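(* Let $\mathscr{A}$ be a Banach algebra that contains a Banach algebra $\mathscr{B}$ (a closed subalgebra of $\mathscr{A}$) which is non-unital, weakly sequentially complete and has a bounded approximate identity. (i) There is a bounded linear map from the quotient space $\mathscr{A}^*/\mathscr{WAP}(\mathscr{A})$ onto $\ell^\infty$. (ii) In particular, $\mathscr{A}$ is non-Arens regular. (iii) If $\mathscr{A}$ is, in addition, separable, then $\mathscr{A}$ is extremely non-Arens regular.
   Context: A bounded approximate identity (bai) in a Banach algebra $\mathscr{B}$ is a bounded net $(e_\alpha)$ in $\mathscr{B}$ with $\lim_\alpha\|ae_\alpha-a\|=\lim_\alpha\|e_\alpha a-a\|=0$ for each $a\in\mathscr{B}$. A Banach space is weakly sequentially complete if every weakly Cauchy sequence converges weakly. For $f\in\mathscr{A}^*$, $\varphi\in\mathscr{A}$, $f\varphi\in\mathscr{A}^*$ is given by $\langle f\varphi,\psi\rangle=\langle f,\varphi\psi\rangle$. $\mathscr{WAP}(\mathscr{A})$ is the closed subspace of all $f\in\mathscr{A}^*$ such that $\{f\varphi:\|\varphi\|\le 1\}$ is relatively weakly compact in $\mathscr{A}^*$. $\mathscr{A}$ is Arens regular if the two Arens products on $\mathscr{A}^{**}$ coincide; by a theorem of Pym this holds iff $\mathscr{WAP}(\mathscr{A})=\mathscr{A}^*$. $\mathscr{A}$ is extremely non-Arens regular (enAr) if $\mathscr{A}^*/\mathscr{WAP}(\mathscr{A})$ contains a closed subspace that admits a surjective bounded linear map onto $\mathscr{A}^*$. *)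

theory Defs
  imports "HOL-Analysis.Analysis"
begin

text \<open>
  Scalars range over a type \<open>'k\<close> of class \<open>{real_normed_field, euclidean_space}\<close>. The types
  \<open>real\<close> and \<open>complex\<close> are instances, and up to isometric isomorphism they are the only ones
  (a finite-dimensional commutative field extension of the reals is the reals or the complex
  numbers), so that real and complex Banach algebras are treated simultaneously.

  As the scalar field is not fixed to be \<open>real\<close>, and as duals and quotients depend on the scalar
  multiplication, normed spaces are records with an explicit carrier.
\<close>

record ('k, 'v) nspace =
  vcarrier :: "'v set"
  vadd :: "'v \<Rightarrow> 'v \<Rightarrow> 'v"
  vscale :: "'k \<Rightarrow> 'v \<Rightarrow> 'v"
  vnorm :: "'v \<Rightarrow> real"

definition scalar_space :: "('k::real_normed_field, 'k) nspace" where
  "scalar_space = \<lparr>vcarrier = UNIV, vadd = (+), vscale = (*), vnorm = norm\<rparr>"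

definition linf :: "('k::real_normed_field, nat \<Rightarrow> 'k) nspace" where
  "linf = \<lparr>vcarrier = {x. bounded (range x)},
           vadd = (\<lambda>x y n. x n + y n),
           vscale = (\<lambda>c x n. c * x n),
           vnorm = (\<lambda>x. SUP n. norm (x n))\<rparr>"

definition subspace_on :: "('k, 'v) nspace \<Rightarrow> 'v set \<Rightarrow> ('k, 'v) nspace" where
  "subspace_on X S = X\<lparr>vcarrier := S\<rparr>"

definition vdist :: "('k::real_normed_field, 'v) nspace \<Rightarrow> 'v \<Rightarrow> 'v \<Rightarrow> real" where
  "vdist X x y = vnorm X (vadd X x (vscale X (- 1) y))"

definition closed_subspace :: "('k::real_normed_field, 'v) nspace \<Rightarrow> 'v set \<Rightarrow> bool" where
  "closed_subspace X S \<longleftrightarrow>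
     S \<subseteq> vcarrier X \<and> S \<noteq> {} \<and>
     (\<forall>x\<in>S. \<forall>y\<in>S. vadd X x y \<in> S) \<and>
     (\<forall>c. \<forall>x\<in>S. vscale X c x \<in> S) \<and>
     (\<forall>x\<in>vcarrier X. (\<forall>\<epsilon>>0. \<exists>y\<in>S. vdist X x y < \<epsilon>) \<longrightarrow> x \<in> S)"

definition bounded_linear_map ::
  "('k::real_normed_field, 'v) nspace \<Rightarrow> ('k, 'w) nspace \<Rightarrow> ('v \<Rightarrow> 'w) \<Rightarrow> bool" where
  "bounded_linear_map X Y T \<longleftrightarrow>
     (\<forall>x\<in>vcarrier X. T x \<in> vcarrier Y) \<and>
     (\<forall>x\<in>vcarrier X. \<forall>y\<in>vcarrier X. T (vadd X x y) = vadd Y (T x) (T y)) \<and>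
     (\<forall>c. \<forall>x\<in>vcarrier X. T (vscale X c x) = vscale Y c (T x)) \<and>
     (\<exists>C. \<forall>x\<in>vcarrier X. vnorm Y (T x) \<le> C * vnorm X x)"

definition bounded_linear_onto ::
  "('k::real_normed_field, 'v) nspace \<Rightarrow> ('k, 'w) nspace \<Rightarrow> ('v \<Rightarrow> 'w) \<Rightarrow> bool" where
  "bounded_linear_onto X Y T \<longleftrightarrow> bounded_linear_map X Y T \<and> T ` vcarrier X = vcarrier Y"

text \<open>Functionals are required to be \<^const>\<open>extensional\<close>, so that two of them are equal as soon as
  they agree on the carrier.\<close>

definition dual :: "('k::real_normed_field, 'v) nspace \<Rightarrow> ('k, 'v \<Rightarrow> 'k) nspace" where
  "dual X =
     \<lparr>vcarrier = {f \<in> extensional (vcarrier X). bounded_linear_map X scalar_space f},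
      vadd = (\<lambda>f g. \<lambda>x\<in>vcarrier X. f x + g x),
      vscale = (\<lambda>c f. \<lambda>x\<in>vcarrier X. c * f x),
      vnorm = (\<lambda>f. SUP x\<in>{x \<in> vcarrier X. vnorm X x \<le> 1}. norm (f x))\<rparr>"

text \<open>The elements of the quotient are the cosets of \<open>W\<close>. Adding \<open>W\<close> in the scalar multiplication
  only matters for the scalar 0, where the result has to be \<open>W\<close> and not \<open>{0}\<close>.\<close>

definition quotient_space :: "('k::real_normed_field, 'v) nspace \<Rightarrow> 'v set \<Rightarrow> ('k, 'v set) nspace" where
  "quotient_space X W =
     \<lparr>vcarrier = {{vadd X x w | w. w \<in> W} | x. x \<in> vcarrier X},
      vadd = (\<lambda>C D. {vadd X x y | x y. x \<in> C \<and> y \<in> D}),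
      vscale = (\<lambda>c C. {vadd X (vscale X c x) w | x w. x \<in> C \<and> w \<in> W}),
      vnorm = (\<lambda>C. INF x\<in>C. vnorm X x)\<rparr>"

definition weak_topology :: "('k::real_normed_field, 'v) nspace \<Rightarrow> 'v topology" where
  "weak_topology X =
     topology_generated_by {{x \<in> vcarrier X. f x \<in> U} | f U. f \<in> vcarrier (dual X) \<and> open U}"

definition relatively_weakly_compact :: "('k::real_normed_field, 'v) nspace \<Rightarrow> 'v set \<Rightarrow> bool" where
  "relatively_weakly_compact X S \<longleftrightarrow>
     compactin (weak_topology X) (weak_topology X closure_of S)"

definition weakly_Cauchy :: "('k::real_normed_field, 'v) nspace \<Rightarrow> (nat \<Rightarrow> 'v) \<Rightarrow> bool" where
  "weakly_Cauchy X x \<longleftrightarrow>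
     (\<forall>n. x n \<in> vcarrier X) \<and> (\<forall>f\<in>vcarrier (dual X). Cauchy (\<lambda>n. f (x n)))"

definition weakly_sequentially_complete :: "('k::real_normed_field, 'v) nspace \<Rightarrow> bool" where
  "weakly_sequentially_complete X \<longleftrightarrow>
     (\<forall>x. weakly_Cauchy X x \<longrightarrow> (\<exists>l. limitin (weak_topology X) x l sequentially))"

text \<open>A Banach algebra over \<open>'k\<close>, not assumed to have a unit. The sort of \<open>'a\<close> makes it a complete
  real normed algebra with submultiplicative norm, to which the scalar multiplication by \<open>'k\<close> is
  added.\<close>

locale banach_algebra = vector_space sc
  for sc :: "'k::{real_normed_field, euclidean_space} \<Rightarrow> 'a::{real_normed_algebra, banach} \<Rightarrow> 'a" +
  assumes scale_of_real: "sc (of_real r) x = r *\<^sub>R x"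
    and norm_scale: "norm (sc c x) = norm c * norm x"
    and mult_scale_left: "sc c x * y = sc c (x * y)"
    and mult_scale_right: "x * sc c y = sc c (x * y)"

definition alg_space :: "('k::real_normed_field \<Rightarrow> 'a::real_normed_algebra \<Rightarrow> 'a) \<Rightarrow> ('k, 'a) nspace"
  where "alg_space sc = \<lparr>vcarrier = UNIV, vadd = (+), vscale = sc, vnorm = norm\<rparr>"

definition closed_subalgebra ::
  "('k::real_normed_field \<Rightarrow> 'a::real_normed_algebra \<Rightarrow> 'a) \<Rightarrow> 'a set \<Rightarrow> bool" where
  "closed_subalgebra sc B \<longleftrightarrow>
     module.subspace sc B \<and> (\<forall>x\<in>B. \<forall>y\<in>B. x * y \<in> B) \<and> closed B"

definition unital :: "'a::real_normed_algebra set \<Rightarrow> bool" where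
  "unital B \<longleftrightarrow> (\<exists>u\<in>B. \<forall>b\<in>B. u * b = b \<and> b * u = b)"

definition directed_set :: "'i set \<Rightarrow> ('i \<Rightarrow> 'i \<Rightarrow> bool) \<Rightarrow> bool" where
  "directed_set D le \<longleftrightarrow>
     D \<noteq> {} \<and> (\<forall>i\<in>D. le i i) \<and>
     (\<forall>i\<in>D. \<forall>j\<in>D. \<forall>k\<in>D. le i j \<longrightarrow> le j k \<longrightarrow> le i k) \<and>
     (\<forall>i\<in>D. \<forall>j\<in>D. \<exists>k\<in>D. le i k \<and> le j k)"

text \<open>Convergence of a net indexed by \<open>D\<close> is convergence along the filter generated by the tails
  of \<open>D\<close>.\<close>

definition tails :: "'i set \<Rightarrow> ('i \<Rightarrow> 'i \<Rightarrow> bool) \<Rightarrow> 'i filter" where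
  "tails D le = (INF i\<in>D. principal {j \<in> D. le i j})"

definition bounded_approximate_identity ::
  "'a::real_normed_algebra set \<Rightarrow> 'i set \<Rightarrow> ('i \<Rightarrow> 'i \<Rightarrow> bool) \<Rightarrow> ('i \<Rightarrow> 'a) \<Rightarrow> bool" where
  "bounded_approximate_identity B D le e \<longleftrightarrow>
     directed_set D le \<and> e ` D \<subseteq> B \<and> bounded (e ` D) \<and>
     (\<forall>a\<in>B. ((\<lambda>i. norm (a * e i - a)) \<longlongrightarrow> 0) (tails D le) \<and>
             ((\<lambda>i. norm (e i * a - a)) \<longlongrightarrow> 0) (tails D le))"

definition WAP ::
  "('k::real_normed_field \<Rightarrow> 'a::real_normed_algebra \<Rightarrow> 'a) \<Rightarrow> ('a \<Rightarrow> 'k) set" where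
  "WAP sc =
     {f \<in> vcarrier (dual (alg_space sc)).
        relatively_weakly_compact (dual (alg_space sc))
          {(\<lambda>\<psi>. f (\<phi> * \<psi>)) | \<phi>. norm \<phi> \<le> 1}}"

text \<open>The two Arens products on the bidual. In the usual notation
  \<open>\<langle>M \<box> N, f\<rangle> = \<langle>M, N f\<rangle>\<close>, \<open>\<langle>N f, \<phi>\<rangle> = \<langle>N, f \<phi>\<rangle>\<close>, \<open>\<langle>f \<phi>, \<psi>\<rangle> = \<langle>f, \<phi> \<psi>\<rangle>\<close> for the first one, and
  \<open>\<langle>M \<diamond> N, f\<rangle> = \<langle>N, f M\<rangle>\<close>, \<open>\<langle>f M, \<psi>\<rangle> = \<langle>M, \<psi> f\<rangle>\<close>, \<open>\<langle>\<psi> f, \<phi>\<rangle> = \<langle>f, \<phi> \<psi>\<rangle>\<close> for the second one.\<close>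

definition arens_fst :: "('k::real_normed_field \<Rightarrow> 'a::real_normed_algebra \<Rightarrow> 'a) \<Rightarrow>
    (('a \<Rightarrow> 'k) \<Rightarrow> 'k) \<Rightarrow> (('a \<Rightarrow> 'k) \<Rightarrow> 'k) \<Rightarrow> (('a \<Rightarrow> 'k) \<Rightarrow> 'k)" where
  "arens_fst sc M N =
     (\<lambda>f\<in>vcarrier (dual (alg_space sc)). M (\<lambda>\<phi>. N (\<lambda>\<psi>. f (\<phi> * \<psi>))))"

definition arens_snd :: "('k::real_normed_field \<Rightarrow> 'a::real_normed_algebra \<Rightarrow> 'a) \<Rightarrow>
    (('a \<Rightarrow> 'k) \<Rightarrow> 'k) \<Rightarrow> (('a \<Rightarrow> 'k) \<Rightarrow> 'k) \<Rightarrow> (('a \<Rightarrow> 'k) \<Rightarrow> 'k)" where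
  "arens_snd sc M N =
     (\<lambda>f\<in>vcarrier (dual (alg_space sc)). N (\<lambda>\<psi>. M (\<lambda>\<phi>. f (\<phi> * \<psi>))))"

definition arens_regular :: "('k::real_normed_field \<Rightarrow> 'a::real_normed_algebra \<Rightarrow> 'a) \<Rightarrow> bool" where
  "arens_regular sc \<longleftrightarrow>
     (\<forall>M\<in>vcarrier (dual (dual (alg_space sc))). \<forall>N\<in>vcarrier (dual (dual (alg_space sc))).
        arens_fst sc M N = arens_snd sc M N)"

definition extremely_non_arens_regular ::
  "('k::real_normed_field \<Rightarrow> 'a::real_normed_algebra \<Rightarrow> 'a) \<Rightarrow> bool" where
  "extremely_non_arens_regular sc \<longleftrightarrow>
     (\<exists>S T. closed_subspace (quotient_space (dual (alg_space sc)) (WAP sc)) S \<and>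
            bounded_linear_onto
              (subspace_on (quotient_space (dual (alg_space sc)) (WAP sc)) S)
              (dual (alg_space sc)) T)"

end

theory Submission
  imports Defs
begin

text \<open>
  A non-unital \<open>\<B>\<close> with a bounded approximate identity contains a bounded sequence \<open>z\<close> that is an
  approximate identity for its own members and has no norm convergent subsequence. If such a
  sequence converges weakly, then it converges in norm; by weak sequential completeness, \<open>z\<close>
  therefore has no weakly Cauchy subsequence, and Rosenthal's \<open>\<ell>\<^sup>1\<close> theorem yields a subsequence on
  which functionals \<open>f\<close> on \<open>\<A>\<close> take arbitrarily prescribed bounded values. Split it into pairs of
  infinite blocks \<open>(x k j)\<^sub>j\<close>, \<open>(y k j)\<^sub>j\<close> for \<open>k \<in> \<nat>\<close>, and take limits along a free ultrafilter. As \<open>x k i * y k j\<close>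
  tends to \<open>x k i\<close> for \<open>j \<longlongrightarrow> \<infinity>\<close> and to \<open>y k j\<close> for \<open>i \<longlongrightarrow> \<infinity>\<close>, the limits of \<open>f (x k j)\<close> and of
  \<open>f (y k j)\<close> are the two iterated limits of \<open>f (x k i * y k j)\<close>. Their difference, as a function of
  \<open>k\<close>, vanishes for weakly almost periodic \<open>f\<close> and takes every value in \<open>\<ell>\<^sup>\<infinity>\<close>.
\<close>

subsection \<open>Ramsey theory and Rosenthal's dichotomy\<close>

text \<open>The approximate identity is a net, so a sequence has to be extracted from it, and a
  single one may well converge in norm, to a unit of the closed subalgebra that it generates. Hence
  two sequences are extracted at once, each absorbing the earlier members of both, with
  corresponding terms a fixed distance apart: if both converged in norm along common indices, each
  limit would absorb the other and they would coincide. A weak limit \<open>l\<close> of such a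
  sequence \<open>z\<close> satisfies \<open>z m * l = z m\<close>, and it lies in the closed
  subspace of all \<open>a\<close> for which \<open>z n * a\<close> tends to \<open>a\<close>; thus
  \<open>z n = z n * l\<close> tends to \<open>l\<close> in norm.

  Interpolation has to cope with real and complex scalars alike. Independence first yields
  functionals that are nearly 1 or -1 in any prescribed pattern; coordinatewise combinations of them
  approximate a bounded sequence up to a fixed fraction, and iteration gives exact values.

  In the bidual, the limits X of \<open>x k j\<close> and Y of \<open>y k j\<close> have X as their
  first and Y as their second Arens product, which makes non-regularity visible without passing
  through the quotient.\<close>

lemma infinite_strict_mono_image:
  fixes \<phi> :: "nat \<Rightarrow> nat"
  assumes "strict_mono \<phi>" "infinite A"
  shows "infinite (\<phi> ` A)"
  using assms finite_image_iff[of \<phi> A] inj_on_subset[OF strict_mono_imp_inj_on[OF assms(1)]]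
  by blast

text \<open>Diagonalisation: the elements of \<open>M\<close> are chosen one at a time, and after
  each choice the reservoir for the later ones is shrunk until it satisfies \<open>P\<close> for all
  of the finitely many subsets of what has been chosen. The tail of \<open>M\<close> beyond
  \<open>s\<close> lies in a reservoir that was treated for \<open>s\<close>, and \<open>P\<close>
  is hereditary.\<close>

lemma fusion_lemma:
  fixes P :: "nat set \<Rightarrow> nat set \<Rightarrow> bool"
  assumes her: "\<And>s M N. \<lbrakk>P s M; N \<subseteq> M; infinite N\<rbrakk> \<Longrightarrow> P s N"
    and ex: "\<And>s M. \<lbrakk>finite s; infinite M; M \<subseteq> M0\<rbrakk> \<Longrightarrow> \<exists>N\<subseteq>M. infinite N \<and> P s N"
    and "infinite M0"
  obtains M where "M \<subseteq> M0" "infinite M"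
    "\<And>s. \<lbrakk>finite s; s \<subseteq> M\<rbrakk> \<Longrightarrow> P s {m \<in> M. \<forall>x\<in>s. x < m}"
proof -
  have ex_fin: "\<exists>N\<subseteq>M. infinite N \<and> (\<forall>s\<in>\<S>. P s N)"
    if "finite \<S>" "\<forall>s\<in>\<S>. finite s" "infinite M" "M \<subseteq> M0" for \<S> M
    using that
  proof (induction \<S> rule: finite_induct)
    case (insert s \<S>)
    then obtain N where N: "N \<subseteq> M" "infinite N" "\<forall>t\<in>\<S>. P t N" by auto
    then obtain N' where N': "N' \<subseteq> N" "infinite N'" "P s N'"
      using ex[of s N] insert by auto
    then show ?case using N her by (metis insert_iff subset_trans)
  qed auto
  define good where "good = (\<lambda>n::nat. \<lambda>(F, M). finite F \<and> infinite M \<and> M \<subseteq> M0 \<and>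
    (\<forall>x\<in>F. \<forall>y\<in>M. x < y) \<and> (\<forall>s\<subseteq>F. P s M) \<and> (n = 0 \<longrightarrow> F = {}))"
  define step where "step = (\<lambda>(F, M) (F', M'). \<exists>m::nat\<in>M. F' = insert m F \<and> M' \<subseteq> M)"
  have "\<exists>f. \<forall>n. good n (f n) \<and> step (f n) (f (Suc n))"
  proof (rule dependent_nat_choice)
    obtain N where "N \<subseteq> M0" "infinite N" "P {} N" using ex[of "{}" M0] assms(3) by auto
    then show "\<exists>x. good 0 x" unfolding good_def by (intro exI[of _ "({}, N)"]) auto
  next
    fix x n assume g: "good n x"
    obtain F M where x: "x = (F, M)" by fastforce
    have M: "finite F" "infinite M" "M \<subseteq> M0" "\<forall>x\<in>F. \<forall>y\<in>M. x < y" "\<forall>s\<subseteq>F. P s M"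
      using g unfolding good_def x by auto
    obtain m where m: "m \<in> M" using M(2) by (metis finite.emptyI equals0I)
    define M1 where "M1 = M - {..m}"
    have M1: "infinite M1" "M1 \<subseteq> M" "M1 \<subseteq> M0" unfolding M1_def using M by auto
    obtain N where N: "N \<subseteq> M1" "infinite N" "\<forall>s\<in>Pow (insert m F). P s N"
    proof -
      have "finite (Pow (insert m F))" "\<forall>s\<in>Pow (insert m F). finite s"
        using M(1) by (auto intro: rev_finite_subset[of "insert m F"])
      then show ?thesis using that ex_fin[OF _ _ M1(1,3)] by metis
    qed
    have "\<forall>x\<in>insert m F. \<forall>y\<in>N. x < y" using M(4) N(1) m by (auto simp: M1_def)
    moreover have "\<forall>s\<subseteq>insert m F. P s N" using N(3) by blast
    moreover have "N \<subseteq> M0" using N(1) M1(3) by blast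
    ultimately have "good (Suc n) (insert m F, N)" unfolding good_def using M(1) N(2) by simp
    moreover have "step x (insert m F, N)" unfolding step_def x using m N M1 by auto
    ultimately show "\<exists>y. good (Suc n) y \<and> step x y" by blast
  qed
  then obtain f where f: "\<And>n. good n (f n)" "\<And>n. step (f n) (f (Suc n))" by blast
  define F where "F = (\<lambda>n. fst (f n))"
  define G where "G = (\<lambda>n. snd (f n))"
  have gd: "G n \<subseteq> M0" "\<forall>x\<in>F n. \<forall>y\<in>G n. x < y" "\<forall>s\<subseteq>F n. P s (G n)" for n
    using f(1)[of n] unfolding good_def F_def G_def by (auto split: prod.splits)
  have F0: "F 0 = {}"
    using f(1)[of 0] unfolding good_def F_def G_def by (auto split: prod.splits)
  have "\<exists>m. m \<in> G n \<and> F (Suc n) = insert m (F n)" and Gdec: "G (Suc n) \<subseteq> G n" for n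
    using f(2)[of n] unfolding step_def F_def G_def by (auto split: prod.splits)
  then obtain m where m: "\<And>n. m n \<in> G n" "\<And>n. F (Suc n) = insert (m n) (F n)" by metis
  have F: "F n = m ` {..<n}" for n
    by (induction n) (auto simp: F0 m(2) lessThan_Suc)
  have Gmono: "G j \<subseteq> G i" if "i \<le> j" for i j
    using lift_Suc_antimono_le[of G, OF Gdec that] .
  have strict: "m i < m j" if "i < j" for i j
    using gd(2)[of j] m(1)[of j] that by (auto simp: F)
  then have sm: "strict_mono m" by (simp add: strict_mono_def)
  show thesis
  proof
    show "range m \<subseteq> M0" using m(1) gd(1) by blast
    show "infinite (range m)" using sm by (simp add: range_inj_infinite strict_mono_imp_inj_on)
  next
    fix s assume s: "finite s" "s \<subseteq> range m"
    then obtain I where I: "s = m ` I" "finite I"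
      by (metis finite_subset_image subset_UNIV)
    \<comment> \<open>The first stage at which all of \<open>s\<close> has been chosen; everything
      in \<open>M\<close> beyond \<open>s\<close> is chosen from then on.\<close>
    define n where "n = (if I = {} then 0 else Suc (Max I))"
    have In: "i < n" if "i \<in> I" for i using that I by (auto simp: n_def le_imp_less_Suc)
    have "{y \<in> range m. \<forall>x\<in>s. x < y} \<subseteq> G n"
    proof clarify
      fix k assume k: "\<forall>x\<in>s. x < m k"
      have "n \<le> k"
      proof (cases "I = {}")
        case False
        then have "m (Max I) < m k" using k I by auto
        then show ?thesis using False sm by (auto simp: n_def strict_mono_less)
      qed (simp add: n_def)
      then show "m k \<in> G n" using Gmono m by blast
    qed
    moreover have "infinite {y \<in> range m. \<forall>x\<in>s. x < y}"
    proof (rule infinite_super)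
      show "m ` {n..} \<subseteq> {y \<in> range m. \<forall>x\<in>s. x < y}"
        using In I strict by fastforce
      show "infinite (m ` {n..})"
        using infinite_strict_mono_image[OF sm infinite_Ici] .
    qed
    moreover have "P s (G n)"
    proof -
      have "s \<subseteq> F n" using In I(1) F by blast
      then show ?thesis using gd(3) by blast
    qed
    ultimately show "P s {m' \<in> range m. \<forall>x\<in>s. x < m'}" using her by blast
  qed
qed

section \<open>Galvin's lemma on families of finite sets\<close>

definition initial_segment :: "nat set \<Rightarrow> nat set \<Rightarrow> bool" where
  "initial_segment t X \<longleftrightarrow> finite t \<and> t \<subseteq> X \<and> (\<forall>x\<in>X. \<forall>y\<in>t. x \<le> y \<longrightarrow> x \<in> t)"

text \<open>Acceptance and rejection as in combinatorial forcing (Galvin and Prikry). Rejection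
  means that no infinite subset accepts, so that every infinite set contains one that decides
  \<open>s\<close>.\<close>

definition accepts :: "nat set set \<Rightarrow> nat set \<Rightarrow> nat set \<Rightarrow> bool" where
  "accepts \<D> s M \<longleftrightarrow> (\<forall>L\<subseteq>M. infinite L \<longrightarrow> (\<forall>x\<in>s. \<forall>y\<in>L. x < y) \<longrightarrow>
     (\<exists>t\<in>\<D>. initial_segment t (s \<union> L)))"

definition rejects :: "nat set set \<Rightarrow> nat set \<Rightarrow> nat set \<Rightarrow> bool" where
  "rejects \<D> s M \<longleftrightarrow> (\<forall>N\<subseteq>M. infinite N \<longrightarrow> \<not> accepts \<D> s N)"

lemma accepts_mono: "accepts \<D> s M \<Longrightarrow> N \<subseteq> M \<Longrightarrow> accepts \<D> s N"
  unfolding accepts_def by blast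

lemma rejects_mono: "rejects \<D> s M \<Longrightarrow> N \<subseteq> M \<Longrightarrow> rejects \<D> s N"
  unfolding rejects_def by blast

text \<open>Acceptance only looks at elements beyond \<open>s\<close>, so the tails produced by
  \<open>fusion_lemma\<close> can be replaced by the whole set; \<open>rejects_tail\<close> does the
  same for rejection.\<close>

lemma accepts_tail: "accepts \<D> s {m \<in> M. \<forall>x\<in>s. x < m} \<longleftrightarrow> accepts \<D> s M"
proof
  assume a: "accepts \<D> s {m \<in> M. \<forall>x\<in>s. x < m}"
  show "accepts \<D> s M"
    unfolding accepts_def
  proof (intro allI impI)
    fix L assume L: "L \<subseteq> M" "infinite L" "\<forall>x\<in>s. \<forall>y\<in>L. x < y"
    then have "L \<subseteq> {m \<in> M. \<forall>x\<in>s. x < m}" by blast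
    then show "\<exists>t\<in>\<D>. initial_segment t (s \<union> L)" using a L unfolding accepts_def by blast
  qed
next
  show "accepts \<D> s {m \<in> M. \<forall>x\<in>s. x < m}" if "accepts \<D> s M"
    using accepts_mono[OF that] by simp
qed

lemma infinite_tail:
  fixes M :: "nat set"
  assumes "finite s" "infinite M" shows "infinite {m \<in> M. \<forall>x\<in>s. x < m}"
proof
  assume f: "finite {m \<in> M. \<forall>x\<in>s. x < m}"
  have "M \<subseteq> {m \<in> M. \<forall>x\<in>s. x < m} \<union> (\<Union>x\<in>s. {..x})" by (auto simp: not_less)
  moreover have "finite ({m \<in> M. \<forall>x\<in>s. x < m} \<union> (\<Union>x\<in>s. {..x}))" using f assms(1) by simp
  ultimately show False using assms(2) finite_subset by blast
qed

lemma rejects_tail: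
  assumes "finite s"
  shows "rejects \<D> s {m \<in> M. \<forall>x\<in>s. x < m} \<longleftrightarrow> rejects \<D> s M"
proof
  assume r: "rejects \<D> s {m \<in> M. \<forall>x\<in>s. x < m}"
  show "rejects \<D> s M"
    unfolding rejects_def
  proof (intro allI impI)
    fix N assume N: "N \<subseteq> M" "infinite N"
    have "{m \<in> N. \<forall>x\<in>s. x < m} \<subseteq> {m \<in> M. \<forall>x\<in>s. x < m}" using N by blast
    then have "\<not> accepts \<D> s {m \<in> N. \<forall>x\<in>s. x < m}"
      using r infinite_tail[OF assms N(2)] unfolding rejects_def by blast
    then show "\<not> accepts \<D> s N" by (simp add: accepts_tail)
  qed
next
  show "rejects \<D> s {m \<in> M. \<forall>x\<in>s. x < m}" if "rejects \<D> s M"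
    using rejects_mono[OF that] by simp
qed

text \<open>A first fusion yields an \<open>M0\<close> that decides each of its finite subsets. If
  it accepts the empty set, the second alternative holds. Otherwise a rejected \<open>s\<close>
  becomes accepted by adding \<open>n\<close> for only finitely many \<open>n\<close> beyond
  \<open>s\<close>, and a second fusion produces \<open>M\<close> all of whose finite subsets are
  rejected; none of them is in \<open>\<D>\<close>, as a finite member of \<open>\<D>\<close> is an
  initial segment of each of its end-extensions.\<close>

lemma galvin_lemma:
  obtains M where "infinite M"
    "(\<forall>s\<in>\<D>. finite s \<longrightarrow> \<not> s \<subseteq> M) \<or> (\<forall>L\<subseteq>M. infinite L \<longrightarrow> (\<exists>t\<in>\<D>. initial_segment t L))"
proof -
  obtain M0 where M0: "infinite M0"
    "\<And>s. \<lbrakk>finite s; s \<subseteq> M0\<rbrakk> \<Longrightarrow> accepts \<D> s {m \<in> M0. \<forall>x\<in>s. x < m} \<or> rejects \<D> s {m \<in> M0. \<forall>x\<in>s. x < m}"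
  proof (rule fusion_lemma[of "\<lambda>s M. accepts \<D> s M \<or> rejects \<D> s M" UNIV])
    show "\<exists>N\<subseteq>M. infinite N \<and> (accepts \<D> s N \<or> rejects \<D> s N)" if "infinite M" for s M
      using that unfolding rejects_def by blast
    show "accepts \<D> s N \<or> rejects \<D> s N"
      if "accepts \<D> s M \<or> rejects \<D> s M" "N \<subseteq> M" for s M N
      using that accepts_mono[of \<D> s M N] rejects_mono[of \<D> s M N] by blast
  qed auto
  have decided: "accepts \<D> s M0 \<or> rejects \<D> s M0" if "finite s" "s \<subseteq> M0" for s
    using M0(2)[OF that] by (simp add: accepts_tail rejects_tail that)
  show thesis
  proof (cases "accepts \<D> {} M0")
    case True
    then show thesis using that[of M0] M0 unfolding accepts_def by auto
  next
    case False
    then have rej0: "rejects \<D> {} M0" using decided by blast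
    obtain M where M: "M \<subseteq> M0" "infinite M"
      "\<And>s. \<lbrakk>finite s; s \<subseteq> M\<rbrakk> \<Longrightarrow> s \<subseteq> M0 \<longrightarrow> rejects \<D> s M0 \<longrightarrow>
        (\<forall>n\<in>{m \<in> M. \<forall>x\<in>s. x < m}. (\<forall>x\<in>s. x < n) \<longrightarrow> rejects \<D> (insert n s) M0)"
    proof (rule fusion_lemma[of "\<lambda>s M. s \<subseteq> M0 \<longrightarrow> rejects \<D> s M0 \<longrightarrow>
        (\<forall>n\<in>M. (\<forall>x\<in>s. x < n) \<longrightarrow> rejects \<D> (insert n s) M0)" M0])
      fix s M :: "nat set" assume s: "finite s" and M: "infinite M" "M \<subseteq> M0"
      define E where "E = {n \<in> M. (\<forall>x\<in>s. x < n) \<and> \<not> rejects \<D> (insert n s) M0}"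
      show "\<exists>N\<subseteq>M. infinite N \<and> (s \<subseteq> M0 \<longrightarrow> rejects \<D> s M0 \<longrightarrow>
        (\<forall>n\<in>N. (\<forall>x\<in>s. x < n) \<longrightarrow> rejects \<D> (insert n s) M0))"
      proof (cases "s \<subseteq> M0 \<and> rejects \<D> s M0")
        case True
        \<comment> \<open>An infinite \<open>L\<close> in \<open>E\<close> beyond \<open>s\<close>
          has a least element \<open>n\<close>; since \<open>M0\<close> accepts
          \<open>insert n s\<close>, some initial segment of \<open>s \<union> L\<close> is in
          \<open>\<D>\<close>. So \<open>E\<close> accepts \<open>s\<close>, and it has to be finite
          because \<open>M0\<close> rejects \<open>s\<close>.\<close>
        have "accepts \<D> s E"
          unfolding accepts_def
        proof (intro allI impI)
          fix L assume L: "L \<subseteq> E" "infinite L" "\<forall>x\<in>s. \<forall>y\<in>L. x < y"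
          define n where "n = (LEAST n. n \<in> L)"
          have n: "n \<in> L" unfolding n_def using L(2) by (metis LeastI finite.emptyI equals0I)
          have nl: "n \<le> y" if "y \<in> L" for y unfolding n_def using that by (rule Least_le)
          have "insert n s \<subseteq> M0" using n L True M E_def by auto
          then have "accepts \<D> (insert n s) M0"
            using n L decided[of "insert n s"] s unfolding E_def by auto
          moreover have "L - {n} \<subseteq> M0" "infinite (L - {n})" using L M E_def by auto
          moreover have "\<forall>x\<in>insert n s. \<forall>y\<in>L - {n}. x < y" using L nl by force
          ultimately have "\<exists>t\<in>\<D>. initial_segment t (insert n s \<union> (L - {n}))"
            unfolding accepts_def by blast
          moreover have "insert n s \<union> (L - {n}) = s \<union> L" using n by auto
          ultimately show "\<exists>t\<in>\<D>. initial_segment t (s \<union> L)" by simp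
        qed
        moreover have "E \<subseteq> M0" using M by (auto simp: E_def)
        ultimately have "finite E" using True unfolding rejects_def by blast
        then show ?thesis using M by (intro exI[of _ "M - E"]) (auto simp: E_def)
      qed (use M in blast)
    qed (use M0 in auto)
    have rej: "rejects \<D> s M0" if "finite s" "s \<subseteq> M" for s
      using that
    proof (induction s rule: finite_linorder_max_induct)
      case (insert b s)
      then show ?case using M by auto
    qed (use rej0 in simp)
    have "\<not> s \<subseteq> M" if "s \<in> \<D>" "finite s" for s
    proof
      assume "s \<subseteq> M"
      then have "rejects \<D> s M0" using rej that by blast
      moreover have "accepts \<D> s M0"
        unfolding accepts_def initial_segment_def using that by fastforce
      ultimately show False using M0 unfolding rejects_def by blast
    qed
    then have "\<forall>s\<in>\<D>. finite s \<longrightarrow> \<not> s \<subseteq> M" by blast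
    then show thesis using that[OF M(2)] by blast
  qed
qed

text \<open>\<open>galvin_lemma\<close> is applied to the finite sets whose alternating pattern
  \<open>A\<close>, \<open>B\<close>, \<open>A\<close>, ... is realised by no point of
  \<open>S\<close>. The hypothesis excludes its second alternative: an increasing sequence can be
  picked that alternates between the two infinite sets of indices, and \<open>s\<close> realises the
  pattern on all its initial segments. What remains is the passage from alternating to arbitrary
  patterns.\<close>

lemma rosenthal_independent_pairs:
  fixes A B :: "nat \<Rightarrow> 's set"
  assumes osc: "\<And>M. infinite M \<Longrightarrow> \<exists>s\<in>S. infinite {n\<in>M. s \<in> A n} \<and> infinite {n\<in>M. s \<in> B n}"
  obtains \<phi> :: "nat \<Rightarrow> nat" where "strict_mono \<phi>"
    "\<And>N \<sigma>. \<exists>s\<in>S. \<forall>i<N. s \<in> (if \<sigma> i then A (\<phi> i) else B (\<phi> i))"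
proof -
  \<comment> \<open>The rank of \<open>x\<close> in \<open>t\<close>, not \<open>x\<close> itself,
    decides between \<open>A\<close> and \<open>B\<close>; this is what allows a pattern to be
    steered by inserting further elements.\<close>
  define alt where "alt = (\<lambda>t s. \<forall>x\<in>t. s \<in> (if even (card {y\<in>t. y < x}) then A x else B x))"
  define \<D> where "\<D> = {t. finite t \<and> \<not> (\<exists>s\<in>S. alt t s)}"
  obtain M where M: "infinite M" and dich: "(\<forall>s\<in>\<D>. finite s \<longrightarrow> \<not> s \<subseteq> M) \<or>
      (\<forall>L\<subseteq>M. infinite L \<longrightarrow> (\<exists>t\<in>\<D>. initial_segment t L))"
    by (rule galvin_lemma)
  have "\<exists>L\<subseteq>M. infinite L \<and> (\<forall>t. initial_segment t L \<longrightarrow> t \<notin> \<D>)"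
  proof -
    obtain s where s: "s \<in> S" "infinite {n\<in>M. s \<in> A n}" "infinite {n\<in>M. s \<in> B n}"
      using osc[OF M] by blast
    define C where "C = (\<lambda>n::nat. if even n then {n\<in>M. s \<in> A n} else {n\<in>M. s \<in> B n})"
    have C: "infinite (C n)" for n using s C_def by auto
    have "\<exists>l. \<forall>n. l n \<in> C n \<and> l n < l (Suc n)"
    proof (rule dependent_nat_choice)
      show "\<exists>x. x \<in> C 0" using C[of 0] by (metis finite.emptyI equals0I)
      show "\<exists>y. y \<in> C (Suc n) \<and> x < y" for x n
        using C[of "Suc n"] by (metis infinite_nat_iff_unbounded)
    qed
    then obtain l where l: "\<And>n. l n \<in> C n" "\<And>n. l n < l (Suc n)" by blast
    have sm: "strict_mono l" using l by (simp add: strict_mono_Suc_iff)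
    have "alt t s" if t: "initial_segment t (range l)" for t
      unfolding alt_def
    proof
      fix x assume x: "x \<in> t"
      then obtain j where j: "x = l j" using t unfolding initial_segment_def by auto
      have "{y\<in>t. y < x} = l ` {..<j}"
      proof (intro equalityI subsetI)
        fix y assume y: "y \<in> {y\<in>t. y < x}"
        then obtain i where "y = l i" using t unfolding initial_segment_def by auto
        then show "y \<in> l ` {..<j}" using y j sm by (auto simp: strict_mono_less)
      next
        fix y assume "y \<in> l ` {..<j}"
        then show "y \<in> {y\<in>t. y < x}"
          using t x j sm unfolding initial_segment_def
            by (auto simp: strict_mono_less) (metis less_imp_le rangeI strict_mono_less)
      qed
      then have "card {y\<in>t. y < x} = j"
        using sm by (simp add: card_image strict_mono_imp_inj_on inj_on_subset)
      then show "s \<in> (if even (card {y\<in>t. y < x}) then A x else B x)"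
        using l(1)[of j] j by (auto simp: C_def split: if_splits)
    qed
    then have "\<forall>t. initial_segment t (range l) \<longrightarrow> t \<notin> \<D>" using s \<D>_def by blast
    moreover have "C n \<subseteq> M" for n by (auto simp: C_def)
    then have "range l \<subseteq> M" using l by blast
    moreover have "infinite (range l)"
      using sm by (simp add: range_inj_infinite strict_mono_imp_inj_on)
    ultimately show ?thesis by blast
  qed
  then have alt_ex: "\<exists>s\<in>S. alt t s" if "finite t" "t \<subseteq> M" for t
    using dich that unfolding \<D>_def by blast
  define m where "m = enumerate M"
  have sm: "strict_mono m" using M by (simp add: m_def strict_mono_enumerate)
  have mM: "m i \<in> M" for i using M by (simp add: m_def enumerate_in_set)
  text \<open>The elements of even index are fillers, which adjust the parity of the rank.\<close>
  have fill: "\<exists>t\<subseteq>m ` {..<2*N}. \<forall>i<N. m (2*i+1) \<in> t \<and> (even (card {y\<in>t. y < m (2*i+1)}) \<longleftrightarrow> \<sigma> i)"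
    for N and \<sigma> :: "nat \<Rightarrow> bool"
  proof (induction N)
    case (Suc N)
    then obtain t where t: "t \<subseteq> m ` {..<2*N}"
      "\<forall>i<N. m (2*i+1) \<in> t \<and> (even (card {y\<in>t. y < m (2*i+1)}) \<longleftrightarrow> \<sigma> i)" by blast
    have fin: "finite t" using finite_subset[OF t(1)] by simp
    have tl: "y < m (2*N)" if "y \<in> t" for y using t(1) that sm by (auto simp: strict_mono_less)
    define t' where "t' = (if even (card t) = \<sigma> N then t else insert (m (2*N)) t)"
    have t'l: "y < m (2*N+1)" if "y \<in> t'" for y
      using that tl[of y] sm by (auto simp: t'_def strict_mono_less split: if_splits
          intro: less_trans[of _ "m (2*N)"])
    have ct': "even (card t') = \<sigma> N" unfolding t'_def using fin tl by (auto simp: card_insert_if)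
    define u where "u = insert (m (2*N+1)) t'"
    have old: "{y\<in>u. y < m (2*i+1)} = {y\<in>t. y < m (2*i+1)}" if "i < N" for i
      using that sm by (auto simp: u_def t'_def strict_mono_less)
    have new: "{y\<in>u. y < m (2*N+1)} = t'" using t'l by (auto simp: u_def)
    have "u \<subseteq> m ` {..<2 * Suc N}" using t(1) by (auto simp: u_def t'_def)
    moreover have "m (2*i+1) \<in> u \<and> (even (card {y\<in>u. y < m (2*i+1)}) \<longleftrightarrow> \<sigma> i)" if "i < Suc N" for i
    proof (cases "i = N")
      case True
      then show ?thesis using new ct' by (auto simp: u_def)
    next
      case False
      then have "i < N" using that by simp
      then show ?thesis using old[of i] t(2) by (auto simp: u_def t'_def)
    qed
    ultimately show ?case by blast
  qed auto
  show thesis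
  proof
    show "strict_mono (\<lambda>i. m (2*i+1))"
      by (intro strict_monoI) (simp add: strict_mono_less[OF sm])
    show "\<exists>s\<in>S. \<forall>i<N. s \<in> (if \<sigma> i then A (m (2*i+1)) else B (m (2*i+1)))" for N \<sigma>
    proof -
      obtain t where t: "t \<subseteq> m ` {..<2*N}"
        "\<forall>i<N. m (2*i+1) \<in> t \<and> (even (card {y\<in>t. y < m (2*i+1)}) \<longleftrightarrow> \<sigma> i)"
        using fill[of N \<sigma>] by blast
      have "finite t" using finite_subset[OF t(1)] by simp
      moreover have "t \<subseteq> M" using t(1) mM by blast
      ultimately obtain s where s: "s \<in> S" "alt t s" using alt_ex by blast
      have "s \<in> (if \<sigma> i then A (m (2*i+1)) else B (m (2*i+1)))" if "i < N" for i
        using s(2)[unfolded alt_def, rule_format, of "m (2*i+1)"] t(2)[rule_format, OF that] by simp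
      then show ?thesis using s(1) by blast
    qed
  qed
qed

section \<open>The dichotomy for bounded sequences of functions\<close>

lemma bounded_not_convergent_two_limits:
  fixes x :: "nat \<Rightarrow> 'k::euclidean_space"
  assumes "bounded (range x)" "\<not> convergent x"
  obtains z z' where "z \<noteq> z'" "\<And>r. r > 0 \<Longrightarrow> infinite {n. dist (x n) z < r}"
    "\<And>r. r > 0 \<Longrightarrow> infinite {n. dist (x n) z' < r}"
proof -
  have inf: "infinite {n. dist (x n) l < r}"
    if lim: "(x \<circ> \<phi>) \<longlonglongrightarrow> l" and sm: "strict_mono \<phi>" and "r > 0" for \<phi> l r
  proof -
    obtain N where N: "\<And>n. n \<ge> N \<Longrightarrow> dist (x (\<phi> n)) l < r"
      using metric_LIMSEQ_D[OF lim \<open>r > 0\<close>] by auto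
    have "\<phi> ` {N..} \<subseteq> {n. dist (x n) l < r}" using N by auto
    moreover have "infinite (\<phi> ` {N..})"
      using infinite_strict_mono_image[OF sm infinite_Ici] .
    ultimately show ?thesis using infinite_super by blast
  qed
  obtain z \<phi> where z: "strict_mono \<phi>" "(x \<circ> \<phi>) \<longlonglongrightarrow> z"
    using bounded_imp_convergent_subsequence[OF assms(1)] by blast
  have "\<not> x \<longlonglongrightarrow> z" using assms(2) convergent_def by blast
  then obtain d where d: "d > 0" "\<forall>N. \<exists>n\<ge>N. dist (x n) z \<ge> d"
    by (auto simp: lim_sequentially not_less)
  define E where "E = {n. dist (x n) z \<ge> d}"
  have E: "infinite E" using d(2) by (auto simp: E_def infinite_nat_iff_unbounded_le)
  define e where "e = enumerate E"
  have e: "strict_mono e" "\<And>n. e n \<in> E" using E by (auto simp: e_def strict_mono_enumerate enumerate_in_set)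
  have "bounded (range (x \<circ> e))" using assms(1) by (rule bounded_subset) auto
  then obtain z' \<psi> where z': "strict_mono \<psi>" "((x \<circ> e) \<circ> \<psi>) \<longlonglongrightarrow> z'"
    using bounded_imp_convergent_subsequence by blast
  have "(\<lambda>n. dist (x (e (\<psi> n))) z) \<longlonglongrightarrow> dist z' z"
    using z'(2) by (auto simp: o_def intro!: tendsto_dist)
  then have "dist z' z \<ge> d" using e(2) by (intro LIMSEQ_le_const) (auto simp: E_def)
  then have "z \<noteq> z'" using d by auto
  moreover have "strict_mono (e \<circ> \<psi>)" using e z' by (simp add: strict_mono_o)
  moreover have "(x \<circ> (e \<circ> \<psi>)) \<longlonglongrightarrow> z'" using z'(2) by (simp add: o_assoc)
  ultimately show thesis using that inf z by blast
qed

text \<open>Comparing the radius with the distance of the centres makes the argument work for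
  complex scalars (Dor) as well as for real ones.\<close>

lemma rosenthal_dor_dichotomy:
  fixes g :: "nat \<Rightarrow> 's \<Rightarrow> 'k::euclidean_space"
  assumes bdd: "\<And>n s. s \<in> S \<Longrightarrow> norm (g n s) \<le> C" and "\<eta> > 0"
    and no_conv: "\<And>\<phi>. strict_mono \<phi> \<Longrightarrow> \<exists>s\<in>S. \<not> convergent (\<lambda>n. g (\<phi> n) s)"
  obtains a b and \<phi> :: "nat \<Rightarrow> nat" where "a \<noteq> b" "strict_mono \<phi>"
    "\<And>N \<sigma>. \<exists>s\<in>S. \<forall>i<N. dist (g (\<phi> i) s) (if \<sigma> i then a else b) < \<eta> * dist a b"
proof -
  obtain Q0 :: "'k set" where Q0: "countable Q0" "\<And>X. open X \<Longrightarrow> X \<noteq> {} \<Longrightarrow> \<exists>q\<in>Q0. q \<in> X"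
    using countable_dense_setE by blast
  \<comment> \<open>Pairs of centres are restricted to a countable dense set, so that a diagonal
    argument can run through all of them.\<close>
  define q where "q = from_nat_into (Q0 \<times> Q0)"
  have q: "\<exists>k. q k = (a, b)" if "a \<in> Q0" "b \<in> Q0" for a b
    using from_nat_into_surj[of "Q0 \<times> Q0" "(a, b)"] Q0 that by (auto simp: q_def)
  define near where "near = (\<lambda>k c M s. infinite {n\<in>M. dist (g n s) c < \<eta> * dist (fst (q k)) (snd (q k))})"
  define good where "good = (\<lambda>k M. \<forall>s\<in>S. \<not> (near k (fst (q k)) M s \<and> near k (snd (q k)) M s))"
  have near_mono: "near k c N s" if "near k c M s" "finite (M - N)" for k c M N s
    unfolding near_def
  proof
    assume "finite {n\<in>N. dist (g n s) c < \<eta> * dist (fst (q k)) (snd (q k))}"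
    then have "finite ({n\<in>N. dist (g n s) c < \<eta> * dist (fst (q k)) (snd (q k))} \<union> (M - N))"
      using that by simp
    then have "finite {n\<in>M. dist (g n s) c < \<eta> * dist (fst (q k)) (snd (q k))}"
      by (rule rev_finite_subset) auto
    then show False using that(1) unfolding near_def by blast
  qed
  have good_mono: "good k N" if "good k M" "finite (N - M)" for k M N
    using that near_mono unfolding good_def by blast
  have "\<exists>k M. infinite M \<and> (\<forall>N\<subseteq>M. infinite N \<longrightarrow> \<not> good k N)"
  proof (rule ccontr)
    assume "\<not> ?thesis"
    then have ex: "\<exists>N\<subseteq>M. infinite N \<and> good k N" if "infinite M" for k M using that by blast
    \<comment> \<open>With a predicate that sees only the cardinality of \<open>s\<close>, fusion
      becomes the usual diagonal sequence: up to finitely many elements, \<open>M\<close> is good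
      for every \<open>k\<close>.\<close>
    obtain M where M: "infinite M"
      "\<And>s. \<lbrakk>finite s; s \<subseteq> M\<rbrakk> \<Longrightarrow> good (card s) {m \<in> M. \<forall>x\<in>s. x < m}"
    proof (rule fusion_lemma[of "\<lambda>s. good (card s)" UNIV])
      show "good (card s) N" if "good (card s) M" "N \<subseteq> M" for s M N
        using that good_mono[of "card s" M N] by (simp add: Diff_eq_empty_iff[THEN iffD2])
    qed (use ex in auto)
    have goodM: "good k M" for k
    proof -
      obtain s where s: "s \<subseteq> M" "finite s" "card s = k"
        using infinite_arbitrarily_large[OF M(1)] by blast
      have "M - {m \<in> M. \<forall>x\<in>s. x < m} \<subseteq> (\<Union>x\<in>s. {..x})" by (auto simp: not_less)
      moreover have "finite (\<Union>x\<in>s. {..x})" using s(2) by simp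
      ultimately have "finite (M - {m \<in> M. \<forall>x\<in>s. x < m})" by (rule finite_subset)
      then show ?thesis using good_mono M(2) s by blast
    qed
    define \<phi> where "\<phi> = enumerate M"
    have \<phi>: "strict_mono \<phi>" "\<And>n. \<phi> n \<in> M"
      using M by (auto simp: \<phi>_def strict_mono_enumerate enumerate_in_set)
    obtain s where s: "s \<in> S" "\<not> convergent (\<lambda>n. g (\<phi> n) s)" using no_conv[OF \<phi>(1)] by blast
    have "bounded (range (\<lambda>n. g (\<phi> n) s))" using bdd s by (auto simp: bounded_iff)
    then obtain z z' where z: "z \<noteq> z'"
      "\<And>r. r > 0 \<Longrightarrow> infinite {n. dist (g (\<phi> n) s) z < r}"
      "\<And>r. r > 0 \<Longrightarrow> infinite {n. dist (g (\<phi> n) s) z' < r}"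
      using bounded_not_convergent_two_limits[OF _ s(2)] by blast
    \<comment> \<open>The solution of \<open>\<eta> * (dist z z' - 2 * \<rho>) = 2 * \<rho>\<close>.
      Centres within \<open>\<rho>\<close> of the two cluster points are at least
      \<open>dist z z' - 2 * \<rho>\<close> apart, so the radius \<open>\<eta> * dist a b\<close>
      allowed for them is at least \<open>2 * \<rho>\<close> and covers the
      \<open>\<rho>\<close>-balls about the cluster points.\<close>
    define \<rho> where "\<rho> = \<eta> * dist z z' / (2 + 2 * \<eta>)"
    have \<rho>: "\<rho> > 0" using z \<open>\<eta> > 0\<close> by (simp add: \<rho>_def)
    have \<rho>eq: "\<eta> * (dist z z' - 2 * \<rho>) = 2 * \<rho>" using \<open>\<eta> > 0\<close> by (simp add: \<rho>_def field_simps)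
    obtain a where a: "a \<in> Q0" "dist z a < \<rho>" using Q0(2)[of "ball z \<rho>"] \<rho> by auto
    obtain b where b: "b \<in> Q0" "dist z' b < \<rho>" using Q0(2)[of "ball z' \<rho>"] \<rho> by auto
    obtain k where k: "q k = (a, b)" using q a b by blast
    have "dist z z' \<le> dist z a + dist a b + dist z' b"
      using dist_triangle[of z z' a] dist_triangle[of a z' b] by (simp add: dist_commute)
    then have "dist z z' - 2 * \<rho> \<le> dist a b" using a b by linarith
    then have "\<eta> * (dist z z' - 2 * \<rho>) \<le> \<eta> * dist a b" using \<open>\<eta> > 0\<close> by (intro mult_left_mono) auto
    then have rad: "2 * \<rho> \<le> \<eta> * dist a b" by (simp add: \<rho>eq)
    have nearI: "near k c M s"
      if "dist w c < \<rho>" "\<And>r. r > 0 \<Longrightarrow> infinite {n. dist (g (\<phi> n) s) w < r}" for c w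
    proof -
      have "\<phi> ` {n. dist (g (\<phi> n) s) w < \<rho>} \<subseteq> {n\<in>M. dist (g n s) c < \<eta> * dist a b}"
      proof clarify
        fix n assume "dist (g (\<phi> n) s) w < \<rho>"
        moreover have "dist (g (\<phi> n) s) c \<le> dist (g (\<phi> n) s) w + dist w c" by (rule dist_triangle)
        ultimately show "\<phi> n \<in> M \<and> dist (g (\<phi> n) s) c < \<eta> * dist a b" using \<phi> that(1) rad by auto
      qed
      moreover have "infinite (\<phi> ` {n. dist (g (\<phi> n) s) w < \<rho>})"
        using infinite_strict_mono_image[OF \<phi>(1) that(2)[OF \<rho>]] .
      ultimately show ?thesis unfolding near_def k by (auto dest: infinite_super)
    qed
    have "near k a M s" "near k b M s" using nearI a b z by blast+
    then show False using goodM[of k] s unfolding good_def by (auto simp: k)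
  qed
  then obtain k M where kM: "infinite M" "\<And>N. \<lbrakk>N \<subseteq> M; infinite N\<rbrakk> \<Longrightarrow> \<not> good k N" by blast
  obtain a b where ab: "q k = (a, b)" by fastforce
  define m where "m = enumerate M"
  have m: "strict_mono m" "\<And>n. m n \<in> M"
    using kM by (auto simp: m_def strict_mono_enumerate enumerate_in_set)
  \<comment> \<open>Failure of \<open>good\<close> on every infinite subset of \<open>M\<close> is
    the oscillation hypothesis for the sets of points where the function is close to
    \<open>a\<close> or close to \<open>b\<close>.\<close>
  define U where "U = (\<lambda>c n. {s. dist (g (m n) s) c < \<eta> * dist a b})"
  have osc: "\<exists>s\<in>S. infinite {n\<in>N. s \<in> U a n} \<and> infinite {n\<in>N. s \<in> U b n}" if N: "infinite N" for N
  proof -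
    have "infinite (m ` N)" by (rule infinite_strict_mono_image[OF m(1) N])
    then have "\<not> good k (m ` N)" using kM(2) m by blast
    then obtain s where s: "s \<in> S" "near k a (m ` N) s" "near k b (m ` N) s"
      unfolding good_def by (auto simp: ab)
    have "infinite {n\<in>N. s \<in> U c n}" if "near k c (m ` N) s" for c
    proof
      assume "finite {n\<in>N. s \<in> U c n}"
      then have "finite (m ` {n\<in>N. s \<in> U c n})" by simp
      moreover have "m ` {n\<in>N. s \<in> U c n} = {n\<in>m ` N. dist (g n s) c < \<eta> * dist a b}"
        by (auto simp: U_def)
      ultimately show False using that unfolding near_def by (simp add: ab)
    qed
    then show ?thesis using s by blast
  qed
  obtain \<psi> :: "nat \<Rightarrow> nat" where \<psi>: "strict_mono \<psi>"
    "\<And>N \<sigma>. \<exists>s\<in>S. \<forall>i<N. s \<in> (if \<sigma> i then U a (\<psi> i) else U b (\<psi> i))"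
    using rosenthal_independent_pairs[of S "U a" "U b"] osc by blast
  have ne: "a \<noteq> b"
  proof
    assume "a = b"
    then show False using \<psi>(2)[of 1 "\<lambda>_. True"] by (auto simp: U_def)
  qed
  have sm: "strict_mono (m \<circ> \<psi>)" using m \<psi> by (simp add: strict_mono_o)
  have ind: "\<exists>s\<in>S. \<forall>i<N. dist (g ((m \<circ> \<psi>) i) s) (if \<sigma> i then a else b) < \<eta> * dist a b" for N \<sigma>
  proof -
    obtain s where "s \<in> S" "\<forall>i<N. s \<in> (if \<sigma> i then U a (\<psi> i) else U b (\<psi> i))" using \<psi>(2) by blast
    then show ?thesis by (intro bexI[of _ s]) (auto simp: U_def split: if_splits)
  qed
  show thesis by (rule that[OF ne sm ind])
qed

subsection \<open>Limits along a free ultrafilter\<close>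

text \<open>Zorn's lemma for the sets of events \<open>ev F\<close>, which reverse the order of
  filters: the union of a chain belongs to the infimum of the filters, and a maximal set of events
  to a minimal proper filter.\<close>

lemma obtain_free_ultrafilter:
  obtains p :: "nat filter" where "p \<noteq> bot" "p \<le> sequentially"
    "\<And>P. eventually P p \<or> eventually (\<lambda>n. \<not> P n) p"
proof -
  define ev where "ev = (\<lambda>F::nat filter. {P. eventually P F})"
  define \<A> where "\<A> = {ev F | F. F \<noteq> bot \<and> F \<le> sequentially}"
  have ev_le: "F \<le> G \<longleftrightarrow> ev G \<subseteq> ev F" for F G by (auto simp: ev_def le_filter_def)
  have "\<exists>M\<in>\<A>. \<forall>X\<in>\<A>. M \<subseteq> X \<longrightarrow> X = M"
  proof (rule subset_Zorn_nonempty)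
    show "\<A> \<noteq> {}" unfolding \<A>_def by (auto intro: exI[of _ sequentially])
    fix \<C> assume C: "\<C> \<noteq> {}" "subset.chain \<A> \<C>"
    define \<F> where "\<F> = {F. F \<noteq> bot \<and> F \<le> sequentially \<and> ev F \<in> \<C>}"
    have CF: "\<C> = ev ` \<F>" using C(2) by (auto simp: \<F>_def \<A>_def subset_chain_def)
    then have Fne: "\<F> \<noteq> {}" using C(1) by auto
    have "\<exists>x\<in>\<F>. x \<le> inf F G" if "F \<in> \<F>" "G \<in> \<F>" for F G
    proof -
      have "ev F \<subseteq> ev G \<or> ev G \<subseteq> ev F" using C(2) that CF unfolding subset_chain_def by blast
      then have "G \<le> F \<or> F \<le> G" by (simp add: ev_le)
      then show ?thesis using that by (metis inf.absorb1 inf.absorb2 order_refl)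
    qed
    then have evI: "eventually P (Inf \<F>) \<longleftrightarrow> (\<exists>F\<in>\<F>. eventually P F)" for P
      using Fne by (intro eventually_Inf_base)
    have "Inf \<F> \<noteq> bot" using evI[of "\<lambda>_. False"] by (auto simp: \<F>_def trivial_limit_def)
    moreover have "Inf \<F> \<le> sequentially"
      using Fne by (auto simp: \<F>_def intro: Inf_lower2)
    moreover have "ev (Inf \<F>) = \<Union>\<C>" using evI by (auto simp: CF ev_def)
    ultimately show "\<Union>\<C> \<in> \<A>" unfolding \<A>_def by force
  qed
  then obtain M where M: "M \<in> \<A>" "\<And>X. \<lbrakk>X \<in> \<A>; M \<subseteq> X\<rbrakk> \<Longrightarrow> X = M" by blast
  then obtain p where p: "p \<noteq> bot" "p \<le> sequentially" and Mp: "M = ev p"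
    unfolding \<A>_def by blast
  note max_ev = M(2)[unfolded Mp]
  have max: "p \<le> F" if "F \<noteq> bot" "F \<le> p" for F
  proof -
    have "ev F \<in> \<A>" using that p(2) order_trans unfolding \<A>_def by blast
    then show ?thesis using max_ev that(2) by (simp add: ev_le)
  qed
  have "eventually P p \<or> eventually (\<lambda>n. \<not> P n) p" for P
  proof (cases "inf p (principal {n. P n}) = bot")
    case True
    then show ?thesis by (simp add: trivial_limit_def eventually_inf_principal)
  next
    case False
    then have "p \<le> inf p (principal {n. P n})" by (intro max inf_le1)
    then show ?thesis by (simp add: le_principal)
  qed
  then show thesis using that p by blast
qed

definition ultra :: "nat filter" where
  "ultra = (SOME p. p \<noteq> bot \<and> p \<le> sequentially \<and>
     (\<forall>P. eventually P p \<or> eventually (\<lambda>n. \<not> P n) p))"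

lemma ultra: "ultra \<noteq> bot" "ultra \<le> sequentially"
    "eventually P ultra \<or> eventually (\<lambda>n. \<not> P n) ultra"
proof -
  have "\<exists>p. p \<noteq> bot \<and> p \<le> sequentially \<and> (\<forall>P. eventually P p \<or> eventually (\<lambda>n. \<not> P n) p)"
    by (metis obtain_free_ultrafilter)
  from someI_ex[OF this] show "ultra \<noteq> bot" "ultra \<le> sequentially"
    "eventually P ultra \<or> eventually (\<lambda>n. \<not> P n) ultra"
    unfolding ultra_def by blast+
qed

text \<open>An ultrafilter converges on every compact set, metrizable or not: if no point of
  \<open>K\<close> were a limit, each would have a neighbourhood that \<open>x\<close> eventually
  avoids, and a finite subcover would leave \<open>x\<close> no room in \<open>K\<close>.\<close>

lemma ultra_limit_in_compact:
  assumes K: "compactin X K" and x: "\<And>n. x n \<in> K"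
  obtains l where "l \<in> K" "limitin X x l ultra"
proof -
  have "\<exists>l\<in>K. limitin X x l ultra"
  proof (rule ccontr)
    assume "\<not> ?thesis"
    moreover have "K \<subseteq> topspace X" using K compactin_subset_topspace by blast
    ultimately have "\<forall>l\<in>K. \<exists>U. openin X U \<and> l \<in> U \<and> \<not> eventually (\<lambda>n. x n \<in> U) ultra"
      unfolding limitin_def by blast
    then obtain U where U: "\<And>l. l \<in> K \<Longrightarrow> openin X (U l) \<and> l \<in> U l \<and> \<not> eventually (\<lambda>n. x n \<in> U l) ultra"
      by metis
    have "(\<forall>V\<in>U ` K. openin X V) \<and> K \<subseteq> \<Union>(U ` K)" using U by blast
    then have "\<exists>\<F>. finite \<F> \<and> \<F> \<subseteq> U ` K \<and> K \<subseteq> \<Union>\<F>"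
      using K unfolding compactin_def by presburger
    then obtain F where F: "finite F" "F \<subseteq> K" "K \<subseteq> (\<Union>l\<in>F. U l)"
      by (metis finite_subset_image)
    have "eventually (\<lambda>n. \<forall>l\<in>F. x n \<notin> U l) ultra"
      using F U ultra(3) by (intro eventually_ball_finite) blast+
    moreover have "\<not> (\<forall>l\<in>F. x n \<notin> U l)" for n using F(3) x[of n] by blast
    ultimately have "eventually (\<lambda>_. False) ultra" by simp
    then show False using ultra(1) by (simp add: trivial_limit_def)
  qed
  then show thesis using that by blast
qed

lemma tendsto_ultra_Lim:
  fixes x :: "nat \<Rightarrow> 'k::euclidean_space"
  assumes "bounded (range x)"
  shows "(x \<longlongrightarrow> Lim ultra x) ultra"
proof -
  have "compactin euclidean (closure (range x))" using assms by simp
  moreover have "x n \<in> closure (range x)" for n by (simp add: closure_subset[THEN subsetD])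
  ultimately obtain l where "limitin euclidean x l ultra"
    by (metis ultra_limit_in_compact)
  then have "(x \<longlongrightarrow> l) ultra" by simp
  then show ?thesis using tendsto_Lim ultra(1) by metis
qed

lemma tendsto_ultra: "x \<longlonglongrightarrow> l \<Longrightarrow> (x \<longlongrightarrow> l) ultra"
  using ultra(2) tendsto_mono by blast

subsection \<open>Hahn--Banach\<close>

text \<open>Partial extensions are encoded by their graphs, subspaces of
  \<open>'a \<times> real\<close> on which the second component is dominated. Domination alone makes
  such a subspace a graph, since it leaves no room for a point \<open>(0, t)\<close> with
  \<open>t > 0\<close>.\<close>

lemma real_hahn_banach:
  fixes V :: "'a::real_normed_vector set" and u :: "'a \<Rightarrow> real"
  assumes V0: "0 \<in> V" and Vadd: "\<And>x y. \<lbrakk>x \<in> V; y \<in> V\<rbrakk> \<Longrightarrow> x + y \<in> V"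
    and Vscale: "\<And>r x. x \<in> V \<Longrightarrow> r *\<^sub>R x \<in> V"
    and add: "\<And>x y. \<lbrakk>x \<in> V; y \<in> V\<rbrakk> \<Longrightarrow> u (x + y) = u x + u y"
    and scale: "\<And>r x. x \<in> V \<Longrightarrow> u (r *\<^sub>R x) = r * u x"
    and bd: "\<And>x. x \<in> V \<Longrightarrow> u x \<le> K * norm x" and "K \<ge> 0"
  obtains U where "linear U" "\<And>x. x \<in> V \<Longrightarrow> U x = u x" "\<And>x. \<bar>U x\<bar> \<le> K * norm x"
proof -
  define \<A> where "\<A> = {G :: ('a \<times> real) set. subspace G \<and> (\<lambda>x. (x, u x)) ` V \<subseteq> G \<and>
    (\<forall>(x, t)\<in>G. t \<le> K * norm x)}"
  have "\<exists>M\<in>\<A>. \<forall>X\<in>\<A>. M \<subseteq> X \<longrightarrow> X = M"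
  proof (rule subset_Zorn_nonempty)
    have "u 0 = 0" using scale[of 0 0] V0 by simp
    then have "(\<lambda>x. (x, u x)) ` V \<in> \<A>"
      unfolding \<A>_def using V0 Vadd Vscale bd
      by (force simp: subspace_def add scale zero_prod_def image_iff)
    then show "\<A> \<noteq> {}" by blast
    fix \<C> assume C: "\<C> \<noteq> {}" "subset.chain \<A> \<C>"
    have CA: "\<C> \<subseteq> \<A>" using C(2) by (simp add: subset_chain_def)
    have CsubC: "subspace X" if "X \<in> \<C>" for X using CA that by (auto simp: \<A>_def)
    have ch: "X \<subseteq> Y \<or> Y \<subseteq> X" if "X \<in> \<C>" "Y \<in> \<C>" for X Y
      using C(2) that by (auto simp: subset_chain_def)
    have "subspace (\<Union>\<C>)"
      unfolding subspace_def
    proof (intro conjI ballI allI)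
      show "0 \<in> \<Union>\<C>" using C(1) CsubC subspace_0 by blast
      show "c *\<^sub>R x \<in> \<Union>\<C>" if "x \<in> \<Union>\<C>" for c x
        using that CsubC subspace_scale by blast
      show "x + y \<in> \<Union>\<C>" if xy: "x \<in> \<Union>\<C>" "y \<in> \<Union>\<C>" for x y
      proof -
        obtain X Y where X: "X \<in> \<C>" "x \<in> X" "Y \<in> \<C>" "y \<in> Y" using xy by blast
        then obtain Z where "Z \<in> \<C>" "x \<in> Z" "y \<in> Z" using ch by blast
        then show ?thesis using CsubC subspace_add by blast
      qed
    qed
    moreover have "(\<lambda>x. (x, u x)) ` V \<subseteq> \<Union>\<C>" using C(1) CA by (auto simp: \<A>_def)
    moreover have "\<forall>(x, t)\<in>\<Union>\<C>. t \<le> K * norm x" using CA by (auto simp: \<A>_def)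
    ultimately show "\<Union>\<C> \<in> \<A>" unfolding \<A>_def by blast
  qed
  then obtain G where G: "G \<in> \<A>" and max: "\<And>X. \<lbrakk>X \<in> \<A>; G \<subseteq> X\<rbrakk> \<Longrightarrow> X = G" by blast
  have sub: "subspace G" and VG: "\<And>x. x \<in> V \<Longrightarrow> (x, u x) \<in> G"
    and le: "\<And>x t. (x, t) \<in> G \<Longrightarrow> t \<le> K * norm x" using G by (auto simp: \<A>_def)
  have Gadd: "(x + y, t + s) \<in> G" if "(x, t) \<in> G" "(y, s) \<in> G" for x y t s
    using subspace_add[OF sub that] by simp
  have Gscale: "(r *\<^sub>R x, r * t) \<in> G" if "(x, t) \<in> G" for r x t
    using subspace_scale[OF sub that, of r] by simp
  have G0: "(0, 0) \<in> G" using subspace_0[OF sub] by (simp add: zero_prod_def)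
  have uniq: "t = s" if "(x, t) \<in> G" "(x, s) \<in> G" for x t s
  proof -
    have "a \<le> b" if "(x, a) \<in> G" "(x, b) \<in> G" for a b
      using Gadd[OF that(1) Gscale[OF that(2), of "-1"]] le[of 0 "a - b"] by simp
    then show ?thesis using that by (meson antisym)
  qed
  have "\<exists>t. (x0, t) \<in> G" for x0
  proof (rule ccontr)
    assume nex: "\<not> (\<exists>t. (x0, t) \<in> G)"
    \<comment> \<open>The value \<open>r\<close> at \<open>x0\<close> must lie above all
      \<open>t - K * norm (x - x0)\<close> and below all \<open>K * norm (y + x0) - s\<close>; the
      triangle inequality separates the two families, and \<open>r\<close> is the supremum of the
      first.\<close>
    define L where "L = {t - K * norm (x - x0) | x t. (x, t) \<in> G}"
    have L: "t - K * norm (x - x0) \<le> K * norm (y + x0) - s" if "(x, t) \<in> G" "(y, s) \<in> G" for x t y s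
    proof -
      have "t + s \<le> K * norm (x + y)" using le Gadd that by blast
      also have "norm (x + y) \<le> norm (x - x0) + norm (y + x0)"
        using norm_triangle_ineq[of "x - x0" "y + x0"] by simp
      then have "K * norm (x + y) \<le> K * (norm (x - x0) + norm (y + x0))"
        using \<open>K \<ge> 0\<close> by (intro mult_left_mono)
      finally show ?thesis by (simp add: distrib_left)
    qed
    define r where "r = Sup L"
    have Lne: "L \<noteq> {}" using G0 by (auto simp: L_def)
    have "bdd_above L" using L[OF _ G0] by (auto simp: L_def bdd_above_def)
    then have r1: "t - K * norm (x - x0) \<le> r" if "(x, t) \<in> G" for x t
      unfolding r_def using that by (intro cSup_upper) (auto simp: L_def)
    have r2: "r \<le> K * norm (y + x0) - s" if "(y, s) \<in> G" for y s
      unfolding r_def using L that Lne by (intro cSup_least) (auto simp: L_def)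
    define H where "H = {(x + a *\<^sub>R x0, t + a * r) | x a t. (x, t) \<in> G}"
    have GH: "G \<subseteq> H" by (force simp: H_def intro: exI[of _ "0::real"])
    have "subspace H"
      unfolding subspace_def
    proof (intro conjI ballI allI)
      show "0 \<in> H" using GH G0 by (auto simp: zero_prod_def)
      fix h assume "h \<in> H"
      then obtain x a t where h: "h = (x + a *\<^sub>R x0, t + a * r)" "(x, t) \<in> G" by (auto simp: H_def)
      show "c *\<^sub>R h \<in> H" for c
      proof -
        have "c *\<^sub>R h = (c *\<^sub>R x + (c * a) *\<^sub>R x0, c * t + (c * a) * r)"
          by (simp add: h algebra_simps)
        then show ?thesis using Gscale[OF h(2), of c] unfolding H_def by blast
      qed
      fix k assume "k \<in> H"
      then obtain y b s where k: "k = (y + b *\<^sub>R x0, s + b * r)" "(y, s) \<in> G" by (auto simp: H_def)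
      have "h + k = ((x + y) + (a + b) *\<^sub>R x0, (t + s) + (a + b) * r)"
        by (simp add: h k algebra_simps)
      then show "h + k \<in> H" using Gadd[OF h(2) k(2)] unfolding H_def by blast
    qed
    \<comment> \<open>Division by the absolute value of \<open>a\<close> reduces the claim to the
      upper bound on \<open>r\<close> for positive \<open>a\<close> and to the lower bound for
      negative \<open>a\<close>.\<close>
    moreover have "t + a * r \<le> K * norm (x + a *\<^sub>R x0)" if xt: "(x, t) \<in> G" for x a t
    proof (cases a "0::real" rule: linorder_cases)
      case equal
      then show ?thesis using le[OF xt] by simp
    next
      case greater
      have "r \<le> K * norm ((1/a) *\<^sub>R x + x0) - (1/a) * t" using r2[OF Gscale[OF xt]] .
      then have "a * r \<le> a * (K * norm ((1/a) *\<^sub>R x + x0) - (1/a) * t)"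
        using greater by (intro mult_left_mono) auto
      also have "\<dots> = K * (a * norm ((1/a) *\<^sub>R x + x0)) - t" using greater by (simp add: algebra_simps)
      also have "a * norm ((1/a) *\<^sub>R x + x0) = norm (a *\<^sub>R ((1/a) *\<^sub>R x + x0))"
        using greater by simp
      also have "a *\<^sub>R ((1/a) *\<^sub>R x + x0) = x + a *\<^sub>R x0" using greater by (simp add: scaleR_add_right)
      finally show ?thesis by simp
    next
      case less
      define y where "y = (-1/a) *\<^sub>R x - x0"
      have "(-1/a) * t - K * norm y \<le> r" using r1[OF Gscale[OF xt]] unfolding y_def .
      then have "(-a) * ((-1/a) * t - K * norm y) \<le> (-a) * r"
        using less by (intro mult_left_mono) auto
      also have "(-a) * ((-1/a) * t - K * norm y) = t - K * ((-a) * norm y)"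
        using less by (simp add: algebra_simps)
      also have "(-a) * norm y = norm ((-a) *\<^sub>R y)"
        by (simp only: norm_scaleR abs_of_neg[OF less] abs_minus_cancel)
      also have "(-a) *\<^sub>R y = x + a *\<^sub>R x0"
        using less by (simp add: y_def scaleR_diff_right)
      finally have "t - K * norm (x + a *\<^sub>R x0) \<le> (-a) * r" .
      then show ?thesis by simp
    qed
    then have "\<forall>(x, t)\<in>H. t \<le> K * norm x" by (auto simp: H_def)
    moreover have "(\<lambda>x. (x, u x)) ` V \<subseteq> H" using VG GH by auto
    ultimately have "H \<in> \<A>" unfolding \<A>_def by blast
    then have "H = G" using max GH by blast
    moreover have "(x0, r) \<in> H" unfolding H_def using G0 by (force intro: exI[of _ "1::real"])
    ultimately show False using nex by blast
  qed
  then obtain U where U: "\<And>x. (x, U x) \<in> G" by metis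
  show thesis
  proof
    show "linear U"
    proof (rule linearI)
      show "U (x + y) = U x + U y" for x y using uniq[OF U Gadd[OF U U]] .
      show "U (r *\<^sub>R x) = r *\<^sub>R U x" for r x using uniq[OF U Gscale[OF U]] by simp
    qed
    then show "\<bar>U x\<bar> \<le> K * norm x" for x
      using le[OF U, of x] le[OF U, of "- x"] by (simp add: linear_neg abs_le_iff)
    show "U x = u x" if "x \<in> V" for x using uniq[OF U VG[OF that]] .
  qed
qed

text \<open>The bilinear form \<open>1 \<bullet> (c * z)\<close>, the real part of
  \<open>c * z\<close> in the complex case, is nondegenerate because \<open>z\<close> can be paired
  with its inverse; in finite dimension it therefore represents every real-linear functional. It is
  the link between real and \<open>'k\<close>-linear functionals.\<close>

lemma real_functional_representation:
  fixes \<phi> :: "'k::{real_normed_field, euclidean_space} \<Rightarrow> real"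
  assumes "linear \<phi>"
  obtains z where "\<And>c. 1 \<bullet> (c * z) = \<phi> c"
proof -
  define T :: "'k \<Rightarrow> 'k" where "T = (\<lambda>z. \<Sum>b\<in>Basis. (1 \<bullet> (b * z)) *\<^sub>R b)"
  have lin_in: "linear (\<lambda>c. 1 \<bullet> (c * z))" for z :: 'k
    by (rule linearI) (simp_all add: distrib_right inner_add_right)
  have Tb: "T z \<bullet> b = 1 \<bullet> (b * z)" if "b \<in> Basis" for z b
    using that by (simp add: T_def inner_sum_left_Basis)
  have linT: "linear T"
    unfolding T_def
    by (rule linearI) (simp_all add: distrib_left inner_add_right scaleR_add_left sum.distrib scaleR_sum_right)
  have "z = 0" if "T z = 0" for z
  proof (rule ccontr)
    assume "z \<noteq> 0"
    have "linear (\<lambda>c. 0 :: real)" by (rule linearI) auto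
    then have "(\<lambda>c. 1 \<bullet> (c * z)) = (\<lambda>c. 0)"
      using Tb[of _ z] that by (intro linear_eq_stdbasis[OF lin_in]) auto
    then have "1 \<bullet> (inverse z * z) = 0" by metis
    then show False using \<open>z \<noteq> 0\<close> by simp
  qed
  then have "inj T" using linear_injective_0[OF linT] by blast
  then have "surj T" using linear_injective_imp_surjective[OF linT] by blast
  then obtain z where z: "T z = (\<Sum>b\<in>Basis. \<phi> b *\<^sub>R b)" by (metis surjD)
  have "1 \<bullet> (b * z) = \<phi> b" if "b \<in> Basis" for b
    using Tb[OF that, of z] that by (simp add: z inner_sum_left_Basis)
  then have "(\<lambda>c. 1 \<bullet> (c * z)) = \<phi>" by (intro linear_eq_stdbasis[OF lin_in assms])
  then show thesis using that by metis
qed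

subsection \<open>Weak topologies\<close>

lemma openin_weak_topology:
  "h \<in> vcarrier (dual X) \<Longrightarrow> open U \<Longrightarrow> openin (weak_topology X) {x \<in> vcarrier X. h x \<in> U}"
  unfolding weak_topology_def by (intro topology_generated_by_Basis) blast

lemma topspace_weak_topology: "topspace (weak_topology X) \<subseteq> vcarrier X"
  by (auto simp: weak_topology_def topology_generated_by_topspace)

lemma continuous_map_weak_topology:
  fixes X :: "('k::real_normed_field, 'v) nspace"
  assumes "h \<in> vcarrier (dual X)"
  shows "continuous_map (weak_topology X) euclidean h"
  unfolding continuous_map
proof (intro conjI allI impI)
  fix U :: "'k set" assume "openin euclidean U"
  then have "openin (weak_topology X) (topspace (weak_topology X) \<inter> {x \<in> vcarrier X. h x \<in> U})"
    using openin_weak_topology[OF assms] by auto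
  moreover have "topspace (weak_topology X) \<inter> {x \<in> vcarrier X. h x \<in> U} = {x \<in> topspace (weak_topology X). h x \<in> U}"
    using topspace_weak_topology[of X] by blast
  ultimately show "openin (weak_topology X) {x \<in> topspace (weak_topology X). h x \<in> U}" by simp
qed auto

lemma limitin_weak_topology:
  assumes "limitin (weak_topology X) v l F" "h \<in> vcarrier (dual X)"
  shows "((\<lambda>i. h (v i)) \<longlongrightarrow> h l) F"
  using continuous_map_limit[OF continuous_map_weak_topology[OF assms(2)] assms(1)] by (simp add: o_def)

section \<open>The space of bounded sequences\<close>

lemma linf_simps:
  "vcarrier linf = {x. bounded (range x)}" "vadd linf x y = (\<lambda>n. x n + y n)"
  "vscale linf c x = (\<lambda>n. c * x n)"
  by (simp_all add: linf_def)

lemma linf_norm_le: "(\<And>n. norm (x n) \<le> M) \<Longrightarrow> vnorm linf x \<le> M"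
  by (auto simp: linf_def intro: cSUP_least)

lemma norm_le_linf_norm:
  assumes "bounded (range x)" shows "norm (x n) \<le> vnorm linf x"
proof -
  have "bdd_above (range (\<lambda>n. norm (x n)))" using assms by (auto simp: bounded_iff bdd_above_def)
  then show ?thesis unfolding linf_def by (auto intro: cSUP_upper)
qed

subsection \<open>Bounded approximate identities\<close>

lemma eventually_tails:
  assumes "directed_set D le"
  shows "eventually P (tails D le) \<longleftrightarrow> (\<exists>i\<in>D. \<forall>j\<in>D. le i j \<longrightarrow> P j)"
proof -
  have "eventually P (tails D le) \<longleftrightarrow> (\<exists>i\<in>D. eventually P (principal {j \<in> D. le i j}))"
    unfolding tails_def
  proof (rule eventually_INF_base)
    show "D \<noteq> {}" using assms by (simp add: directed_set_def)
    fix a b assume ab: "a \<in> D" "b \<in> D"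
    then obtain k where k: "k \<in> D" "le a k" "le b k" using assms unfolding directed_set_def by blast
    have "le a j \<and> le b j" if "j \<in> D" "le k j" for j
      using assms ab k that unfolding directed_set_def by blast
    then show "\<exists>x\<in>D. principal {j \<in> D. le x j} \<le> inf (principal {j \<in> D. le a j}) (principal {j \<in> D. le b j})"
      using k(1) by (intro bexI[of _ k]) auto
  qed
  then show ?thesis by (auto simp: eventually_principal)
qed

lemma tails_neq_bot: "directed_set D le \<Longrightarrow> tails D le \<noteq> bot"
  using eventually_tails[of D le "\<lambda>_. False"] unfolding trivial_limit_def directed_set_def by blast

text \<open>A Cauchy approximate identity would converge, by completeness and closedness, to an
  element of \<open>B\<close> that is a unit.\<close>

lemma bounded_approximate_identity_not_Cauchy:
  fixes e :: "'i \<Rightarrow> 'a::{real_normed_algebra, banach}"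
  assumes bai: "bounded_approximate_identity B D le e" and "closed B" and "\<not> unital B"
  shows "\<exists>\<delta>>0. \<forall>P. eventually P (tails D le) \<longrightarrow> (\<exists>i\<in>D. \<exists>j\<in>D. P i \<and> P j \<and> \<delta> \<le> dist (e i) (e j))"
proof -
  let ?F = "tails D le"
  have dir: "directed_set D le" and eB: "e ` D \<subseteq> B" using bai by (auto simp: bounded_approximate_identity_def)
  have inD: "\<forall>\<^sub>F i in ?F. i \<in> D"
    unfolding eventually_tails[OF dir] using dir unfolding directed_set_def by blast
  have ne: "?F \<noteq> bot" using tails_neq_bot[OF dir] .
  have "\<not> cauchy_filter (filtermap e ?F)"
  proof
    assume "cauchy_filter (filtermap e ?F)"
    then obtain u where "filtermap e ?F \<le> nhds u"
      using cauchy_filter_complete_converges[of "filtermap e ?F" UNIV] ne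
      by (auto simp: complete_UNIV filtermap_bot_iff)
    then have u: "(e \<longlongrightarrow> u) ?F" by (simp add: filterlim_def)
    have "u \<in> B"
    proof (rule Lim_in_closed_set[OF \<open>closed B\<close> _ ne u])
      show "\<forall>\<^sub>F i in ?F. e i \<in> B" using inD by eventually_elim (use eB in blast)
    qed
    moreover have "u * b = b \<and> b * u = b" if "b \<in> B" for b
    proof -
      have "((\<lambda>i. b * e i - b) \<longlongrightarrow> 0) ?F" "((\<lambda>i. e i * b - b) \<longlongrightarrow> 0) ?F"
        using bai that by (auto simp: bounded_approximate_identity_def tendsto_norm_zero_iff)
      moreover have "((\<lambda>i. b * e i - b) \<longlongrightarrow> b * u - b) ?F" "((\<lambda>i. e i * b - b) \<longlongrightarrow> u * b - b) ?F"
        using u by (auto intro!: tendsto_intros)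
      ultimately have "b * u - b = 0" "u * b - b = 0" using ne tendsto_unique by blast+
      then show ?thesis by simp
    qed
    ultimately show False using \<open>\<not> unital B\<close> by (auto simp: unital_def)
  qed
  then obtain \<delta> where d: "\<delta> > 0"
    "\<And>P. eventually P ?F \<Longrightarrow> \<exists>i j. P i \<and> P j \<and> \<delta> \<le> dist (e i) (e j)"
    by (auto simp: cauchy_filter_metric_filtermap not_less)
  have "\<exists>i\<in>D. \<exists>j\<in>D. P i \<and> P j \<and> \<delta> \<le> dist (e i) (e j)" if "eventually P ?F" for P
    using d(2)[OF eventually_conj[OF that inD]] by blast
  then show ?thesis using d(1) by blast
qed

text \<open>The state of the recursion is the finite set \<open>F\<close> of all members chosen so
  far together with the latest pair; the next pair is taken so far out in the net that it fixes
  \<open>F\<close> up to \<open>1 / (n + 1)\<close> on both sides. That its two members are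
  \<open>\<delta>\<close> apart will later prevent both sequences from converging.\<close>

lemma approximate_unit_pairs:
  fixes e :: "'i \<Rightarrow> 'a::{real_normed_algebra, banach}"
  assumes bai: "bounded_approximate_identity B D le e" and "closed B" and "\<not> unital B"
  obtains \<delta> and x y :: "nat \<Rightarrow> 'a" where "\<delta> > 0" "\<And>n. \<delta> \<le> dist (x n) (y n)"
    "range x \<union> range y \<subseteq> e ` D"
    "\<And>a. a \<in> range x \<union> range y \<Longrightarrow> (\<lambda>n. x n * a) \<longlonglongrightarrow> a \<and> (\<lambda>n. a * x n) \<longlonglongrightarrow> a \<and>
       (\<lambda>n. y n * a) \<longlonglongrightarrow> a \<and> (\<lambda>n. a * y n) \<longlonglongrightarrow> a"
proof -
  let ?F = "tails D le"
  obtain \<delta> where \<delta>: "\<delta> > 0"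
    "\<And>P. eventually P ?F \<Longrightarrow> \<exists>i\<in>D. \<exists>j\<in>D. P i \<and> P j \<and> \<delta> \<le> dist (e i) (e j)"
    using bounded_approximate_identity_not_Cauchy[OF assms] by blast
  have eB: "e ` D \<subseteq> B" using bai by (auto simp: bounded_approximate_identity_def)
  define near where "near = (\<lambda>F r (v::'a). \<forall>a\<in>F. norm (v * a - a) < r \<and> norm (a * v - a) < (r::real))"
  have ex: "\<exists>u\<in>e ` D. \<exists>v\<in>e ` D. near F r u \<and> near F r v \<and> \<delta> \<le> dist u v"
    if F: "finite F" "F \<subseteq> B" and "r > 0" for F r
  proof -
    have "\<forall>\<^sub>F i in ?F. norm (e i * a - a) < r \<and> norm (a * e i - a) < r" if "a \<in> B" for a
      using bai that \<open>r > 0\<close> unfolding bounded_approximate_identity_def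
      by (intro eventually_conj) (auto intro!: order_tendstoD(2))
    then have "\<forall>\<^sub>F i in ?F. near F r (e i)"
      unfolding near_def using F by (intro eventually_ball_finite) auto
    then show ?thesis using \<delta>(2) by blast
  qed
  define P where "P = (\<lambda>n::nat. \<lambda>(F, u, v). finite F \<and> F \<subseteq> B \<and> u \<in> F \<and> v \<in> F \<and>
    u \<in> e ` D \<and> v \<in> e ` D \<and> \<delta> \<le> dist u v)"
  define Q where "Q = (\<lambda>n. \<lambda>(F, u :: 'a, v :: 'a) (F', u', v').
    F \<subseteq> F' \<and> near F (inverse (Suc n)) u' \<and> near F (inverse (Suc n)) v')"
  have "\<exists>s. \<forall>n. P n (s n) \<and> Q n (s n) (s (Suc n))"
  proof (rule dependent_nat_choice)
    obtain u v where "u \<in> e ` D" "v \<in> e ` D" "\<delta> \<le> dist u v" using ex[of "{}" 1] by auto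
    then show "\<exists>s. P 0 s" using eB by (intro exI[of _ "({u, v}, u, v)"]) (auto simp: P_def)
    fix s n assume s: "P n s"
    obtain F u v where suv: "s = (F, u, v)" by (metis prod_cases3)
    have "finite F" "F \<subseteq> B" using s by (auto simp: P_def suv)
    moreover obtain u' v' where "u' \<in> e ` D" "v' \<in> e ` D" "near F (inverse (Suc n)) u'"
      "near F (inverse (Suc n)) v'" "\<delta> \<le> dist u' v'"
      using ex[of F "inverse (Suc n)"] calculation by auto
    ultimately have "P (Suc n) (insert u' (insert v' F), u', v')"
      "Q n s (insert u' (insert v' F), u', v')"
      using eB by (auto simp: P_def Q_def suv)
    then show "\<exists>s'. P (Suc n) s' \<and> Q n s s'" by blast
  qed
  then obtain s where s: "\<And>n. P n (s n)" "\<And>n. Q n (s n) (s (Suc n))" by blast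
  define F where "F = (\<lambda>n. fst (s n))"
  define x where "x = (\<lambda>n. fst (snd (s n)))"
  define y where "y = (\<lambda>n. snd (snd (s n)))"
  have P: "x n \<in> F n" "y n \<in> F n" "x n \<in> e ` D" "y n \<in> e ` D" "\<delta> \<le> dist (x n) (y n)" for n
    using s(1)[of n] by (auto simp: P_def F_def x_def y_def split: prod.splits)
  have Q: "F n \<subseteq> F (Suc n)" "near (F n) (inverse (Suc n)) (x (Suc n))"
    "near (F n) (inverse (Suc n)) (y (Suc n))" for n
    using s(2)[of n] by (auto simp: Q_def F_def x_def y_def split: prod.splits)
  have mono: "F m \<subseteq> F n" if "m \<le> n" for m n using lift_Suc_mono_le[of F, OF Q(1) that] .
  have lim: "(\<lambda>n. w n * a) \<longlonglongrightarrow> a \<and> (\<lambda>n. a * w n) \<longlonglongrightarrow> a"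
    if w: "\<And>n. near (F n) (inverse (Suc n)) (w (Suc n))" and a: "a \<in> F m" for w a m
  proof -
    have "norm (w (Suc n) * a - a) \<le> inverse (Suc n) \<and> norm (a * w (Suc n) - a) \<le> inverse (Suc n)"
      if "m \<le> n" for n
      using w[of n] mono[OF that] a unfolding near_def by (blast intro: less_imp_le)
    then have "\<forall>\<^sub>F n in sequentially. norm (w (Suc n) * a - a) \<le> inverse (Suc n)"
      "\<forall>\<^sub>F n in sequentially. norm (a * w (Suc n) - a) \<le> inverse (Suc n)"
      by (blast intro: eventually_sequentiallyI[of m])+
    then have "(\<lambda>n. w (Suc n) * a - a) \<longlonglongrightarrow> 0" "(\<lambda>n. a * w (Suc n) - a) \<longlonglongrightarrow> 0"
      using LIMSEQ_inverse_real_of_nat by (auto intro: Lim_null_comparison)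
    then have "(\<lambda>n. w (Suc n) * a) \<longlonglongrightarrow> a" "(\<lambda>n. a * w (Suc n)) \<longlonglongrightarrow> a"
      by (auto intro: LIM_zero_cancel)
    then show ?thesis
      using LIMSEQ_imp_Suc[of "\<lambda>n. w n * a"] LIMSEQ_imp_Suc[of "\<lambda>n. a * w n"] by blast
  qed
  show thesis
  proof (rule that[OF \<delta>(1) P(5)])
    show "range x \<union> range y \<subseteq> e ` D" using P by auto
    show "(\<lambda>n. x n * a) \<longlonglongrightarrow> a \<and> (\<lambda>n. a * x n) \<longlonglongrightarrow> a \<and> (\<lambda>n. y n * a) \<longlonglongrightarrow> a \<and> (\<lambda>n. a * y n) \<longlonglongrightarrow> a"
      if a: "a \<in> range x \<union> range y" for a
    proof -
      obtain m where "a \<in> F m" using a P(1,2) by auto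
      then show ?thesis using lim[of x a m] lim[of y a m] Q by blast
    qed
  qed
qed

subsection \<open>Functionals on a Banach algebra\<close>

context banach_algebra
begin

lemma scaleR_eq_scale: "r *\<^sub>R x = sc (of_real r) x"
  by (simp add: scale_of_real)

text \<open>Bounded \<open>'k\<close>-linear functionals with an explicit bound, not necessarily the
  norm: a bound common to a family passes to its limits along \<open>ultra\<close>.\<close>

definition functional :: "real \<Rightarrow> ('a \<Rightarrow> 'k) \<Rightarrow> bool" where
  "functional K f \<longleftrightarrow> 0 \<le> K \<and> (\<forall>x y. f (x + y) = f x + f y) \<and> (\<forall>c x. f (sc c x) = c * f x) \<and>
     (\<forall>x. norm (f x) \<le> K * norm x)"

lemma functionalD:
  assumes "functional K f"
  shows "0 \<le> K" "f (x + y) = f x + f y" "f (sc c x) = c * f x" "norm (f x) \<le> K * norm x"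
  using assms unfolding functional_def by blast+

lemma functional_bounded_linear:
  assumes "functional K f" shows "bounded_linear f"
  using functionalD[OF assms]
  by (intro bounded_linear_intro[of f K]) (auto simp: scaleR_eq_scale scaleR_conv_of_real mult.commute)

lemma functional_simps:
  assumes "functional K f"
  shows "f 0 = 0" "f (x - y) = f x - f y" "f (- x) = - f x"
  using functional_bounded_linear[OF assms] bounded_linear.linear linear_0 linear_diff linear_neg by blast+

lemma functional_tendsto:
  "functional K f \<Longrightarrow> (x \<longlongrightarrow> l) F \<Longrightarrow> ((\<lambda>i. f (x i)) \<longlongrightarrow> f l) F"
  using functional_bounded_linear bounded_linear.tendsto by blast

lemma functional_bounded:
  assumes "functional K f" "bounded (range x)"
  shows "bounded (range (\<lambda>n. f (x n)))"
  using bounded_linear_image[OF assms(2) functional_bounded_linear[OF assms(1)]]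
  by (simp add: image_image)

lemma functional_zero: "functional 0 (\<lambda>x. 0)"
  by (simp add: functional_def)

lemma functional_add:
  assumes "functional K f" "functional K' g"
  shows "functional (K + K') (\<lambda>x. f x + g x)"
proof -
  have "norm (f x + g x) \<le> (K + K') * norm x" for x
    using norm_triangle_ineq[of "f x" "g x"] functionalD(4)[OF assms(1), of x]
      functionalD(4)[OF assms(2), of x] by (simp add: distrib_right)
  then show ?thesis using functionalD[OF assms(1)] functionalD[OF assms(2)]
    by (auto simp: functional_def algebra_simps)
qed

lemma functional_scale:
  assumes "functional K f"
  shows "functional (norm c * K) (\<lambda>x. c * f x)"
proof -
  have "norm (c * f x) \<le> norm c * K * norm x" for x
    using mult_left_mono[OF functionalD(4)[OF assms, of x] norm_ge_zero[of c]]
    by (simp add: norm_mult mult.assoc)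
  then show ?thesis using functionalD[OF assms] by (auto simp: functional_def algebra_simps)
qed

lemma functional_sum:
  assumes "\<And>i. i \<in> I \<Longrightarrow> functional (K i) (f i)" "finite I"
  shows "functional (\<Sum>i\<in>I. K i) (\<lambda>x. \<Sum>i\<in>I. f i x)"
  using assms(2,1)
  by (induction I rule: finite_induct) (auto intro: functional_zero functional_add)

lemma functional_mono: "functional K f \<Longrightarrow> K \<le> K' \<Longrightarrow> functional K' f"
  unfolding functional_def by (meson mult_right_mono norm_ge_zero order_trans)

lemma functional_mult_left:
  assumes "functional K f"
  shows "functional (K * norm a) (\<lambda>x. f (a * x))"
proof -
  have "norm (f (a * x)) \<le> K * norm a * norm x" for x
    using functionalD(4)[OF assms, of "a * x"] functionalD(1)[OF assms] norm_mult_ineq[of a x]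
    by (metis mult.assoc mult_left_mono order_trans)
  then show ?thesis using functionalD[OF assms]
    by (auto simp: functional_def distrib_left mult_scale_right)
qed

lemma functional_mult_right:
  assumes "functional K f"
  shows "functional (K * norm a) (\<lambda>x. f (x * a))"
proof -
  have "norm (f (x * a)) \<le> K * norm a * norm x" for x
    using functionalD(4)[OF assms, of "x * a"] functionalD(1)[OF assms] norm_mult_ineq[of x a]
    by (metis mult.assoc mult.commute mult_left_mono order_trans)
  then show ?thesis using functionalD[OF assms]
    by (auto simp: functional_def distrib_right mult_scale_left)
qed

text \<open>The weak-star compactness of balls of the dual, in the form of pointwise limits along
  \<open>ultra\<close>; the common bound makes each sequence \<open>f n x\<close> bounded.\<close>

lemma functional_ultra_limit:
  assumes "\<And>n. functional K (f n)"
  shows "functional K (\<lambda>x. Lim ultra (\<lambda>n. f n x))"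
    "((\<lambda>n. f n x) \<longlongrightarrow> Lim ultra (\<lambda>n. f n x)) ultra"
proof -
  have lim: "((\<lambda>n. f n x) \<longlongrightarrow> Lim ultra (\<lambda>n. f n x)) ultra" for x
    using functionalD(4)[OF assms] by (intro tendsto_ultra_Lim) (auto simp: bounded_iff)
  then show "((\<lambda>n. f n x) \<longlongrightarrow> Lim ultra (\<lambda>n. f n x)) ultra" .
  show "functional K (\<lambda>x. Lim ultra (\<lambda>n. f n x))"
    unfolding functional_def
  proof (intro conjI allI)
    show "0 \<le> K" using assms functionalD(1) by blast
    show "Lim ultra (\<lambda>n. f n (x + y)) = Lim ultra (\<lambda>n. f n x) + Lim ultra (\<lambda>n. f n y)" for x y
      using tendsto_add[OF lim[of x] lim[of y]] functionalD(2)[OF assms]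
      by (intro tendsto_Lim) (auto simp: ultra(1))
    show "Lim ultra (\<lambda>n. f n (sc c x)) = c * Lim ultra (\<lambda>n. f n x)" for c x
      using tendsto_mult_left[OF lim[of x]] functionalD(3)[OF assms]
      by (intro tendsto_Lim) (auto simp: ultra(1))
    show "norm (Lim ultra (\<lambda>n. f n x)) \<le> K * norm x" for x
      using functionalD(4)[OF assms] ultra(1)
      by (intro tendsto_upperbound[OF tendsto_norm[OF lim]]) auto
  qed
qed

text \<open>The real functional \<open>1 \<bullet> g x\<close> is extended to \<open>U\<close>, and
  \<open>f x\<close> is the scalar that represents \<open>c \<mapsto> U (sc c x)\<close>; this is
  the analogue of recovering a complex functional from its real part.\<close>

lemma hahn_banach_extension:
  assumes V: "subspace V"
    and add: "\<And>x y. \<lbrakk>x \<in> V; y \<in> V\<rbrakk> \<Longrightarrow> g (x + y) = g x + g y"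
    and scale: "\<And>c x. x \<in> V \<Longrightarrow> g (sc c x) = c * g x"
    and bd: "\<And>x. x \<in> V \<Longrightarrow> norm (g x) \<le> K * norm x" and "K \<ge> 0"
  obtains f where "functional K f" "\<And>x. x \<in> V \<Longrightarrow> f x = g x"
proof -
  obtain U where U: "linear U" "\<And>x. x \<in> V \<Longrightarrow> U x = 1 \<bullet> g x" "\<And>x. \<bar>U x\<bar> \<le> K * norm x"
  proof (rule real_hahn_banach[of V "\<lambda>x. 1 \<bullet> g x" K])
    show "1 \<bullet> g x \<le> K * norm x" if "x \<in> V" for x
      using norm_cauchy_schwarz[of 1 "g x"] bd[OF that] by simp
    show "1 \<bullet> g (r *\<^sub>R x) = r * (1 \<bullet> g x)" if "x \<in> V" for r x
      using scale[OF that, of "of_real r"]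
      by (metis inner_scaleR_right scaleR_conv_of_real scaleR_eq_scale)
  qed (use V \<open>K \<ge> 0\<close> in \<open>auto simp: subspace_0 subspace_add subspace_scale scaleR_eq_scale add inner_add_right\<close>)
  have "\<exists>z. \<forall>c. 1 \<bullet> (c * z) = U (sc c x)" for x
  proof -
    have "linear (\<lambda>c. U (sc c x))"
      using U(1) by (intro linearI)
        (auto simp: scale_left_distrib linear_add scaleR_conv_of_real linear_scale
          simp flip: scale_scale scaleR_eq_scale)
    then show ?thesis by (metis real_functional_representation)
  qed
  then obtain f where f: "\<And>c x. 1 \<bullet> (c * f x) = U (sc c x)" by metis
  have uniq: "z = z'" if "\<And>c. 1 \<bullet> (c * z) = 1 \<bullet> (c * z')" for z z' :: 'k
  proof (rule ccontr)
    assume ne: "z \<noteq> z'"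
    have "1 \<bullet> (inverse (z - z') * (z - z')) = 0"
      using that[of "inverse (z - z')"] by (simp add: right_diff_distrib inner_diff_right)
    then show False using ne by simp
  qed
  show thesis
  proof
    show "f x = g x" if "x \<in> V" for x
    proof (rule uniq)
      show "1 \<bullet> (c * f x) = 1 \<bullet> (c * g x)" for c
        using f U(2)[of "sc c x"] scale[OF that] V that by (simp add: subspace_scale)
    qed
    show "functional K f"
      unfolding functional_def
    proof (intro conjI allI)
      show "0 \<le> K" by fact
      show "f (x + y) = f x + f y" for x y
        using U(1) by (intro uniq) (simp add: f distrib_left inner_add_right scale_right_distrib linear_add)
      show "f (sc d x) = d * f x" for d x
        by (intro uniq) (simp add: f flip: mult.assoc)
      show "norm (f x) \<le> K * norm x" for x
      proof (cases "f x = 0")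
        case True
        then show ?thesis using \<open>K \<ge> 0\<close> by simp
      next
        case False
        \<comment> \<open>Normalising the argument so that the value of \<open>f\<close> becomes 1
          turns the bound for \<open>U\<close> into one for \<open>f\<close> without loss in the
          constant.\<close>
        have "1 = U (sc (inverse (f x)) x)" using f[of "inverse (f x)" x] False by (simp add: dot_square_norm)
        also have "\<dots> \<le> K * norm (sc (inverse (f x)) x)" using U(3) abs_le_D1 by blast
        also have "\<dots> = K * norm x / norm (f x)" by (simp add: norm_scale norm_inverse divide_inverse)
        finally show ?thesis using False by (simp add: field_simps)
      qed
    qed
  qed
qed

text \<open>On the span of \<open>V\<close> and \<open>l\<close> the functional reads off the
  coefficient of \<open>l\<close>. Since a \<open>\<delta>\<close>-ball about \<open>l\<close>
  misses \<open>V\<close>, it is bounded by \<open>1/\<delta>\<close> and extends.\<close>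

lemma functional_separation:
  assumes V: "subspace V" "closed V" and l: "l \<notin> V"
  obtains f K where "functional K f" "\<And>x. x \<in> V \<Longrightarrow> f x = 0" "f l = 1"
proof -
  obtain \<delta> where \<delta>: "\<delta> > 0" "ball l \<delta> \<subseteq> - V"
    using V(2) l by (metis ComplI open_Compl open_contains_ball)
  have far: "\<delta> \<le> norm (l - v)" if "v \<in> V" for v
    using \<delta>(2) that by (force simp: dist_norm not_le[symmetric])
  define W where "W = {v + sc c l | v c. v \<in> V}"
  define g where "g = (\<lambda>w. THE c. w - sc c l \<in> V)"
  have g: "g (v + sc c l) = c" if "v \<in> V" for v c
    unfolding g_def
  proof (rule the_equality)
    show "v + sc c l - sc c l \<in> V" using that by simp
    fix d assume "v + sc c l - sc d l \<in> V"
    then have "(v + sc c l - sc d l) - v \<in> V" using V(1) that subspace_diff by blast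
    then have "sc (c - d) l \<in> V" by (simp add: scale_left_diff_distrib)
    then have "sc (inverse (c - d)) (sc (c - d) l) \<in> V" using V(1) subspace_scale by blast
    then show "d = c" using l by (cases "c - d = 0") auto
  qed
  have gl: "g l = 1" using g[of 0 1] subspace_0[OF V(1)] by simp
  obtain f where f: "functional (1/\<delta>) f" "\<And>x. x \<in> W \<Longrightarrow> f x = g x"
  proof (rule hahn_banach_extension[of W g "1/\<delta>"])
    have Wadd: "\<exists>v. v \<in> V \<and> (v1 + sc c1 l) + (v2 + sc c2 l) = v + sc (c1 + c2) l"
      if "v1 \<in> V" "v2 \<in> V" for v1 v2 c1 c2
      using that V(1) by (intro exI[of _ "v1 + v2"]) (auto simp: subspace_add scale_left_distrib algebra_simps)
    have Wscale: "\<exists>v'. v' \<in> V \<and> sc d (v + sc c l) = v' + sc (d * c) l" if "v \<in> V" for v c d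
      using that V(1) by (intro exI[of _ "sc d v"]) (auto simp: subspace_scale scale_right_distrib)
    show "subspace W"
    proof (rule subspaceI)
      show "0 \<in> W" unfolding W_def using subspace_0[OF V(1)]
        by (auto intro!: exI[of _ "0::'a"] exI[of _ "0::'k"])
      show "x + y \<in> W" if "x \<in> W" "y \<in> W" for x y
        using that Wadd unfolding W_def by blast
      show "sc c x \<in> W" if "x \<in> W" for c x
        using that Wscale unfolding W_def by blast
    qed
    show "g (x + y) = g x + g y" if "x \<in> W" "y \<in> W" for x y
      using that Wadd g unfolding W_def by (smt (verit) mem_Collect_eq)
    show "g (sc c x) = c * g x" if "x \<in> W" for c x
      using that Wscale g unfolding W_def by (smt (verit) mem_Collect_eq)
    show "norm (g x) \<le> 1 / \<delta> * norm x" if xW: "x \<in> W" for x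
    proof -
      obtain v c where x: "x = v + sc c l" "v \<in> V" using xW unfolding W_def by blast
      show ?thesis
      proof (cases "c = 0")
        case True
        then show ?thesis using g[OF x(2), of c] x(1) \<delta>(1) by simp
      next
        case False
        have "sc (- inverse c) v \<in> V" using x(2) V(1) subspace_scale by blast
        then have "\<delta> \<le> norm (l - sc (- inverse c) v)" by (rule far)
        then have "norm c * \<delta> \<le> norm c * norm (l - sc (- inverse c) v)" by (intro mult_left_mono) auto
        also have "\<dots> = norm (sc c (l - sc (- inverse c) v))" by (simp add: norm_scale)
        also have "sc c (l - sc (- inverse c) v) = x" using False by (simp add: x scale_right_diff_distrib scale_right_distrib add.commute)
        finally show ?thesis using g[OF x(2), of c] x(1) \<delta>(1) by (simp add: field_simps)
      qed
    qed
    show "0 \<le> 1 / \<delta>" using \<delta> by simp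
  qed blast
  have VW: "x \<in> W" if "x \<in> V" for x
    unfolding W_def using that by (auto intro!: exI[of _ x] exI[of _ "0::'k"])
  show thesis
  proof (rule that[OF f(1)])
    show "f x = 0" if "x \<in> V" for x using f(2)[OF VW[OF that]] g[OF that, of 0] by simp
    have "l \<in> W" unfolding W_def using subspace_0[OF V(1)]
      by (auto intro!: exI[of _ "0::'a"] exI[of _ "1::'k"])
    then show "f l = 1" using f(2) gl by simp
  qed
qed

lemma functionals_separate_points:
  assumes "\<And>K f. functional K f \<Longrightarrow> f x = f y"
  shows "x = y"
proof (rule ccontr)
  assume "x \<noteq> y"
  then have "subspace {0}" "closed {0::'a}" "x - y \<notin> {0}" by auto
  then obtain f K where f: "functional K f" "f (x - y) = 1"
    by (rule functional_separation)
  then show False using assms[OF f(1)] by (simp add: functional_simps)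
qed

text \<open>Weak sequential completeness speaks of the dual of \<open>B\<close>, the other arguments
  of functionals on the whole algebra. Extension of functionals translates the Cauchy condition,
  restriction the limit.\<close>

lemma weak_limit_in_subalgebra:
  assumes B: "closed_subalgebra sc B"
    and wsc: "weakly_sequentially_complete (subspace_on (alg_space sc) B)"
    and z: "\<And>n. z n \<in> B" and conv: "\<And>K f. functional K f \<Longrightarrow> convergent (\<lambda>n. f (z n))"
  obtains l where "l \<in> B" "\<And>K f. functional K f \<Longrightarrow> (\<lambda>n. f (z n)) \<longlonglongrightarrow> f l"
proof -
  let ?X = "subspace_on (alg_space sc) B"
  have X: "vcarrier ?X = B" "vadd ?X = (+)" "vscale ?X = sc" "vnorm ?X = norm"
    by (simp_all add: subspace_on_def alg_space_def)
  have sub: "subspace B" using B by (simp add: closed_subalgebra_def)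
  have "weakly_Cauchy ?X z"
    unfolding weakly_Cauchy_def
  proof (intro conjI allI ballI)
    show "z n \<in> vcarrier ?X" for n using z X by simp
    fix h assume "h \<in> vcarrier (dual ?X)"
    then have h: "bounded_linear_map ?X scalar_space h" by (simp add: dual_def)
    then obtain C where C: "\<forall>x\<in>B. norm (h x) \<le> C * norm x"
      unfolding bounded_linear_map_def scalar_space_def X by auto
    \<comment> \<open>The constant in \<open>bounded_linear_map\<close> carries no sign condition,
      whereas \<open>functional\<close> requires a nonnegative one.\<close>
    have "norm (h x) \<le> max C 0 * norm x" if "x \<in> B" for x
      using bspec[OF C that] mult_right_mono[of C "max C 0" "norm x"] by simp
    then obtain f where f: "functional (max C 0) f" "\<And>x. x \<in> B \<Longrightarrow> f x = h x"
      using hahn_banach_extension[OF sub, of h "max C 0"] h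
      by (auto simp: bounded_linear_map_def scalar_space_def X)
    have "(\<lambda>n. h (z n)) = (\<lambda>n. f (z n))" using f(2) z by auto
    then show "Cauchy (\<lambda>n. h (z n))" using conv[OF f(1)] convergent_Cauchy by metis
  qed
  then obtain l where l: "limitin (weak_topology ?X) z l sequentially"
    using wsc unfolding weakly_sequentially_complete_def by blast
  have lB: "l \<in> B" using l topspace_weak_topology[of ?X] by (auto simp: limitin_def X)
  have "(\<lambda>n. f (z n)) \<longlonglongrightarrow> f l" if f: "functional K f" for K f
  proof -
    have "bounded_linear_map ?X scalar_space (restrict f B)"
      using functionalD[OF f] sub
      by (auto simp: bounded_linear_map_def scalar_space_def X subspace_add subspace_scale
          intro!: exI[of _ K])
    then have "restrict f B \<in> vcarrier (dual ?X)" by (simp add: dual_def X)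
    from limitin_weak_topology[OF l this] show ?thesis using z lB by simp
  qed
  then show thesis using that lB by blast
qed

lemma weakly_convergent_approximate_unit:
  assumes "bounded (range z)"
    and left: "\<And>m. (\<lambda>n. z n * z m) \<longlonglongrightarrow> z m" and right: "\<And>m. (\<lambda>n. z m * z n) \<longlonglongrightarrow> z m"
    and weak: "\<And>K f. functional K f \<Longrightarrow> (\<lambda>n. f (z n)) \<longlonglongrightarrow> f l"
  shows "z \<longlonglongrightarrow> l"
proof -
  obtain R where R: "\<And>n. norm (z n) \<le> R" using assms(1) by (auto simp: bounded_iff)
  have R0: "R \<ge> 0" using R[of 0] norm_ge_zero order_trans by blast
  have zl: "z m * l = z m" for m
  proof (rule functionals_separate_points)
    fix K f assume f: "functional K f"
    have "(\<lambda>n. f (z m * z n)) \<longlonglongrightarrow> f (z m * l)" using weak[OF functional_mult_left[OF f]] .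
    moreover have "(\<lambda>n. f (z m * z n)) \<longlonglongrightarrow> f (z m)" using functional_tendsto[OF f right] .
    ultimately show "f (z m * l) = f (z m)" by (rule LIMSEQ_unique)
  qed
  \<comment> \<open>A closed subspace that contains all \<open>z m\<close> contains their weak limit
    \<open>l\<close>, by separation; so \<open>z n * l\<close> tends to \<open>l\<close>, and
    \<open>z n * l\<close> is \<open>z n\<close>.\<close>
  define V where "V = {a. (\<lambda>n. z n * a) \<longlonglongrightarrow> a}"
  have V: "subspace V"
  proof (rule subspaceI)
    show "sc c x \<in> V" if "x \<in> V" for c x
    proof -
      have "(\<lambda>n. norm c * norm (z n * x - x)) \<longlonglongrightarrow> norm c * 0"
        using that unfolding V_def
        by (intro tendsto_mult_left tendsto_norm_zero LIM_zero) simp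
      moreover have "norm c * norm (z n * x - x) = norm (z n * sc c x - sc c x)" for n
        by (simp add: mult_scale_right norm_scale flip: scale_right_diff_distrib)
      ultimately have "(\<lambda>n. norm (z n * sc c x - sc c x)) \<longlonglongrightarrow> 0" by simp
      then show ?thesis unfolding V_def by (simp add: tendsto_norm_zero_iff LIM_zero_iff)
    qed
  qed (auto simp: V_def distrib_left intro: tendsto_add)
  have V_closed: "closed V"
    unfolding closed_sequential_limits
  proof (intro allI impI, elim conjE)
    fix a l assume a: "\<forall>n. a n \<in> V" "a \<longlonglongrightarrow> l"
    show "l \<in> V"
      unfolding V_def mem_Collect_eq
    proof (rule metric_LIMSEQ_I)
      fix \<epsilon> :: real assume e: "\<epsilon> > 0"
      \<comment> \<open>With \<open>a k\<close> within \<open>\<delta>\<close> of \<open>l\<close>,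
        replacing \<open>l\<close> by \<open>a k\<close> costs at most \<open>R * \<delta>\<close>
        in the product with \<open>z n\<close> and \<open>\<delta>\<close> in the limit, together
        half of \<open>\<epsilon>\<close>.\<close>
      define \<delta> where "\<delta> = \<epsilon> / 2 / (R + 1)"
      have "R + 1 \<noteq> 0" using R0 by simp
      then have d: "\<delta> > 0" "(R + 1) * \<delta> = \<epsilon> / 2"
        unfolding \<delta>_def using e R0 by (simp, metis nonzero_mult_div_cancel_left times_divide_eq_right)
      obtain k where k: "norm (a k - l) < \<delta>" using a(2) d(1) LIMSEQ_D by blast
      have "(\<lambda>n. z n * a k) \<longlonglongrightarrow> a k" using a(1) by (simp add: V_def)
      then obtain N where N: "\<And>n. n \<ge> N \<Longrightarrow> norm (z n * a k - a k) < \<epsilon> / 2"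
        using e LIMSEQ_D half_gt_zero by blast
      have "dist (z n * l) l < \<epsilon>" if "n \<ge> N" for n
      proof -
        have "z n * l - l = z n * (l - a k) + (z n * a k - a k) + (a k - l)" by (simp add: right_diff_distrib)
        then have "norm (z n * l - l) \<le> norm (z n * (l - a k)) + norm (z n * a k - a k) + norm (a k - l)"
          using norm_triangle_ineq[of "z n * (l - a k) + (z n * a k - a k)" "a k - l"]
            norm_triangle_ineq[of "z n * (l - a k)" "z n * a k - a k"] by simp
        also have "norm (z n * (l - a k)) \<le> R * norm (a k - l)"
          using norm_mult_ineq[of "z n" "l - a k"] R[of n] mult_right_mono[of "norm (z n)" R "norm (a k - l)"]
          by (simp add: norm_minus_commute)
        finally have "norm (z n * l - l) \<le> (R + 1) * norm (a k - l) + norm (z n * a k - a k)"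
          by (simp add: algebra_simps)
        also have "(R + 1) * norm (a k - l) \<le> (R + 1) * \<delta>" using k R0 by (intro mult_left_mono) auto
        finally show ?thesis using N[OF that] d(2) by (simp add: dist_norm)
      qed
      then show "\<exists>N. \<forall>n\<ge>N. dist (z n * l) l < \<epsilon>" by blast
    qed
  qed
  have zV: "z m \<in> V" for m using left by (simp add: V_def)
  have "l \<in> V"
  proof (rule ccontr)
    assume "l \<notin> V"
    then obtain f K where f: "functional K f" "\<And>x. x \<in> V \<Longrightarrow> f x = 0" "f l = 1"
      using functional_separation[OF V V_closed] by blast
    have "(\<lambda>n. f (z n)) \<longlonglongrightarrow> 0" using f(2) zV by simp
    then have "f l = 0" using LIMSEQ_unique weak[OF f(1)] by blast
    then show False using f(3) by simp
  qed
  then show ?thesis by (simp add: V_def zl)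
qed

subsection \<open>Interpolating approximate units\<close>

definition approximate_unit_sequence :: "(nat \<Rightarrow> 'a) \<Rightarrow> bool" where
  "approximate_unit_sequence z \<longleftrightarrow> bounded (range z) \<and>
     (\<forall>m. (\<lambda>n. z n * z m) \<longlonglongrightarrow> z m) \<and> (\<forall>m. (\<lambda>n. z m * z n) \<longlonglongrightarrow> z m)"

lemma approximate_unit_subsequence:
  assumes z: "approximate_unit_sequence z" and \<phi>: "strict_mono \<phi>"
  shows "approximate_unit_sequence (z \<circ> \<phi>)"
  unfolding approximate_unit_sequence_def
proof (intro conjI allI)
  show "bounded (range (z \<circ> \<phi>))"
    using z unfolding approximate_unit_sequence_def by (auto intro: bounded_subset)
  show "(\<lambda>n. (z \<circ> \<phi>) n * (z \<circ> \<phi>) m) \<longlonglongrightarrow> (z \<circ> \<phi>) m" "(\<lambda>n. (z \<circ> \<phi>) m * (z \<circ> \<phi>) n) \<longlonglongrightarrow> (z \<circ> \<phi>) m" for m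
    using z LIMSEQ_subseq_LIMSEQ[of "\<lambda>n. z n * z (\<phi> m)" _ \<phi>] LIMSEQ_subseq_LIMSEQ[of "\<lambda>n. z (\<phi> m) * z n" _ \<phi>] \<phi>
    unfolding approximate_unit_sequence_def by (auto simp: o_def)
qed

text \<open>Along a weakly Cauchy subsequence an approximate unit in \<open>B\<close> converges in
  norm. Either \<open>x\<close> has no such subsequence, or it converges along some
  \<open>\<phi>\<close>, and then \<open>y \<circ> \<phi>\<close> has none.\<close>

lemma obtain_nowhere_weakly_Cauchy_approximate_unit:
  assumes B: "closed_subalgebra sc B" and "\<not> unital B"
    and wsc: "weakly_sequentially_complete (subspace_on (alg_space sc) B)"
    and bai: "bounded_approximate_identity B D le e"
  obtains z where "approximate_unit_sequence z"
    "\<And>\<phi> :: nat \<Rightarrow> nat. strict_mono \<phi> \<Longrightarrow> \<exists>K f. functional K f \<and> \<not> convergent (\<lambda>n. f (z (\<phi> n)))"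
proof -
  have "closed B" using B by (simp add: closed_subalgebra_def)
  then obtain \<delta> x y where \<delta>: "\<delta> > 0" "\<And>n. \<delta> \<le> dist (x n) (y n)" and xyD: "range x \<union> range y \<subseteq> e ` D"
    and lim: "\<And>a. a \<in> range x \<union> range y \<Longrightarrow> (\<lambda>n. x n * a) \<longlonglongrightarrow> a \<and> (\<lambda>n. a * x n) \<longlonglongrightarrow> a \<and>
       (\<lambda>n. y n * a) \<longlonglongrightarrow> a \<and> (\<lambda>n. a * y n) \<longlonglongrightarrow> a"
    using approximate_unit_pairs[OF bai _ \<open>\<not> unital B\<close>] by metis
  have bd: "bounded (e ` D)" "e ` D \<subseteq> B" using bai by (auto simp: bounded_approximate_identity_def)
  have xB: "x n \<in> B" and yB: "y n \<in> B" for n using xyD bd(2) by blast+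
  have "bounded (range x)" "bounded (range y)" using xyD bd(1) by (auto intro: bounded_subset)
  then have ax: "approximate_unit_sequence x" and ay: "approximate_unit_sequence y"
    using lim unfolding approximate_unit_sequence_def by auto
  have conv: "convergent w"
    if w: "approximate_unit_sequence w" "\<And>n. w n \<in> B"
      "\<And>K f. functional K f \<Longrightarrow> convergent (\<lambda>n. f (w n))" for w
  proof -
    obtain l where "\<And>K f. functional K f \<Longrightarrow> (\<lambda>n. f (w n)) \<longlonglongrightarrow> f l"
      using weak_limit_in_subalgebra[where z = w, OF B wsc w(2)] w(3) by metis
    then have "w \<longlonglongrightarrow> l"
      using w(1) weakly_convergent_approximate_unit[of w l]
      unfolding approximate_unit_sequence_def by blast
    then show ?thesis by (rule convergentI)
  qed
  show thesis
  proof (cases "\<exists>\<phi>. strict_mono \<phi> \<and> (\<forall>K f. functional K f \<longrightarrow> convergent (\<lambda>n. f (x (\<phi> n))))")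
    case False
    then show thesis using that[OF ax] by blast
  next
    case True
    then obtain \<phi> where \<phi>: "strict_mono \<phi>" "\<And>K f. functional K f \<Longrightarrow> convergent (\<lambda>n. f (x (\<phi> n)))" by blast
    have "convergent (x \<circ> \<phi>)"
      using conv[OF approximate_unit_subsequence[OF ax \<phi>(1)]] \<phi>(2) xB by simp
    then obtain l where l: "(\<lambda>n. x (\<phi> n)) \<longlonglongrightarrow> l" by (auto simp: convergent_def o_def)
    have ay': "approximate_unit_sequence (y \<circ> \<phi>)" using approximate_unit_subsequence[OF ay \<phi>(1)] .
    show thesis
    proof (rule that[OF ay'], rule ccontr)
      fix \<psi> :: "nat \<Rightarrow> nat"
      assume \<psi>: "strict_mono \<psi>" and "\<not> (\<exists>K f. functional K f \<and> \<not> convergent (\<lambda>n. f ((y \<circ> \<phi>) (\<psi> n))))"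
      then have "convergent ((y \<circ> \<phi>) \<circ> \<psi>)"
        using conv[OF approximate_unit_subsequence[OF ay' \<psi>]] yB by auto
      then obtain l' where l': "(\<lambda>n. y (\<phi> (\<psi> n))) \<longlonglongrightarrow> l'" by (auto simp: convergent_def o_def)
      \<comment> \<open>Along \<open>\<theta>\<close> both sequences converge. As each absorbs the
        members of the other, \<open>l * l'\<close> equals both \<open>l\<close> and
        \<open>l'\<close>, contrary to the distance \<open>\<delta>\<close> between the
        sequences.\<close>
      define \<theta> where "\<theta> = \<phi> \<circ> \<psi>"
      have \<theta>: "strict_mono \<theta>" unfolding \<theta>_def using \<phi>(1) \<psi> by (rule strict_mono_o)
      have X: "(\<lambda>n. x (\<theta> n)) \<longlonglongrightarrow> l" using LIMSEQ_subseq_LIMSEQ[OF l \<psi>] by (simp add: \<theta>_def o_def)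
      have Y: "(\<lambda>n. y (\<theta> n)) \<longlonglongrightarrow> l'" using l' by (simp add: \<theta>_def)
      have "x (\<theta> n) * l' = x (\<theta> n)" for n
      proof (rule LIMSEQ_unique)
        show "(\<lambda>m. x (\<theta> n) * y (\<theta> m)) \<longlonglongrightarrow> x (\<theta> n) * l'" using Y by (intro tendsto_mult_left)
        show "(\<lambda>m. x (\<theta> n) * y (\<theta> m)) \<longlonglongrightarrow> x (\<theta> n)"
          using LIMSEQ_subseq_LIMSEQ[OF _ \<theta>, of "\<lambda>m. x (\<theta> n) * y m"] lim[of "x (\<theta> n)"] by (auto simp: o_def)
      qed
      then have "l * l' = l" using LIMSEQ_unique[OF tendsto_mult_right[OF X]] X by simp
      moreover have "l * y (\<theta> n) = y (\<theta> n)" for n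
      proof (rule LIMSEQ_unique)
        show "(\<lambda>m. x (\<theta> m) * y (\<theta> n)) \<longlonglongrightarrow> l * y (\<theta> n)" using X by (intro tendsto_mult_right)
        show "(\<lambda>m. x (\<theta> m) * y (\<theta> n)) \<longlonglongrightarrow> y (\<theta> n)"
          using LIMSEQ_subseq_LIMSEQ[OF _ \<theta>, of "\<lambda>m. x m * y (\<theta> n)"] lim[of "y (\<theta> n)"] by (auto simp: o_def)
      qed
      then have "l * l' = l'" using LIMSEQ_unique[OF tendsto_mult_left[OF Y]] Y by simp
      ultimately have "l = l'" by simp
      then have "(\<lambda>n. dist (x (\<theta> n)) (y (\<theta> n))) \<longlonglongrightarrow> dist l l" using tendsto_dist[OF X Y] by simp
      then have "\<delta> \<le> dist l l" using \<delta>(2) by (intro LIMSEQ_le_const) auto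
      then show False using \<delta>(1) by simp
    qed
  qed
qed

text \<open>Functionals realising a pattern \<open>\<sigma>\<close> and its opposite are subtracted
  and divided by \<open>a - b\<close>: the unknown values \<open>a\<close> and \<open>b\<close> turn
  into 1 and -1, and the two errors of \<open>\<eta> / 2\<close> relative to \<open>dist a b\<close>
  add up to \<open>\<eta>\<close>. Finite patterns are extended to infinite ones by a limit along
  \<open>ultra\<close>.\<close>

lemma sign_functionals:
  assumes u: "bounded (range u)" and "\<eta> > 0"
    and nc: "\<And>\<phi> :: nat \<Rightarrow> nat. strict_mono \<phi> \<Longrightarrow> \<exists>K f. functional K f \<and> \<not> convergent (\<lambda>n. f (u (\<phi> n)))"
  obtains K and \<phi> :: "nat \<Rightarrow> nat" where "strict_mono \<phi>"
    "\<And>\<sigma>. \<exists>h. functional K h \<and> (\<forall>i. norm (h (u (\<phi> i)) - (if \<sigma> i then 1 else - 1)) \<le> \<eta>)"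
proof -
  obtain R where R: "\<And>n. norm (u n) \<le> R" using u by (auto simp: bounded_iff)
  define S where "S = {f. functional 1 f}"
  obtain a b and \<phi> :: "nat \<Rightarrow> nat" where ab: "a \<noteq> b" and \<phi>: "strict_mono \<phi>"
    and ind: "\<And>N \<sigma>. \<exists>s\<in>S. \<forall>i<N. dist (s (u (\<phi> i))) (if \<sigma> i then a else b) < \<eta> / 2 * dist a b"
  proof (rule rosenthal_dor_dichotomy[of S "\<lambda>n s. s (u n)" R "\<eta> / 2"])
    show "norm (s (u n)) \<le> R" if "s \<in> S" for n s
      using functionalD(4)[of 1 s "u n"] R[of n] that by (simp add: S_def)
    show "\<exists>s\<in>S. \<not> convergent (\<lambda>n. s (u (\<phi> n)))" if \<phi>: "strict_mono \<phi>" for \<phi> :: "nat \<Rightarrow> nat"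
    proof -
      obtain K f where f: "functional K f" "\<not> convergent (\<lambda>n. f (u (\<phi> n)))" using nc[OF \<phi>] by blast
      \<comment> \<open>Scaling into the unit ball of the dual, as the dichotomy asks for a
        uniformly bounded family; the added 1 guards against \<open>K = 0\<close>.\<close>
      define c :: 'k where "c = of_real (inverse (K + 1))"
      have K: "K + 1 > 0" using functionalD(1)[OF f(1)] by simp
      have "functional (norm c * K) (\<lambda>x. c * f x)" using functional_scale[OF f(1)] .
      moreover have nc1: "norm c = inverse (K + 1)" unfolding c_def norm_of_real using K by simp
      then have "norm c * K \<le> 1" using K by (simp only:) (simp add: field_simps)
      ultimately have "(\<lambda>x. c * f x) \<in> S" unfolding S_def using functional_mono by blast
      moreover have "\<not> convergent (\<lambda>n. c * f (u (\<phi> n)))"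
        using f(2) K nc1 convergent_mult_const_iff[of c "\<lambda>n. f (u (\<phi> n))"] by fastforce
      ultimately show ?thesis by (intro bexI[of _ "\<lambda>x. c * f x"])
    qed
  qed (use \<open>\<eta> > 0\<close> in auto)
  show thesis
  proof (rule that[OF \<phi>])
    fix \<sigma> :: "nat \<Rightarrow> bool"
    \<comment> \<open>This bound depends neither on \<open>N\<close>, as the limit over
      \<open>N\<close> requires, nor on \<open>\<sigma>\<close>, as \<open>K\<close> is fixed before
      \<open>\<sigma>\<close>.\<close>
    let ?K = "norm (inverse (a - b)) * (1 + norm (- 1 :: 'k) * 1)"
    have "\<exists>h. functional ?K h \<and> (\<forall>i<N. norm (h (u (\<phi> i)) - (if \<sigma> i then 1 else - 1)) \<le> \<eta>)" for N
    proof -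
      obtain s where s: "s \<in> S" "\<forall>i<N. dist (s (u (\<phi> i))) (if \<sigma> i then a else b) < \<eta> / 2 * dist a b"
        using ind[of N \<sigma>] by blast
      obtain t where t: "t \<in> S" "\<forall>i<N. dist (t (u (\<phi> i))) (if \<not> \<sigma> i then a else b) < \<eta> / 2 * dist a b"
        using ind[of N "\<lambda>i. \<not> \<sigma> i"] by blast
      define h where "h = (\<lambda>x. inverse (a - b) * (s x + (- 1) * t x))"
      have "functional ?K h"
        unfolding h_def using s(1) t(1) by (intro functional_scale functional_add) (auto simp: S_def)
      moreover have "norm (h (u (\<phi> i)) - (if \<sigma> i then 1 else - 1)) \<le> \<eta>" if i: "i < N" for i
      proof -
        define A where "A = (if \<sigma> i then a else b)"
        define A' where "A' = (if \<not> \<sigma> i then a else b)"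
        have 1: "norm (s (u (\<phi> i)) - A) \<le> \<eta> / 2 * norm (a - b)"
          "norm (t (u (\<phi> i)) - A') \<le> \<eta> / 2 * norm (a - b)"
          using s(2) t(2) i unfolding A_def A'_def by (auto simp: dist_norm intro: less_imp_le)
        have "(if \<sigma> i then 1 else - 1) = inverse (a - b) * (A - A')"
          using ab by (auto simp: A_def A'_def field_simps)
        then have "h (u (\<phi> i)) - (if \<sigma> i then 1 else - 1)
            = inverse (a - b) * ((s (u (\<phi> i)) - A) - (t (u (\<phi> i)) - A'))"
          unfolding h_def by (simp only:) (simp add: algebra_simps)
        then have "norm (h (u (\<phi> i)) - (if \<sigma> i then 1 else - 1))
            = inverse (norm (a - b)) * norm ((s (u (\<phi> i)) - A) - (t (u (\<phi> i)) - A'))"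
          by (simp add: norm_mult norm_inverse)
        also have "\<dots> \<le> inverse (norm (a - b)) * (\<eta> * norm (a - b))"
          using norm_triangle_ineq4[of "s (u (\<phi> i)) - A" "t (u (\<phi> i)) - A'"] 1
          by (intro mult_left_mono) auto
        also have "\<dots> = \<eta>" using ab by simp
        finally show ?thesis .
      qed
      ultimately show ?thesis by blast
    qed
    then obtain h where h: "\<And>N. functional ?K (h N)"
      "\<And>N i. i < N \<Longrightarrow> norm (h N (u (\<phi> i)) - (if \<sigma> i then 1 else - 1)) \<le> \<eta>" by metis
    define g where "g = (\<lambda>x. Lim ultra (\<lambda>N. h N x))"
    have "functional ?K g" unfolding g_def using functional_ultra_limit(1)[OF h(1)] .
    moreover have "norm (g (u (\<phi> i)) - (if \<sigma> i then 1 else - 1)) \<le> \<eta>" for i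
    proof (rule tendsto_upperbound)
      show "((\<lambda>N. norm (h N (u (\<phi> i)) - (if \<sigma> i then 1 else - 1))) \<longlongrightarrow>
          norm (g (u (\<phi> i)) - (if \<sigma> i then 1 else - 1))) ultra"
        unfolding g_def using functional_ultra_limit(2)[OF h(1)] by (intro tendsto_intros)
      have "\<forall>\<^sub>F N in sequentially. norm (h N (u (\<phi> i)) - (if \<sigma> i then 1 else - 1)) \<le> \<eta>"
        using h(2) by (intro eventually_sequentiallyI[of "Suc i"]) auto
      then show "\<forall>\<^sub>F N in ultra. norm (h N (u (\<phi> i)) - (if \<sigma> i then 1 else - 1)) \<le> \<eta>"
        using ultra(2) filter_leD by blast
    qed (simp add: ultra(1))
    ultimately show "\<exists>h. functional ?K h \<and> (\<forall>i. norm (h (u (\<phi> i)) - (if \<sigma> i then 1 else - 1)) \<le> \<eta>)"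
      by blast
  qed
qed

text \<open>Successive approximation, as in the open mapping theorem: subtracting half of the sign
  pattern, separately for each coordinate of \<open>'k\<close>, reduces coordinates bounded by 1 to
  at most 3/4, and the remainder, scaled by 4/3, is treated in the same way. The corrections form a
  geometric series.\<close>

lemma interpolating_subsequence_exists:
  assumes u: "bounded (range u)"
    and nc: "\<And>\<phi> :: nat \<Rightarrow> nat. strict_mono \<phi> \<Longrightarrow> \<exists>K f. functional K f \<and> \<not> convergent (\<lambda>n. f (u (\<phi> n)))"
  shows "\<exists>\<phi> :: nat \<Rightarrow> nat. strict_mono \<phi> \<and>
    (\<forall>c. bounded (range c) \<longrightarrow> (\<exists>K f. functional K f \<and> (\<forall>i. f (u (\<phi> i)) = c i)))"
proof -
  \<comment> \<open>The tolerance \<open>1 / (2 * d)\<close> is made for \<open>contract\<close>: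
    the \<open>d\<close> summands contribute errors of at most \<open>1 / (4 * d)\<close> each, 1/4
    in total, on top of the 1/2 left by subtracting half the sign from a coordinate.\<close>
  define d where "d = real DIM('k)"
  have d: "d > 0" by (simp add: d_def)
  obtain K and \<phi> :: "nat \<Rightarrow> nat" where \<phi>: "strict_mono \<phi>"
    and "\<And>\<sigma>. \<exists>h. functional K h \<and> (\<forall>i. norm (h (u (\<phi> i)) - (if \<sigma> i then 1 else - 1)) \<le> 1 / (2 * d))"
    using sign_functionals[OF u, of "1 / (2 * d)"] nc d by (metis divide_pos_pos mult_pos_pos zero_less_numeral zero_less_one)
  then obtain h where h: "\<And>\<sigma>. functional K (h \<sigma>)"
    "\<And>\<sigma> i. norm (h \<sigma> (u (\<phi> i)) - (if \<sigma> i then 1 else - 1)) \<le> 1 / (2 * d)" by metis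
  define x where "x = u \<circ> \<phi>"
  define G where "G = (\<lambda>c a. \<Sum>b\<in>Basis. (of_real (1/2) * b) * h (\<lambda>i. c i \<bullet> b \<ge> 0) a)"
  define K1 where "K1 = (\<Sum>b\<in>(Basis :: 'k set). norm (of_real (1/2) * b) * K)"
  have G: "functional K1 (G c)" for c
    unfolding G_def K1_def by (intro functional_sum functional_scale h(1)) auto
  have contract: "\<bar>(c i - G c (x i)) \<bullet> b0\<bar> \<le> 3/4"
    if c: "\<And>i b. b \<in> Basis \<Longrightarrow> \<bar>c i \<bullet> b\<bar> \<le> 1" and b0: "b0 \<in> Basis" for c i b0
  proof -
    define s where "s = (\<lambda>b. if c i \<bullet> b \<ge> 0 then 1 else - 1 :: real)"
    define \<epsilon> where "\<epsilon> = (\<lambda>b. h (\<lambda>i. c i \<bullet> b \<ge> 0) (x i) - of_real (s b))"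
    have \<epsilon>: "norm (\<epsilon> b) \<le> 1 / (2 * d)" for b
      using h(2)[of "\<lambda>i. c i \<bullet> b \<ge> 0" i] by (auto simp: \<epsilon>_def s_def x_def)
    define E where "E = (\<Sum>b\<in>Basis. (1/2) *\<^sub>R (b * \<epsilon> b))"
    have "G c (x i) = (\<Sum>b\<in>Basis. (s b / 2) *\<^sub>R b + (1/2) *\<^sub>R (b * \<epsilon> b))"
      unfolding G_def
    proof (rule sum.cong[OF refl])
      fix b :: 'k
      have "h (\<lambda>i. c i \<bullet> b \<ge> 0) (x i) = of_real (s b) + \<epsilon> b" by (simp add: \<epsilon>_def)
      then show "of_real (1/2) * b * h (\<lambda>i. c i \<bullet> b \<ge> 0) (x i) = (s b / 2) *\<^sub>R b + (1/2) *\<^sub>R (b * \<epsilon> b)"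
        by (simp only:) (simp add: scaleR_conv_of_real algebra_simps)
    qed
    then have "c i - G c (x i) = (\<Sum>b\<in>Basis. (c i \<bullet> b - s b / 2) *\<^sub>R b) - E"
      by (simp add: E_def sum.distrib scaleR_diff_left sum_subtractf euclidean_representation)
    then have "(c i - G c (x i)) \<bullet> b0 = (c i \<bullet> b0 - s b0 / 2) - E \<bullet> b0"
      using b0 by (simp add: inner_diff_left inner_sum_left_Basis)
    moreover have "\<bar>c i \<bullet> b0 - s b0 / 2\<bar> \<le> 1/2"
    proof (cases "0 \<le> c i \<bullet> b0")
      case True
      then have "s b0 = 1" by (simp add: s_def)
      then show ?thesis using c[OF b0, of i] True by linarith
    next
      case False
      then have "s b0 = - 1" by (simp add: s_def)
      then show ?thesis using c[OF b0, of i] False by linarith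
    qed
    moreover have "\<bar>E \<bullet> b0\<bar> \<le> 1/4"
    proof -
      have "\<bar>E \<bullet> b0\<bar> \<le> norm E" using b0 Basis_le_norm by blast
      also have "\<dots> \<le> (\<Sum>b\<in>(Basis :: 'k set). 1 / (4 * d))"
        unfolding E_def
      proof (rule sum_norm_le)
        show "norm ((1/2) *\<^sub>R (b * \<epsilon> b)) \<le> 1 / (4 * d)" if "b \<in> Basis" for b
          using \<epsilon>[of b] that by (simp add: norm_mult)
      qed
      also have "\<dots> = d * (1 / (4 * d))" by (simp add: d_def)
      also have "\<dots> = 1/4" using d by simp
      finally show ?thesis .
    qed
    ultimately show ?thesis by linarith
  qed
  have interp: "\<exists>K f. functional K f \<and> (\<forall>i. f (x i) = c i)"
    if c: "\<And>i b. b \<in> Basis \<Longrightarrow> \<bar>c i \<bullet> b\<bar> \<le> 1" for c :: "nat \<Rightarrow> 'k"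
  proof -
    \<comment> \<open>\<open>C k\<close> is the remainder after \<open>k\<close> corrections, blown
      up by \<open>(4/3)^k\<close>, which keeps its coordinates within 1.\<close>
    define C where "C = rec_nat c (\<lambda>_ c i. (4/3) *\<^sub>R (c i - G c (x i)))"
    have C0: "C 0 = c" and CS: "\<And>k. C (Suc k) = (\<lambda>i. (4/3) *\<^sub>R (C k i - G (C k) (x i)))"
      by (simp_all add: C_def)
    have Cb: "\<bar>C k i \<bullet> b\<bar> \<le> 1" if "b \<in> Basis" for k i b
      using that
    proof (induction k arbitrary: i b)
      case (Suc k)
      then have "\<bar>(C k i - G (C k) (x i)) \<bullet> b\<bar> \<le> 3/4" by (intro contract) auto
      then show ?case by (simp add: CS abs_mult)
    qed (simp add: C0 c)
    define f where "f = (\<lambda>k a. \<Sum>j<k. of_real ((3/4)^j) * G (C j) a)"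
    have f: "functional (4 * K1) (f k)" for k
    proof (rule functional_mono)
      show "functional (\<Sum>j<k. norm (of_real ((3/4)^j) :: 'k) * K1) (f k)"
        unfolding f_def by (intro functional_sum functional_scale G) auto
      have "(\<Sum>j<k. norm (of_real ((3/4)^j) :: 'k) * K1) = (\<Sum>j<k. (3/4)^j) * K1"
        by (simp add: sum_distrib_right norm_power del: of_real_power)
      also have "(\<Sum>j<k. (3/4::real)^j) \<le> 4" by (simp add: geometric_sum)
      then have "(\<Sum>j<k. (3/4)^j) * K1 \<le> 4 * K1"
        using functionalD(1)[OF G] by (rule mult_right_mono)
      finally show "(\<Sum>j<k. norm (of_real ((3/4)^j) :: 'k) * K1) \<le> 4 * K1" .
    qed
    define g where "g = (\<lambda>a. Lim ultra (\<lambda>k. f k a))"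
    have "functional (4 * K1) g" unfolding g_def using functional_ultra_limit(1)[OF f] .
    moreover have "g (x i) = c i" for i
    proof -
      have fk: "f k (x i) = c i - (3/4)^k *\<^sub>R C k i" for k
      proof (induction k)
        case (Suc k)
        have "(3/4)^Suc k *\<^sub>R C (Suc k) i = (3/4)^k *\<^sub>R C k i - (3/4)^k *\<^sub>R G (C k) (x i)"
          by (simp add: CS scaleR_diff_right)
        moreover have "f (Suc k) (x i) = f k (x i) + (3/4)^k *\<^sub>R G (C k) (x i)"
          by (simp add: f_def scaleR_conv_of_real)
        ultimately show ?case using Suc by simp
      qed (simp add: f_def C0)
      have "norm (C k i) \<le> d" for k
      proof -
        have "norm (C k i) \<le> (\<Sum>b\<in>Basis. \<bar>C k i \<bullet> b\<bar>)" by (rule norm_le_l1)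
        also have "\<dots> \<le> (\<Sum>b\<in>(Basis :: 'k set). 1)" by (intro sum_mono Cb)
        finally show ?thesis by (simp add: d_def)
      qed
      then have "\<forall>\<^sub>F k in sequentially. norm ((3/4)^k *\<^sub>R C k i) \<le> (3/4)^k * d"
        by (intro always_eventually allI) (simp add: mult_left_mono)
      moreover have "(\<lambda>k. (3/4)^k * d) \<longlonglongrightarrow> 0"
        by (rule tendsto_mult_left_zero) (rule LIMSEQ_power_zero, simp)
      ultimately have "(\<lambda>k. (3/4)^k *\<^sub>R C k i) \<longlonglongrightarrow> 0" by (rule Lim_null_comparison)
      then have "(\<lambda>k. f k (x i)) \<longlonglongrightarrow> c i - 0" unfolding fk by (intro tendsto_intros)
      then show ?thesis unfolding g_def using tendsto_ultra by (intro tendsto_Lim ultra(1)) simp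
    qed
    ultimately show ?thesis by blast
  qed
  show ?thesis
  proof (intro exI[of _ \<phi>] conjI allI impI \<phi>)
    fix c :: "nat \<Rightarrow> 'k" assume "bounded (range c)"
    then obtain R where R: "R > 0" "\<And>i. norm (c i) \<le> R" by (auto simp: bounded_pos)
    have "\<bar>(c i /\<^sub>R R) \<bullet> b\<bar> \<le> 1" if "b \<in> Basis" for i b
    proof -
      have "\<bar>(c i /\<^sub>R R) \<bullet> b\<bar> \<le> norm (c i /\<^sub>R R)" using that by (rule Basis_le_norm)
      also have "\<dots> \<le> 1" using R(1) R(2)[of i] by (simp add: field_simps)
      finally show ?thesis .
    qed
    then obtain K f where f: "functional K f" "\<And>i. f (x i) = c i /\<^sub>R R" using interp[of "\<lambda>i. c i /\<^sub>R R"] by blast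
    have "functional (norm (of_real R :: 'k) * K) (\<lambda>a. of_real R * f a)" using functional_scale[OF f(1)] .
    moreover have "of_real R * f (u (\<phi> i)) = c i" for i
      using f(2)[of i] R(1) by (simp add: x_def scaleR_conv_of_real)
    ultimately show "\<exists>K f. functional K f \<and> (\<forall>i. f (u (\<phi> i)) = c i)" by blast
  qed
qed

lemma interpolating_approximate_units_exist:
  assumes B: "closed_subalgebra sc B" and "\<not> unital B"
    and wsc: "weakly_sequentially_complete (subspace_on (alg_space sc) B)"
    and bai: "bounded_approximate_identity B D le e"
  shows "\<exists>R x y. (\<forall>k j. norm (x k j) \<le> R) \<and> (\<forall>k j. norm (y k j) \<le> R) \<and>
    (\<forall>k i. (\<lambda>j. x k i * y k j) \<longlonglongrightarrow> x k i) \<and> (\<forall>k j. (\<lambda>i. x k i * y k j) \<longlonglongrightarrow> y k j) \<and>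
    (\<forall>c :: nat \<Rightarrow> 'k. bounded (range c) \<longrightarrow>
      (\<exists>K f. functional K f \<and> (\<forall>(k :: nat) (j :: nat). f (x k j) = c k \<and> f (y k j) = 0)))"
proof -
  obtain z where z: "approximate_unit_sequence z"
    "\<And>\<phi> :: nat \<Rightarrow> nat. strict_mono \<phi> \<Longrightarrow> \<exists>K f. functional K f \<and> \<not> convergent (\<lambda>n. f (z (\<phi> n)))"
    using obtain_nowhere_weakly_Cauchy_approximate_unit[OF assms] by metis
  have "bounded (range z)" using z(1) by (simp add: approximate_unit_sequence_def)
  then obtain \<phi> :: "nat \<Rightarrow> nat" where \<phi>: "strict_mono \<phi>"
    and interp: "\<And>c. bounded (range c) \<Longrightarrow> \<exists>K f. functional K f \<and> (\<forall>i. f (z (\<phi> i)) = c i)"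
    using interpolating_subsequence_exists[of z, OF _ z(2)] by blast
  define u where "u = z \<circ> \<phi>"
  have "approximate_unit_sequence u" unfolding u_def using approximate_unit_subsequence[OF z(1) \<phi>] .
  then have u: "bounded (range u)" "\<And>m. (\<lambda>n. u n * u m) \<longlonglongrightarrow> u m" "\<And>m. (\<lambda>n. u m * u n) \<longlonglongrightarrow> u m"
    by (auto simp: approximate_unit_sequence_def)
  obtain R where R: "\<And>n. norm (u n) \<le> R" using u(1) by (auto simp: bounded_iff)
  \<comment> \<open>Row \<open>k\<close> of an enumeration of pairs; its even columns become
    \<open>x k\<close>, its odd columns \<open>y k\<close>. Indices tend to infinity along a row, so
    that along each block the products with a fixed \<open>u m\<close> still tend to
    \<open>u m\<close>.\<close>
  define p where "p = (\<lambda>k j. prod_encode (k, j))"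
  have p_le: "j \<le> p k j" for k j
    unfolding p_def by (rule le_prod_encode_2)
  have at_top: "filterlim (\<lambda>j. p k (2 * j + r)) sequentially sequentially" for k r
    unfolding filterlim_at_top
  proof
    fix N
    have "N \<le> p k (2 * j + r)" if "N \<le> j" for j using p_le[of "2 * j + r" k] that by linarith
    then show "\<forall>\<^sub>F j in sequentially. N \<le> p k (2 * j + r)" by (rule eventually_sequentiallyI)
  qed
  show ?thesis
  proof (rule exI[of _ R], rule exI[of _ "\<lambda>k j. u (p k (2 * j + 0))"],
      rule exI[of _ "\<lambda>k j. u (p k (2 * j + 1))"], intro conjI allI impI)
    show "(\<lambda>j. u (p k (2 * i + 0)) * u (p k (2 * j + 1))) \<longlonglongrightarrow> u (p k (2 * i + 0))" for k i
      using filterlim_compose[OF u(3) at_top] .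
    show "(\<lambda>i. u (p k (2 * i + 0)) * u (p k (2 * j + 1))) \<longlonglongrightarrow> u (p k (2 * j + 1))" for k j
      using filterlim_compose[OF u(2) at_top] .
    fix c :: "nat \<Rightarrow> 'k" assume c: "bounded (range c)"
    define c' where "c' = (\<lambda>n. if even (snd (prod_decode n)) then c (fst (prod_decode n)) else 0)"
    have "range c' \<subseteq> insert 0 (range c)" by (auto simp: c'_def)
    then have "bounded (range c')" using c bounded_subset bounded_insert by metis
    then obtain K f where f: "functional K f" "\<And>i. f (u i) = c' i"
      using interp[of c'] unfolding u_def comp_def by blast
    have "f (u (p k (2 * j + 0))) = c k \<and> f (u (p k (2 * j + 1))) = 0" for k j
      by (simp add: f(2) c'_def p_def)
    then show "\<exists>K f. functional K f \<and> (\<forall>k j. f (u (p k (2 * j + 0))) = c k \<and> f (u (p k (2 * j + 1))) = 0)"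
      using f(1) by blast
  qed (simp_all only: R)
qed

subsection \<open>Weakly almost periodic functionals and Arens products\<close>

abbreviation adual :: "('k, 'a \<Rightarrow> 'k) nspace" where "adual \<equiv> dual (alg_space sc)"

lemma adual_carrier: "f \<in> vcarrier adual \<longleftrightarrow> (\<exists>K. functional K f)"
proof
  assume "f \<in> vcarrier adual"
  then have f: "\<And>x y. f (x + y) = f x + f y" "\<And>c x. f (sc c x) = c * f x"
    and "\<exists>C. \<forall>x. norm (f x) \<le> C * norm x"
    by (auto simp: dual_def alg_space_def bounded_linear_map_def scalar_space_def)
  then obtain C where C: "\<And>x. norm (f x) \<le> C * norm x" by blast
  have "norm (f x) \<le> max C 0 * norm x" for x
    using C[of x] mult_right_mono[of C "max C 0" "norm x"] by simp
  then show "\<exists>K. functional K f" using f unfolding functional_def by (intro exI[of _ "max C 0"]) auto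
next
  assume "\<exists>K. functional K f"
  then show "f \<in> vcarrier adual"
    by (auto simp: functional_def dual_def alg_space_def bounded_linear_map_def scalar_space_def)
qed

lemma adual_simps:
  "vadd adual f g = (\<lambda>x. f x + g x)" "vscale adual c f = (\<lambda>x. c * f x)"
  by (simp_all add: dual_def alg_space_def restrict_UNIV)

lemma functional_unit_ball_bound:
  assumes f: "functional K f" and M: "\<And>x. norm x \<le> 1 \<Longrightarrow> norm (f x) \<le> M"
  shows "functional M f"
proof -
  have "norm (f x) \<le> M * norm x" for x
  proof (cases "x = 0")
    case True
    then show ?thesis using functional_simps(1)[OF f] by simp
  next
    case False
    define c :: 'k where "c = of_real (inverse (norm x))"
    have c: "norm c = inverse (norm x)" by (simp add: c_def norm_inverse)
    have "norm (sc c x) \<le> 1" using False by (simp add: norm_scale c)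
    then have "norm (f (sc c x)) \<le> M" by (rule M)
    then have "inverse (norm x) * norm (f x) \<le> M" by (simp add: functionalD(3)[OF f] norm_mult c)
    then show ?thesis using False by (simp add: field_simps)
  qed
  moreover have "0 \<le> M" using M[of 0] norm_ge_zero order_trans by (metis norm_zero zero_le_one)
  ultimately show ?thesis using functionalD[OF f] by (simp add: functional_def)
qed

lemma functional_adual_norm:
  assumes "functional K f"
  shows "functional (vnorm adual f) f" "vnorm adual f \<le> K"
proof -
  have n: "vnorm adual f = (SUP x\<in>{x. norm x \<le> 1}. norm (f x))" by (simp add: dual_def alg_space_def)
  have le: "norm (f x) \<le> K" if "norm x \<le> 1" for x
    using functionalD(4)[OF assms, of x] mult_left_mono[OF that functionalD(1)[OF assms]] by simp
  then have "bdd_above ((\<lambda>x. norm (f x)) ` {x. norm x \<le> 1})" by (auto simp: bdd_above_def)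
  then show "functional (vnorm adual f) f"
    unfolding n by (intro functional_unit_ball_bound[OF assms] cSUP_upper) auto
  have "{x::'a. norm x \<le> 1} \<noteq> {}" by (auto intro: exI[of _ 0])
  then show "vnorm adual f \<le> K" unfolding n using le by (intro cSUP_least) auto
qed

section \<open>Functionals on the dual: point evaluations and their limits\<close>

lemma bidualD:
  assumes "h \<in> vcarrier (dual adual)" "functional K f" "functional K' g"
  shows "h (\<lambda>x. f x + c * g x) = h f + c * h g"
proof -
  have fg: "f \<in> vcarrier adual" "g \<in> vcarrier adual" "(\<lambda>x. c * g x) \<in> vcarrier adual"
    using assms(2,3) functional_scale adual_carrier by blast+
  have "bounded_linear_map adual scalar_space h" using assms(1) by (simp add: dual_def[of adual])
  then show ?thesis using fg unfolding bounded_linear_map_def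
    by (simp add: adual_simps scalar_space_def)
qed

lemma bidualI:
  assumes add: "\<And>K f K' g. functional K f \<Longrightarrow> functional K' g \<Longrightarrow> h (\<lambda>x. f x + g x) = h f + h g"
    and scale: "\<And>K f c. functional K f \<Longrightarrow> h (\<lambda>x. c * f x) = c * h f"
    and bound: "\<And>K f. functional K f \<Longrightarrow> norm (h f) \<le> C * K"
  shows "restrict h (vcarrier adual) \<in> vcarrier (dual adual)"
proof -
  have "bounded_linear_map adual scalar_space (restrict h (vcarrier adual))"
    unfolding bounded_linear_map_def
  proof (intro conjI ballI allI exI)
    fix f assume "f \<in> vcarrier adual"
    then obtain K where f: "functional K f" by (auto simp: adual_carrier)
    show "restrict h (vcarrier adual) f \<in> vcarrier scalar_space" by (simp add: scalar_space_def)
    have cf: "(\<lambda>x. c * f x) \<in> vcarrier adual" for c using functional_scale[OF f] adual_carrier by blast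
    show "restrict h (vcarrier adual) (vscale adual c f) = vscale scalar_space c (restrict h (vcarrier adual) f)" for c
      using cf \<open>f \<in> vcarrier adual\<close> by (simp add: adual_simps scalar_space_def scale[OF f])
    show "vnorm scalar_space (restrict h (vcarrier adual) f) \<le> C * vnorm adual f"
      using bound[OF functional_adual_norm(1)[OF f]] \<open>f \<in> vcarrier adual\<close> by (simp add: scalar_space_def)
    fix g assume "g \<in> vcarrier adual"
    then obtain K' where g: "functional K' g" by (auto simp: adual_carrier)
    have "(\<lambda>x. f x + g x) \<in> vcarrier adual" using functional_add[OF f g] adual_carrier by blast
    then show "restrict h (vcarrier adual) (vadd adual f g)
        = vadd scalar_space (restrict h (vcarrier adual) f) (restrict h (vcarrier adual) g)"
      using \<open>f \<in> vcarrier adual\<close> \<open>g \<in> vcarrier adual\<close>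
      by (simp add: adual_simps scalar_space_def add[OF f g])
  qed
  then show ?thesis by (simp add: dual_def[of adual])
qed

text \<open>The canonical image of \<open>\<psi>\<close> in the bidual, restricted because elements
  of \<open>dual\<close> are extensional.\<close>

definition eval_at :: "'a \<Rightarrow> ('a \<Rightarrow> 'k) \<Rightarrow> 'k" where
  "eval_at \<psi> = (\<lambda>f\<in>vcarrier adual. f \<psi>)"

text \<open>For bounded \<open>x\<close>, the weak-star limit along \<open>ultra\<close> of the
  canonical images of the \<open>x j\<close>.\<close>

definition ultra_eval :: "(nat \<Rightarrow> 'a) \<Rightarrow> ('a \<Rightarrow> 'k) \<Rightarrow> 'k" where
  "ultra_eval x = (\<lambda>f\<in>vcarrier adual. Lim ultra (\<lambda>j. f (x j)))"

lemma eval_at_apply: "functional K f \<Longrightarrow> eval_at \<psi> f = f \<psi>"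
  using adual_carrier by (auto simp: eval_at_def)

lemma ultra_eval_apply: "functional K f \<Longrightarrow> ultra_eval x f = Lim ultra (\<lambda>j. f (x j))"
  using adual_carrier by (auto simp: ultra_eval_def)

lemma eval_at_bidual: "eval_at \<psi> \<in> vcarrier (dual adual)"
  unfolding eval_at_def using functionalD(4)
  by (intro bidualI[where C = "norm \<psi>"]) (auto simp: mult.commute)

lemma ultra_eval_lim:
  assumes x: "\<And>j. norm (x j) \<le> R" and f: "functional K f"
  shows "((\<lambda>j. f (x j)) \<longlongrightarrow> ultra_eval x f) ultra"
proof -
  have "bounded (range x)" using x by (auto simp: bounded_iff)
  then show ?thesis
    unfolding ultra_eval_apply[OF f] by (intro tendsto_ultra_Lim functional_bounded[OF f])
qed

lemma ultra_eval_eqI: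
  assumes "functional K f" "((\<lambda>j. f (x j)) \<longlongrightarrow> l) ultra"
  shows "ultra_eval x f = l"
  unfolding ultra_eval_apply[OF assms(1)] using assms(2) by (intro tendsto_Lim ultra(1))

lemma ultra_eval_linear:
  assumes x: "\<And>j. norm (x j) \<le> R" and f: "functional K f" and g: "functional K' g"
  shows "ultra_eval x (\<lambda>a. f a + g a) = ultra_eval x f + ultra_eval x g"
    "ultra_eval x (\<lambda>a. c * f a) = c * ultra_eval x f" "norm (ultra_eval x f) \<le> R * K"
proof -
  note lf = ultra_eval_lim[OF x f] and lg = ultra_eval_lim[OF x g]
  show "ultra_eval x (\<lambda>a. f a + g a) = ultra_eval x f + ultra_eval x g"
    using tendsto_add[OF lf lg] by (rule ultra_eval_eqI[OF functional_add[OF f g]])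
  show "ultra_eval x (\<lambda>a. c * f a) = c * ultra_eval x f"
    using tendsto_mult_left[OF lf] by (rule ultra_eval_eqI[OF functional_scale[OF f]])
  have "norm (f (x j)) \<le> R * K" for j
    using functionalD(4)[OF f, of "x j"] mult_left_mono[OF x functionalD(1)[OF f], of j]
    by (simp add: mult.commute)
  then show "norm (ultra_eval x f) \<le> R * K"
    using ultra(1) by (intro tendsto_upperbound[OF tendsto_norm[OF lf]]) auto
qed

lemma ultra_eval_bidual:
  assumes "\<And>j. norm (x j) \<le> R" shows "ultra_eval x \<in> vcarrier (dual adual)"
proof -
  have "restrict (ultra_eval x) (vcarrier adual) \<in> vcarrier (dual adual)"
    using ultra_eval_linear[of x R, OF assms] functional_zero by (intro bidualI[where C = R]) blast+
  then show ?thesis by (simp add: ultra_eval_def)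
qed

section \<open>The weak topology of the dual and linear combinations in \<open>WAP\<close>\<close>

lemma topspace_weak_adual: "topspace (weak_topology adual) = vcarrier adual"
proof
  show "vcarrier adual \<subseteq> topspace (weak_topology adual)"
    using openin_subset[OF openin_weak_topology[OF eval_at_bidual open_UNIV]] by auto
qed (rule topspace_weak_topology)

text \<open>Point evaluations separate the elements of the dual. The Hausdorff property makes weakly
  compact sets closed, so that relative weak compactness can be shown by inclusion in a compact
  set.\<close>

lemma Hausdorff_weak_adual: "Hausdorff_space (weak_topology adual)"
  unfolding Hausdorff_space_def
proof (intro allI impI, elim conjE)
  fix f g assume fg: "f \<in> topspace (weak_topology adual)" "g \<in> topspace (weak_topology adual)" "f \<noteq> g"
  obtain \<psi> where "f \<psi> \<noteq> g \<psi>" using fg(3) by auto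
  moreover have f: "f \<in> vcarrier adual" and g: "g \<in> vcarrier adual"
    using fg topspace_weak_adual by auto
  ultimately have "eval_at \<psi> f \<noteq> eval_at \<psi> g" by (simp add: eval_at_def)
  then obtain U V where UV: "open U" "open V" "eval_at \<psi> f \<in> U" "eval_at \<psi> g \<in> V" "U \<inter> V = {}"
    using hausdorff[of "eval_at \<psi> f" "eval_at \<psi> g"] by blast
  show "\<exists>U V. openin (weak_topology adual) U \<and> openin (weak_topology adual) V \<and> f \<in> U \<and> g \<in> V \<and> disjnt U V"
  proof (intro exI conjI)
    show "openin (weak_topology adual) {x \<in> vcarrier adual. eval_at \<psi> x \<in> U}"
      "openin (weak_topology adual) {x \<in> vcarrier adual. eval_at \<psi> x \<in> V}"
      using UV openin_weak_topology[OF eval_at_bidual] by blast+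
    show "f \<in> {x \<in> vcarrier adual. eval_at \<psi> x \<in> U}" "g \<in> {x \<in> vcarrier adual. eval_at \<psi> x \<in> V}"
      using UV f g by auto
    show "disjnt {x \<in> vcarrier adual. eval_at \<psi> x \<in> U} {x \<in> vcarrier adual. eval_at \<psi> x \<in> V}"
      using UV(5) by (auto simp: disjnt_def)
  qed
qed

lemma relatively_weakly_compactI:
  assumes "compactin (weak_topology adual) K" "S \<subseteq> K"
  shows "relatively_weakly_compact adual S"
proof -
  have "closedin (weak_topology adual) K"
    using assms(1) Hausdorff_weak_adual compactin_imp_closedin by blast
  then have "weak_topology adual closure_of S \<subseteq> K" using assms(2) by (rule closure_of_minimal[rotated])
  then show ?thesis
    unfolding relatively_weakly_compact_def using assms(1) closed_compactin closedin_closure_of by blast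
qed

lemma orbit_subset_adual:
  "functional K f \<Longrightarrow> {(\<lambda>\<psi>. f (\<phi> * \<psi>)) | \<phi>. norm \<phi> \<le> 1} \<subseteq> vcarrier adual"
  using functional_mult_left[of K f] adual_carrier by blast

lemma WAP_zero: "(\<lambda>x. 0) \<in> WAP sc"
proof -
  have "(\<lambda>x. 0) \<in> vcarrier adual" using functional_zero adual_carrier by blast
  then have "compactin (weak_topology adual) {\<lambda>x. 0}" by (simp add: topspace_weak_adual)
  then have "relatively_weakly_compact adual {(\<lambda>\<psi>. (\<lambda>x. 0) (\<phi> * \<psi>)) | \<phi>. norm \<phi> \<le> 1}"
    by (rule relatively_weakly_compactI) auto
  then show ?thesis using \<open>(\<lambda>x. 0) \<in> vcarrier adual\<close> by (simp add: WAP_def)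
qed

text \<open>The weak topology is generated by the functionals \<open>h\<close>, so continuity may be
  tested on each of them, where the map becomes \<open>h (fst p) + c * h (snd p)\<close>.\<close>

lemma continuous_map_weak_combination:
  "continuous_map (prod_topology (weak_topology adual) (weak_topology adual)) (weak_topology adual)
     (\<lambda>p x. fst p x + c * snd p x)"
proof -
  let ?W = "weak_topology adual"
  have sub: "(\<lambda>p x. fst p x + c * snd p x) ` topspace (prod_topology ?W ?W) \<subseteq> vcarrier adual"
  proof clarify
    fix f g assume "(f, g) \<in> topspace (prod_topology ?W ?W)"
    then obtain K K' where "functional K f" "functional K' g"
      by (auto simp: topspace_weak_adual adual_carrier)
    then have "functional (K + norm c * K') (\<lambda>x. f x + c * g x)"
      by (intro functional_add functional_scale)
    then show "(\<lambda>x. fst (f, g) x + c * snd (f, g) x) \<in> vcarrier adual"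
      unfolding adual_carrier by auto
  qed
  have op: "openin (prod_topology ?W ?W)
      ((\<lambda>p x. fst p x + c * snd p x) -` {x \<in> vcarrier adual. h x \<in> U} \<inter> topspace (prod_topology ?W ?W))"
    if h: "h \<in> vcarrier (dual adual)" and U: "open U" for h U
  proof -
    have "continuous_map (prod_topology ?W ?W) euclidean (\<lambda>p. h (fst p) + c * h (snd p))"
    proof (rule continuous_map_add)
      show "continuous_map (prod_topology ?W ?W) euclidean (\<lambda>p. h (fst p))"
        using continuous_map_compose[OF continuous_map_fst continuous_map_weak_topology[OF h]]
        by (simp add: o_def)
      have "continuous_map euclidean euclidean (\<lambda>t. c * t)" by (simp add: continuous_intros)
      from continuous_map_compose[OF continuous_map_compose[OF continuous_map_snd continuous_map_weak_topology[OF h]] this]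
      show "continuous_map (prod_topology ?W ?W) euclidean (\<lambda>p. c * h (snd p))" by (simp add: o_def)
    qed
    then have "openin (prod_topology ?W ?W)
        {p \<in> topspace (prod_topology ?W ?W). h (fst p) + c * h (snd p) \<in> U}"
      using U by (simp add: continuous_map)
    moreover have "h (\<lambda>x. fst p x + c * snd p x) = h (fst p) + c * h (snd p)"
      if "p \<in> topspace (prod_topology ?W ?W)" for p
      using that bidualD[OF h] by (auto simp: topspace_weak_adual adual_carrier)
    then have "(\<lambda>p x. fst p x + c * snd p x) -` {x \<in> vcarrier adual. h x \<in> U} \<inter> topspace (prod_topology ?W ?W)
        = {p \<in> topspace (prod_topology ?W ?W). h (fst p) + c * h (snd p) \<in> U}"
      using sub by auto
    ultimately show ?thesis by simp
  qed
  have "\<Union>{{x \<in> vcarrier adual. f x \<in> U} | f U. f \<in> vcarrier (dual adual) \<and> open U} = vcarrier adual"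
    using topspace_weak_adual by (simp add: weak_topology_def topology_generated_by_topspace)
  then show ?thesis
    using sub op unfolding weak_topology_def[of adual] continuous_on_generated_topo_iff
    by (auto simp: weak_topology_def)
qed

text \<open>The orbit of the combination lies in the continuous image of the product of the two
  orbit closures, which is compact.\<close>

lemma WAP_combination:
  assumes f: "f \<in> WAP sc" and g: "g \<in> WAP sc"
  shows "(\<lambda>x. f x + c * g x) \<in> WAP sc"
proof -
  let ?W = "weak_topology adual"
  define Of where "Of = (\<lambda>f. {(\<lambda>\<psi>. f (\<phi> * \<psi>)) | \<phi>. norm \<phi> \<le> 1} :: ('a \<Rightarrow> 'k) set)"
  obtain K K' where fK: "functional K f" and gK: "functional K' g"
    using f g adual_carrier by (auto simp: WAP_def)
  have h: "functional (K + norm c * K') (\<lambda>x. f x + c * g x)"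
    using functional_add[OF fK functional_scale[OF gK]] .
  have "compactin ?W (?W closure_of Of f)" "compactin ?W (?W closure_of Of g)"
    using f g by (simp_all add: WAP_def relatively_weakly_compact_def Of_def)
  then have "compactin (prod_topology ?W ?W) ((?W closure_of Of f) \<times> (?W closure_of Of g))"
    by (simp add: compactin_Times)
  then have comp: "compactin ?W ((\<lambda>p x. fst p x + c * snd p x) ` ((?W closure_of Of f) \<times> (?W closure_of Of g)))"
    by (rule image_compactin[OF _ continuous_map_weak_combination])
  have sub: "Of u \<subseteq> ?W closure_of Of u" if "functional K u" for K u
    using orbit_subset_adual[OF that] by (intro closure_of_subset) (simp add: Of_def topspace_weak_adual)
  have "Of (\<lambda>x. f x + c * g x) \<subseteq>
      (\<lambda>p x. fst p x + c * snd p x) ` ((?W closure_of Of f) \<times> (?W closure_of Of g))"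
  proof
    fix v assume "v \<in> Of (\<lambda>x. f x + c * g x)"
    then obtain \<phi> where \<phi>: "norm \<phi> \<le> 1" "v = (\<lambda>\<psi>. f (\<phi> * \<psi>) + c * g (\<phi> * \<psi>))" by (auto simp: Of_def)
    have "(\<lambda>\<psi>. f (\<phi> * \<psi>)) \<in> Of f" "(\<lambda>\<psi>. g (\<phi> * \<psi>)) \<in> Of g" using \<phi>(1) by (auto simp: Of_def)
    then show "v \<in> (\<lambda>p x. fst p x + c * snd p x) ` ((?W closure_of Of f) \<times> (?W closure_of Of g))"
      using sub[OF fK] sub[OF gK] \<phi>(2) by (intro image_eqI[of _ _ "((\<lambda>\<psi>. f (\<phi> * \<psi>)), (\<lambda>\<psi>. g (\<phi> * \<psi>)))"]) auto
  qed
  then have "relatively_weakly_compact adual (Of (\<lambda>x. f x + c * g x))"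
    by (rule relatively_weakly_compactI[OF comp])
  then show ?thesis using h adual_carrier by (auto simp: WAP_def Of_def)
qed

text \<open>The easy half of Grothendieck's double limit criterion: both iterated limits of
  \<open>f (x i * y j)\<close> are expressed by a weak cluster point of the orbit of \<open>f\<close>.\<close>

lemma WAP_double_limit:
  assumes f: "f \<in> WAP sc" and x: "\<And>j. norm (x j) \<le> R" and y: "\<And>j. norm (y j) \<le> R"
    and xy: "\<And>i. (\<lambda>j. x i * y j) \<longlonglongrightarrow> x i" "\<And>j. (\<lambda>i. x i * y j) \<longlonglongrightarrow> y j"
  shows "ultra_eval x f = ultra_eval y f"
proof -
  let ?W = "weak_topology adual"
  define S where "S = ({(\<lambda>\<psi>. f (\<phi> * \<psi>)) | \<phi>. norm \<phi> \<le> 1} :: ('a \<Rightarrow> 'k) set)"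
  obtain K where fK: "functional K f" using f adual_carrier by (auto simp: WAP_def)
  have comp: "compactin ?W (?W closure_of S)"
    using f by (simp add: WAP_def relatively_weakly_compact_def S_def)
  \<comment> \<open>The orbit in the definition of \<open>WAP\<close> ranges over the unit ball;
    dividing by \<open>R + 1\<close> moves all \<open>x j\<close> into it, and \<open>c\<close>
    cancels at the end.\<close>
  define c :: 'k where "c = of_real (inverse (R + 1))"
  have R: "R \<ge> 0" using x[of 0] norm_ge_zero order_trans by blast
  have nc: "norm c = inverse (R + 1)" unfolding c_def norm_of_real using R by simp
  then have c0: "norm c \<noteq> 0" using R by simp
  define v where "v = (\<lambda>j \<psi>. f (sc c (x j) * \<psi>))"
  have v: "v j \<psi> = c * f (x j * \<psi>)" for j \<psi>
    by (simp add: v_def mult_scale_left functionalD(3)[OF fK])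
  have "v j \<in> S" for j
  proof -
    have "norm (sc c (x j)) \<le> 1" using x[of j] R by (simp add: norm_scale nc field_simps)
    then show ?thesis by (auto simp: S_def v_def)
  qed
  moreover have "S \<subseteq> ?W closure_of S"
    using orbit_subset_adual[OF fK] by (intro closure_of_subset) (simp add: S_def topspace_weak_adual)
  ultimately obtain g where g: "g \<in> ?W closure_of S" "limitin ?W v g ultra"
    using ultra_limit_in_compact[OF comp, of v] by blast
  have "g \<in> vcarrier adual" using g(1) closure_of_subset_topspace[of ?W S] topspace_weak_adual by auto
  then obtain K' where gK: "functional K' g" using adual_carrier by blast
  have vK: "functional (K * norm (sc c (x j))) (v j)" for j
    unfolding v_def by (rule functional_mult_left[OF fK])
  \<comment> \<open>Point evaluations, together with the absorption of \<open>y i\<close> by the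
    \<open>x j\<close>, determine \<open>g\<close> at the points \<open>y i\<close>; this is all
    that \<open>ultra_eval y g\<close> depends on.\<close>
  have gy: "g (y i) = c * f (y i)" for i
  proof -
    have "((\<lambda>j. eval_at (y i) (v j)) \<longlongrightarrow> eval_at (y i) g) ultra"
      by (rule limitin_weak_topology[OF g(2) eval_at_bidual])
    then have "((\<lambda>j. c * f (x j * y i)) \<longlongrightarrow> g (y i)) ultra"
      by (simp add: eval_at_apply[OF vK] eval_at_apply[OF gK] v)
    moreover have "((\<lambda>j. c * f (x j * y i)) \<longlongrightarrow> c * f (y i)) ultra"
      by (intro tendsto_mult_left tendsto_ultra functional_tendsto[OF fK] xy)
    ultimately show ?thesis using tendsto_unique ultra(1) by blast
  qed
  \<comment> \<open>Here convergence in the weak topology enters and not just pointwise convergence: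
    the test functional is \<open>ultra_eval y\<close>.\<close>
  have "((\<lambda>j. ultra_eval y (v j)) \<longlongrightarrow> ultra_eval y g) ultra"
    by (rule limitin_weak_topology[OF g(2) ultra_eval_bidual[of y R, OF y]])
  moreover have "ultra_eval y (v j) = c * f (x j)" for j
    by (rule ultra_eval_eqI[OF vK])
      (unfold v, intro tendsto_mult_left tendsto_ultra functional_tendsto[OF fK] xy)
  moreover have "ultra_eval y g = c * ultra_eval y f"
    by (rule ultra_eval_eqI[OF gK])
      (unfold gy, intro tendsto_mult_left ultra_eval_lim[of y R, OF y fK])
  ultimately have "((\<lambda>j. c * f (x j)) \<longlongrightarrow> c * ultra_eval y f) ultra" by simp
  moreover have "((\<lambda>j. c * f (x j)) \<longlongrightarrow> c * ultra_eval x f) ultra"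
    by (intro tendsto_mult_left ultra_eval_lim[of x R, OF x fK])
  ultimately have "c * ultra_eval y f = c * ultra_eval x f" using tendsto_unique ultra(1) by blast
  then show ?thesis using c0 by simp
qed

text \<open>At every \<open>f\<close>, the first Arens product of \<open>ultra_eval x\<close> and
  \<open>ultra_eval y\<close> takes the value \<open>ultra_eval x f\<close>, the second the value
  \<open>ultra_eval y f\<close>, since the inner limits are \<open>f (x i)\<close> and
  \<open>f (y i)\<close>.\<close>

lemma arens_products_differ:
  assumes x: "\<And>j. norm (x j) \<le> R" and y: "\<And>j. norm (y j) \<le> R"
    and xy: "\<And>i. (\<lambda>j. x i * y j) \<longlonglongrightarrow> x i" "\<And>j. (\<lambda>i. x i * y j) \<longlonglongrightarrow> y j"
    and f: "functional K f" and ne: "ultra_eval x f \<noteq> ultra_eval y f"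
  shows "\<not> arens_regular sc"
proof
  assume "arens_regular sc"
  then have "arens_fst sc (ultra_eval x) (ultra_eval y) = arens_snd sc (ultra_eval x) (ultra_eval y)"
    using ultra_eval_bidual[of x R, OF x] ultra_eval_bidual[of y R, OF y]
    unfolding arens_regular_def by blast
  then have eq: "ultra_eval x (\<lambda>\<phi>. ultra_eval y (\<lambda>\<psi>. f (\<phi> * \<psi>)))
      = ultra_eval y (\<lambda>\<psi>. ultra_eval x (\<lambda>\<phi>. f (\<phi> * \<psi>)))"
  proof -
    have "f \<in> vcarrier adual" using f adual_carrier by blast
    then show ?thesis
      using fun_cong[OF \<open>arens_fst sc _ _ = _\<close>, of f] by (simp add: arens_fst_def arens_snd_def)
  qed
  have app: "ultra_eval y (\<lambda>\<psi>. f (\<phi> * \<psi>)) = Lim ultra (\<lambda>j. f (\<phi> * y j))"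
    "ultra_eval x (\<lambda>\<phi>. f (\<phi> * \<psi>)) = Lim ultra (\<lambda>j. f (x j * \<psi>))" for \<phi> \<psi>
    by (rule ultra_eval_apply, rule functional_mult_left[OF f])
      (rule ultra_eval_apply, rule functional_mult_right[OF f])
  \<comment> \<open>\<open>ultra_eval\<close> is unspecified outside the carrier of the dual, so the
    inner functions must be shown to be bounded functionals before the outer limit can be evaluated;
    the common bound \<open>K * R\<close> provides this.\<close>
  have "functional (K * R) (\<lambda>\<phi>. f (\<phi> * y j)) \<and> functional (K * R) (\<lambda>\<psi>. f (x j * \<psi>))" for j
    using functional_mult_right[OF f, of "y j"] functional_mult_left[OF f, of "x j"] x[of j] y[of j]
      functionalD(1)[OF f] functional_mono mult_left_mono by blast+
  then have F: "functional (K * R) (\<lambda>\<phi>. ultra_eval y (\<lambda>\<psi>. f (\<phi> * \<psi>)))"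
    "functional (K * R) (\<lambda>\<psi>. ultra_eval x (\<lambda>\<phi>. f (\<phi> * \<psi>)))"
    using functional_ultra_limit(1)[of "K * R" "\<lambda>j \<phi>. f (\<phi> * y j)"]
      functional_ultra_limit(1)[of "K * R" "\<lambda>j \<psi>. f (x j * \<psi>)"]
    unfolding app by blast+
  have "ultra_eval y (\<lambda>\<psi>. f (x i * \<psi>)) = f (x i)" "ultra_eval x (\<lambda>\<phi>. f (\<phi> * y i)) = f (y i)" for i
    by (intro ultra_eval_eqI[OF functional_mult_left[OF f]] ultra_eval_eqI[OF functional_mult_right[OF f]]
        tendsto_ultra functional_tendsto[OF f] xy)+
  then have "ultra_eval x (\<lambda>\<phi>. ultra_eval y (\<lambda>\<psi>. f (\<phi> * \<psi>))) = ultra_eval x f"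
    "ultra_eval y (\<lambda>\<psi>. ultra_eval x (\<lambda>\<phi>. f (\<phi> * \<psi>))) = ultra_eval y f"
    by (simp_all add: ultra_eval_apply[OF F(1)] ultra_eval_apply[OF F(2)] ultra_eval_apply[OF f])
  then show False using eq ne by simp
qed

subsection \<open>The quotient by the weakly almost periodic functionals\<close>

definition wap_coset :: "('a \<Rightarrow> 'k) \<Rightarrow> ('a \<Rightarrow> 'k) set" where
  "wap_coset f = {(\<lambda>x. f x + w x) | w. w \<in> WAP sc}"

abbreviation wap_quotient :: "('k, ('a \<Rightarrow> 'k) set) nspace" where
  "wap_quotient \<equiv> quotient_space adual (WAP sc)"

lemma WAP_functional: "w \<in> WAP sc \<Longrightarrow> \<exists>K. functional K w"
  using adual_carrier by (auto simp: WAP_def)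

lemma WAP_add: "v \<in> WAP sc \<Longrightarrow> w \<in> WAP sc \<Longrightarrow> (\<lambda>x. v x + w x) \<in> WAP sc"
  using WAP_combination[of v w 1] by simp

lemma WAP_scale: "w \<in> WAP sc \<Longrightarrow> (\<lambda>x. c * w x) \<in> WAP sc"
  using WAP_combination[OF WAP_zero, of w c] by simp

lemma wap_cosetI: "w \<in> WAP sc \<Longrightarrow> (\<lambda>x. f x + w x) \<in> wap_coset f"
  unfolding wap_coset_def by blast

lemma self_in_wap_coset: "f \<in> wap_coset f"
  unfolding wap_coset_def using WAP_zero by force

lemma wap_quotient_carrier: "C \<in> vcarrier wap_quotient \<longleftrightarrow> (\<exists>K f. functional K f \<and> C = wap_coset f)"
proof -
  have "vcarrier wap_quotient = {wap_coset f | f. f \<in> vcarrier adual}"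
    by (simp add: quotient_space_def adual_simps wap_coset_def)
  then show ?thesis by (auto simp: adual_carrier)
qed

lemma wap_quotient_add: "vadd wap_quotient (wap_coset f) (wap_coset g) = wap_coset (\<lambda>x. f x + g x)"
proof (intro equalityI subsetI)
  fix u assume "u \<in> vadd wap_quotient (wap_coset f) (wap_coset g)"
  then obtain v w where vw: "v \<in> WAP sc" "w \<in> WAP sc" "u = (\<lambda>x. (f x + v x) + (g x + w x))"
    by (auto simp: quotient_space_def adual_simps wap_coset_def)
  then have "u = (\<lambda>x. (f x + g x) + (v x + w x))" by (auto simp: algebra_simps)
  then show "u \<in> wap_coset (\<lambda>x. f x + g x)" using wap_cosetI[OF WAP_add[OF vw(1,2)]] by simp
next
  fix u assume "u \<in> wap_coset (\<lambda>x. f x + g x)"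
  then obtain w where w: "w \<in> WAP sc" "u = (\<lambda>x. f x + (g x + w x))"
    by (auto simp: wap_coset_def algebra_simps)
  then have "(\<lambda>x. g x + w x) \<in> wap_coset g" by (auto simp: wap_coset_def)
  then show "u \<in> vadd wap_quotient (wap_coset f) (wap_coset g)"
    using self_in_wap_coset[of f] w(2) by (auto simp: quotient_space_def adual_simps)
qed

lemma wap_quotient_scale: "vscale wap_quotient c (wap_coset f) = wap_coset (\<lambda>x. c * f x)"
proof (intro equalityI subsetI)
  fix u assume "u \<in> vscale wap_quotient c (wap_coset f)"
  then obtain v w where vw: "v \<in> WAP sc" "w \<in> WAP sc" "u = (\<lambda>x. c * (f x + v x) + w x)"
    by (auto simp: quotient_space_def adual_simps wap_coset_def)
  then have "u = (\<lambda>x. c * f x + (c * v x + w x))" by (auto simp: algebra_simps)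
  then show "u \<in> wap_coset (\<lambda>x. c * f x)"
    using wap_cosetI[OF WAP_add[OF WAP_scale[OF vw(1)] vw(2)]] by simp
next
  fix u assume "u \<in> wap_coset (\<lambda>x. c * f x)"
  then show "u \<in> vscale wap_quotient c (wap_coset f)"
    using self_in_wap_coset[of f] by (auto simp: quotient_space_def adual_simps wap_coset_def)
qed

lemma wap_quotient_closed:
  assumes "C \<in> vcarrier wap_quotient" "D \<in> vcarrier wap_quotient"
  shows "vadd wap_quotient C D \<in> vcarrier wap_quotient" "vscale wap_quotient c C \<in> vcarrier wap_quotient"
proof -
  obtain f K g K' where f: "functional K f" "C = wap_coset f" "functional K' g" "D = wap_coset g"
    using assms by (auto simp: wap_quotient_carrier)
  then show "vadd wap_quotient C D \<in> vcarrier wap_quotient" "vscale wap_quotient c C \<in> vcarrier wap_quotient"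
    using functional_add[OF f(1,3)] functional_scale[OF f(1)]
    unfolding f wap_quotient_add wap_quotient_scale wap_quotient_carrier by blast+
qed

text \<open>The quotient norm is an infimum over representatives, and the dual norm of each of them
  is one of its admissible bounds \<open>K\<close>.\<close>

lemma wap_quotient_norm_ge:
  assumes "C \<in> vcarrier wap_quotient" and "\<And>K f. f \<in> C \<Longrightarrow> functional K f \<Longrightarrow> m \<le> K"
  shows "m \<le> vnorm wap_quotient C"
proof -
  obtain f K where f: "functional K f" "C = wap_coset f" using assms(1) by (auto simp: wap_quotient_carrier)
  have "m \<le> vnorm adual g" if g: "g \<in> C" for g
  proof -
    obtain w where "w \<in> WAP sc" "g = (\<lambda>x. f x + w x)" using g f(2) by (auto simp: wap_coset_def)
    then obtain K' where "functional K' g" using functional_add[OF f(1)] WAP_functional by blast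
    then show ?thesis using assms(2)[OF g functional_adual_norm(1)] by blast
  qed
  moreover have "C \<noteq> {}" using self_in_wap_coset f(2) by blast
  ultimately show ?thesis unfolding quotient_space_def by (simp add: cINF_greatest)
qed

text \<open>An additive map that vanishes on \<open>WAP\<close> is constant on cosets, so any choice
  of representatives gives the induced map. The estimate is divided by \<open>M\<close> to become a
  lower bound for the infimum in the quotient norm.\<close>

lemma wap_quotient_onto_linf:
  fixes T0 :: "('a \<Rightarrow> 'k) \<Rightarrow> nat \<Rightarrow> 'k"
  assumes T0: "\<And>K f k. functional K f \<Longrightarrow> norm (T0 f k) \<le> M * K" and "M > 0"
    and add: "\<And>K f K' g. functional K f \<Longrightarrow> functional K' g \<Longrightarrow> T0 (\<lambda>x. f x + g x) = (\<lambda>k. T0 f k + T0 g k)"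
    and scale: "\<And>K f c. functional K f \<Longrightarrow> T0 (\<lambda>x. c * f x) = (\<lambda>k. c * T0 f k)"
    and wap: "\<And>w. w \<in> WAP sc \<Longrightarrow> T0 w = (\<lambda>k. 0)"
    and onto: "\<And>c. bounded (range c) \<Longrightarrow> \<exists>K f. functional K f \<and> T0 f = c"
  shows "\<exists>T. bounded_linear_onto wap_quotient (linf :: ('k, nat \<Rightarrow> 'k) nspace) T"
proof -
  define T where "T = (\<lambda>C. T0 (SOME f. f \<in> C))"
  have eq: "T0 g = T0 f" if g: "g \<in> wap_coset f" and f: "functional K f" for f g K
  proof -
    obtain w K' where w: "w \<in> WAP sc" "functional K' w" "g = (\<lambda>x. f x + w x)"
      using g WAP_functional unfolding wap_coset_def by blast
    then show ?thesis using add[OF f w(2)] wap by simp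
  qed
  have T: "T (wap_coset f) = T0 f" if f: "functional K f" for f K
    unfolding T_def by (rule eq[OF someI[of "\<lambda>g. g \<in> wap_coset f", OF self_in_wap_coset] f])
  have bd: "bounded (range (T0 f))" if "functional K f" for f K
    using T0[OF that] by (auto simp: bounded_iff)
  have "bounded_linear_map wap_quotient linf T"
    unfolding bounded_linear_map_def
  proof (intro conjI ballI allI exI)
    fix C assume C: "C \<in> vcarrier wap_quotient"
    then obtain f K where f: "functional K f" "C = wap_coset f" by (auto simp: wap_quotient_carrier)
    show "T C \<in> vcarrier linf" using bd[OF f(1)] by (simp add: f(2) T[OF f(1)] linf_simps)
    show "T (vscale wap_quotient c C) = vscale linf c (T C)" for c
      by (simp add: f(2) wap_quotient_scale T[OF f(1)] T[OF functional_scale[OF f(1)]] linf_simps scale[OF f(1)])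
    have "vnorm linf (T C) / M \<le> vnorm wap_quotient C"
    proof (rule wap_quotient_norm_ge[OF C])
      fix K' g assume g: "g \<in> C" "functional K' g"
      have "vnorm linf (T0 g) \<le> M * K'" using T0[OF g(2)] by (rule linf_norm_le)
      moreover have "T C = T0 g" using eq[of g f, OF _ f(1)] g(1) by (simp add: f(2) T[OF f(1)])
      ultimately show "vnorm linf (T C) / M \<le> K'" using \<open>M > 0\<close> by (simp add: field_simps)
    qed
    then show "vnorm linf (T C) \<le> M * vnorm wap_quotient C" using \<open>M > 0\<close> by (simp add: field_simps)
    fix D assume "D \<in> vcarrier wap_quotient"
    then obtain g K' where g: "functional K' g" "D = wap_coset g" by (auto simp: wap_quotient_carrier)
    show "T (vadd wap_quotient C D) = vadd linf (T C) (T D)"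
      by (simp add: f(2) g(2) wap_quotient_add T[OF f(1)] T[OF g(1)] T[OF functional_add[OF f(1) g(1)]]
          linf_simps add[OF f(1) g(1)])
  qed
  moreover have "T ` vcarrier wap_quotient = vcarrier linf"
  proof (intro equalityI subsetI)
    show "c \<in> vcarrier linf" if "c \<in> T ` vcarrier wap_quotient" for c
      using that calculation by (auto simp: bounded_linear_map_def)
    fix c :: "nat \<Rightarrow> 'k" assume "c \<in> vcarrier linf"
    then obtain K f where f: "functional K f" "T0 f = c" using onto[of c] by (auto simp: linf_simps)
    then have "wap_coset f \<in> vcarrier wap_quotient" "T (wap_coset f) = c"
      using wap_quotient_carrier T[OF f(1)] by auto
    then show "c \<in> T ` vcarrier wap_quotient" by blast
  qed
  ultimately show ?thesis unfolding bounded_linear_onto_def by blast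
qed

section \<open>Separable algebras and extreme non-regularity\<close>

lemma separable_dense_sequence_in_unit_ball:
  assumes "separable_space (euclidean :: 'a topology)"
  obtains b :: "nat \<Rightarrow> 'a" where "\<And>n. norm (b n) \<le> 1" "\<And>x. norm x \<le> 1 \<Longrightarrow> x \<in> closure (range b)"
proof -
  obtain C :: "'a set" where C: "countable C" "closure C = UNIV"
    using assms by (auto simp: separable_space_def euclidean_closure_of)
  then have Cne: "C \<noteq> {}" by auto
  \<comment> \<open>A continuous retraction onto the unit ball; it maps a dense set to a dense
    subset of the ball.\<close>
  define r where "r = (\<lambda>x::'a. x /\<^sub>R max 1 (norm x))"
  define b where "b = (\<lambda>n. r (from_nat_into C n))"
  have "range b = r ` range (from_nat_into C)" by (simp add: b_def image_image)
  then have rb: "range b = r ` C" using range_from_nat_into[OF Cne C(1)] by simp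
  have cont: "continuous_on UNIV r"
    unfolding r_def by (intro continuous_intros) auto
  show thesis
  proof
    show "norm (b n) \<le> 1" for n by (simp add: b_def r_def divide_simps)
    fix x :: 'a assume "norm x \<le> 1"
    then have "r x = x" by (simp add: r_def max_def)
    moreover have "r ` closure C \<subseteq> closure (r ` C)"
      using cont C(2) by (intro image_closure_subset[of _ r]) (auto simp: closure_subset)
    ultimately show "x \<in> closure (range b)" using C(2) rb by (metis UNIV_I image_subset_iff)
  qed
qed

text \<open>A separable space has its dual embedded isometrically in \<open>\<ell>\<^sup>\<infinity>\<close> by evaluation at a sequence
  that is dense in the unit ball; the required subspace is the preimage of this copy of the dual.\<close>

lemma extremely_non_arens_regularI:
  assumes T: "bounded_linear_onto wap_quotient linf T"
    and sep: "separable_space (euclidean :: 'a topology)"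
  shows "extremely_non_arens_regular sc"
proof -
  obtain b :: "nat \<Rightarrow> 'a" where b: "\<And>n. norm (b n) \<le> 1" "\<And>x. norm x \<le> 1 \<Longrightarrow> x \<in> closure (range b)"
    using separable_dense_sequence_in_unit_ball[OF sep] by blast
  define J where "J = (\<lambda>(f :: 'a \<Rightarrow> 'k) n. f (b n))"
  have Jle: "norm (J f n) \<le> K" if "functional K f" for f K n
    using functionalD(4)[OF that, of "b n"] mult_left_mono[OF b(1) functionalD(1)[OF that], of n]
    by (simp add: J_def)
  have Jbd: "bounded (range (J f))" if "functional K f" for f K
    using Jle[OF that] by (auto simp: bounded_iff)
  \<comment> \<open>By density of \<open>b\<close> in the ball, a functional is bounded by the sup
    norm of its image under \<open>J\<close>. Together with \<open>Jle\<close> this makes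
    \<open>J\<close> isometric.\<close>
  have Jnorm: "functional M f" if f: "functional K f" and M: "\<And>n. norm (J f n) \<le> M" for f K M
  proof (rule functional_unit_ball_bound[OF f])
    fix x :: 'a assume "norm x \<le> 1"
    then obtain s where s: "\<And>n. s n \<in> range b" "s \<longlonglongrightarrow> x" using b(2) closure_sequential by blast
    have "norm (f (s n)) \<le> M" for n using s(1)[of n] M by (auto simp: J_def)
    then show "norm (f x) \<le> M"
      using tendsto_norm[OF functional_tendsto[OF f s(2)]] by (intro LIMSEQ_le_const2) auto
  qed
  have Jinj: "f = g" if "functional K f" "functional K' g" "J f = J g" for f g K K'
  proof -
    define d where "d = (\<lambda>x. f x + (- 1) * g x)"
    have "functional (K + norm (- 1 :: 'k) * K') d"
      unfolding d_def by (intro functional_add functional_scale that)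
    moreover have "norm (J d n) \<le> 0" for n using fun_cong[OF that(3), of n] by (simp add: J_def d_def)
    ultimately have "functional 0 d" by (rule Jnorm)
    then have "d x = 0" for x using functionalD(4)[of 0 d x] by simp
    then show ?thesis by (auto simp: d_def)
  qed
  have Tb: "bounded_linear_map wap_quotient linf T" and Tonto: "T ` vcarrier wap_quotient = vcarrier linf"
    using T by (auto simp: bounded_linear_onto_def)
  then obtain C0 where C0: "\<forall>C\<in>vcarrier wap_quotient. vnorm linf (T C) \<le> C0 * vnorm wap_quotient C"
    unfolding bounded_linear_map_def by blast
  have nn: "0 \<le> vnorm wap_quotient C" if "C \<in> vcarrier wap_quotient" for C
    by (rule wap_quotient_norm_ge[OF that]) (rule functionalD(1))
  \<comment> \<open>A positive constant that still bounds \<open>T\<close>: enlarging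
    \<open>C0\<close> is harmless because quotient norms are nonnegative.\<close>
  define M where "M = max C0 1"
  have M: "vnorm linf (T C) \<le> M * vnorm wap_quotient C" if "C \<in> vcarrier wap_quotient" for C
    using bspec[OF C0 that] mult_right_mono[OF _ nn[OF that], of C0 M] by (simp add: M_def)
  have M0: "M > 0" by (simp add: M_def)
  have Tadd: "T (vadd wap_quotient C D) = (\<lambda>n. T C n + T D n)"
    if "C \<in> vcarrier wap_quotient" "D \<in> vcarrier wap_quotient" for C D
    using Tb that by (simp add: bounded_linear_map_def linf_simps)
  have Tscale: "T (vscale wap_quotient c C) = (\<lambda>n. c * T C n)" if "C \<in> vcarrier wap_quotient" for C c
    using Tb that by (simp add: bounded_linear_map_def linf_simps)
  have Tbd: "bounded (range (T C))" if "C \<in> vcarrier wap_quotient" for C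
    using Tb that by (simp add: bounded_linear_map_def linf_simps)
  define S where "S = {C \<in> vcarrier wap_quotient. \<exists>K f. functional K f \<and> T C = J f}"
  have SC: "C \<in> vcarrier wap_quotient" if "C \<in> S" for C using that by (simp add: S_def)
  have Jadd: "J (\<lambda>x. f x + g x) = (\<lambda>n. J f n + J g n)" and Jscale: "J (\<lambda>x. c * f x) = (\<lambda>n. c * J f n)" for f g c
    by (simp_all add: J_def)
  have surj: "\<exists>C\<in>S. T C = J f" if f: "functional K f" for f K
  proof -
    have "J f \<in> T ` vcarrier wap_quotient" using Jbd[OF f] Tonto by (simp add: linf_simps)
    then obtain C where "C \<in> vcarrier wap_quotient" "T C = J f" by auto
    then show ?thesis using f unfolding S_def by blast
  qed
  have closed: "closed_subspace wap_quotient S"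
    unfolding closed_subspace_def
  proof (intro conjI ballI allI impI)
    show "S \<subseteq> vcarrier wap_quotient" using SC by blast
    show "S \<noteq> {}" using surj[OF functional_zero] by blast
    fix C assume C: "C \<in> S"
    then obtain f K where f: "functional K f" "T C = J f" by (auto simp: S_def)
    show "vscale wap_quotient c C \<in> S" for c
    proof -
      have "T (vscale wap_quotient c C) = J (\<lambda>x. c * f x)"
        using Tscale[OF SC[OF C], of c] f(2) Jscale[of c f] by simp
      then show ?thesis
        using wap_quotient_closed(2)[OF SC[OF C] SC[OF C], of c] functional_scale[OF f(1), of c]
        unfolding S_def by blast
    qed
    fix D assume D: "D \<in> S"
    then obtain g K' where g: "functional K' g" "T D = J g" by (auto simp: S_def)
    have "T (vadd wap_quotient C D) = J (\<lambda>x. f x + g x)"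
      using Tadd[OF SC[OF C] SC[OF D]] f(2) g(2) Jadd[of f g] by simp
    then show "vadd wap_quotient C D \<in> S"
      using wap_quotient_closed(1)[OF SC[OF C] SC[OF D]] functional_add[OF f(1) g(1)]
      unfolding S_def by blast
  next
    fix C assume C: "C \<in> vcarrier wap_quotient" and "\<forall>\<epsilon>>0. \<exists>D\<in>S. vdist wap_quotient C D < \<epsilon>"
    then have "\<forall>m::nat. \<exists>D\<in>S. vdist wap_quotient C D < inverse (Suc m)" by simp
    then obtain D where D: "\<And>m. D m \<in> S" "\<And>m. vdist wap_quotient C (D m) < inverse (Suc m)" by metis
    then have "\<exists>K f. functional K f \<and> T (D m) = J f" for m by (auto simp: S_def)
    then obtain f where f: "\<And>m. \<exists>K. functional K (f m)" "\<And>m. T (D m) = J (f m)" by metis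
    \<comment> \<open>The images \<open>J (f m)\<close> approach \<open>T C\<close> in the sup norm.
      Therefore the \<open>f m\<close> are uniformly bounded, and their pointwise limit
      \<open>g\<close> along \<open>ultra\<close> satisfies \<open>J g = T C\<close>: the copy of
      the dual is closed.\<close>
    have close: "norm (T C n - J (f m) n) \<le> M * inverse (Suc m)" for n m
    proof -
      define E where "E = vadd wap_quotient C (vscale wap_quotient (- 1) (D m))"
      have Dm: "vscale wap_quotient (- 1) (D m) \<in> vcarrier wap_quotient"
        using wap_quotient_closed(2) SC D(1) by blast
      have E: "E \<in> vcarrier wap_quotient" unfolding E_def by (rule wap_quotient_closed(1)[OF C Dm])
      have "T E = (\<lambda>n. T C n - J (f m) n)"
        unfolding E_def Tadd[OF C Dm] Tscale[OF SC[OF D(1)]] f(2) by simp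
      then have "norm (T C n - J (f m) n) \<le> vnorm linf (T E)"
        using norm_le_linf_norm[OF Tbd[OF E], of n] by simp
      also have "\<dots> \<le> M * vnorm wap_quotient E" by (rule M[OF E])
      also have "\<dots> \<le> M * inverse (Suc m)"
        using D(2)[of m] M0 by (intro mult_left_mono) (auto simp: vdist_def E_def)
      finally show ?thesis .
    qed
    obtain R where R: "\<And>n. norm (T C n) \<le> R" using Tbd[OF C] by (auto simp: bounded_iff)
    have "functional (R + M) (f m)" for m
    proof -
      obtain K where K: "functional K (f m)" using f(1) by blast
      show ?thesis
      proof (rule Jnorm[OF K])
        fix n
        have "norm (J (f m) n) \<le> norm (T C n) + norm (T C n - J (f m) n)"
          using norm_triangle_ineq4[of "T C n" "T C n - J (f m) n"] by simp
        moreover have "M * inverse (Suc m) \<le> M * 1"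
          using M0 by (intro mult_left_mono) (auto simp: field_simps)
        ultimately show "norm (J (f m) n) \<le> R + M" using R[of n] close[of n m] by simp
      qed
    qed
    note lim = functional_ultra_limit[OF this]
    define g where "g = (\<lambda>x. Lim ultra (\<lambda>m. f m x))"
    have "T C n = J g n" for n
    proof -
      have z: "(\<lambda>m. M * inverse (real (Suc m))) \<longlonglongrightarrow> 0"
        using tendsto_mult_left[OF LIMSEQ_inverse_real_of_nat, of M] by simp
      have "\<forall>\<^sub>F m in sequentially. norm (T C n - J (f m) n) \<le> M * inverse (real (Suc m))"
        by (intro always_eventually allI close)
      then have "(\<lambda>m. T C n - J (f m) n) \<longlonglongrightarrow> 0" using z by (rule Lim_null_comparison)
      then have "(\<lambda>m. T C n - (T C n - J (f m) n)) \<longlonglongrightarrow> T C n - 0" by (intro tendsto_intros)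
      then have "(\<lambda>m. f m (b n)) \<longlonglongrightarrow> T C n" by (simp add: J_def)
      then have "((\<lambda>m. f m (b n)) \<longlongrightarrow> T C n) ultra" by (rule tendsto_ultra)
      moreover have "((\<lambda>m. f m (b n)) \<longlongrightarrow> g (b n)) ultra" unfolding g_def by (rule lim(2))
      ultimately have "T C n = g (b n)" by (rule tendsto_unique[OF ultra(1)])
      then show ?thesis by (simp add: J_def)
    qed
    then have "T C = J g" by auto
    moreover have "functional (R + M) g" unfolding g_def by (rule lim(1))
    ultimately show "C \<in> S" using C unfolding S_def by blast
  qed
  \<comment> \<open>\<open>J\<close> is injective, so the choice is forced: \<open>L\<close> is
    \<open>T\<close> followed by the inverse of \<open>J\<close>.\<close>
  define L where "L = (\<lambda>C. SOME f. (\<exists>K. functional K f) \<and> T C = J f)"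
  have L: "(\<exists>K. functional K (L C)) \<and> T C = J (L C)" if "C \<in> S" for C
  proof -
    have "\<exists>f. (\<exists>K. functional K f) \<and> T C = J f" using that by (auto simp: S_def)
    then show ?thesis unfolding L_def by (rule someI_ex)
  qed
  have Leq: "L C = f" if "C \<in> S" "functional K f" "T C = J f" for C f K
    using L[OF that(1)] Jinj that(2,3) by metis
  have "bounded_linear_onto (subspace_on wap_quotient S) adual L"
    unfolding bounded_linear_onto_def bounded_linear_map_def
  proof (intro conjI ballI allI exI)
    fix C assume "C \<in> vcarrier (subspace_on wap_quotient S)"
    then have C: "C \<in> S" by (simp add: subspace_on_def)
    obtain K where K: "functional K (L C)" and TC: "T C = J (L C)" using L[OF C] by blast
    show "L C \<in> vcarrier adual" using K adual_carrier by blast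
    have "vscale wap_quotient c C \<in> S" for c using closed C by (simp add: closed_subspace_def)
    then show "L (vscale (subspace_on wap_quotient S) c C) = vscale adual c (L C)" for c
      using Leq[OF _ functional_scale[OF K]] Tscale[OF SC[OF C]] TC
      by (simp add: subspace_on_def adual_simps Jscale)
    have "norm (J (L C) n) \<le> vnorm linf (T C)" for n
      using norm_le_linf_norm[OF Tbd[OF SC[OF C]], of n] by (simp add: TC)
    then have "vnorm adual (L C) \<le> vnorm linf (T C)"
      using Jnorm[OF K] functional_adual_norm(2) by blast
    also have "\<dots> \<le> M * vnorm wap_quotient C" by (rule M[OF SC[OF C]])
    finally show "vnorm adual (L C) \<le> M * vnorm (subspace_on wap_quotient S) C" by (simp add: subspace_on_def)
    fix D assume "D \<in> vcarrier (subspace_on wap_quotient S)"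
    then have D: "D \<in> S" by (simp add: subspace_on_def)
    obtain K' where K': "functional K' (L D)" and TD: "T D = J (L D)" using L[OF D] by blast
    have "vadd wap_quotient C D \<in> S" using closed C D by (simp add: closed_subspace_def)
    then show "L (vadd (subspace_on wap_quotient S) C D) = vadd adual (L C) (L D)"
      using Leq[OF _ functional_add[OF K K']] Tadd[OF SC[OF C] SC[OF D]] TC TD
      by (simp add: subspace_on_def adual_simps Jadd)
  next
    show "L ` vcarrier (subspace_on wap_quotient S) = vcarrier adual"
    proof (intro equalityI subsetI)
      show "f \<in> vcarrier adual" if "f \<in> L ` vcarrier (subspace_on wap_quotient S)" for f
        using that L adual_carrier by (auto simp: subspace_on_def)
      fix f assume "f \<in> vcarrier adual"
      then obtain K where f: "functional K f" using adual_carrier by blast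
      then obtain C where C: "C \<in> S" "T C = J f" using surj by blast
      then have "L C = f" using Leq f by blast
      then show "f \<in> L ` vcarrier (subspace_on wap_quotient S)" using C(1) by (auto simp: subspace_on_def)
    qed
  qed
  then show ?thesis using closed unfolding extremely_non_arens_regular_def by blast
qed

end

theorem theorem4p4:
  fixes sc :: "'k::{real_normed_field, euclidean_space} \<Rightarrow> 'a::{real_normed_algebra, banach} \<Rightarrow> 'a"
    and B :: "'a set"
    and D :: "'i set" and le :: "'i \<Rightarrow> 'i \<Rightarrow> bool" and e :: "'i \<Rightarrow> 'a"
  assumes "banach_algebra sc"
    and "closed_subalgebra sc B"
    and "\<not> unital B"
    and "weakly_sequentially_complete (subspace_on (alg_space sc) B)"
    and "bounded_approximate_identity B D le e"
  shows "(\<exists>T. bounded_linear_onto (quotient_space (dual (alg_space sc)) (WAP sc)) linf T) \<and>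
         \<not> arens_regular sc \<and>
         (separable_space (euclidean :: 'a topology) \<longrightarrow> extremely_non_arens_regular sc)"
proof -
  interpret banach_algebra sc by fact
  obtain R and x y :: "nat \<Rightarrow> nat \<Rightarrow> 'a" where x: "\<And>k j. norm (x k j) \<le> R" and y: "\<And>k j. norm (y k j) \<le> R"
    and xy: "\<And>k i. (\<lambda>j. x k i * y k j) \<longlonglongrightarrow> x k i" "\<And>k j. (\<lambda>i. x k i * y k j) \<longlonglongrightarrow> y k j"
    and interp: "\<And>c. bounded (range c) \<Longrightarrow> \<exists>K f. functional K f \<and> (\<forall>k j. f (x k j) = c k \<and> f (y k j) = 0)"
  proof -
    obtain R and x y :: "nat \<Rightarrow> nat \<Rightarrow> 'a" where "(\<forall>k j. norm (x k j) \<le> R) \<and> (\<forall>k j. norm (y k j) \<le> R) \<and>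
      (\<forall>k i. (\<lambda>j. x k i * y k j) \<longlonglongrightarrow> x k i) \<and> (\<forall>k j. (\<lambda>i. x k i * y k j) \<longlonglongrightarrow> y k j) \<and>
      (\<forall>c :: nat \<Rightarrow> 'k. bounded (range c) \<longrightarrow>
        (\<exists>K f. functional K f \<and> (\<forall>(k :: nat) (j :: nat). f (x k j) = c k \<and> f (y k j) = 0)))"
      using interpolating_approximate_units_exist[OF assms(2-5)] by (elim exE)
    then show thesis by (intro that[of x R y]) blast+
  qed
  have R: "R \<ge> 0" using x[of 0 0] norm_ge_zero order_trans by blast
  \<comment> \<open>A functional that is \<open>c k\<close> on the block \<open>x k\<close> and 0 on
    the block \<open>y k\<close> is mapped to \<open>c\<close>, whence surjectivity.\<close>
  define T0 where "T0 = (\<lambda>f k. ultra_eval (x k) f - ultra_eval (y k) f)"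
  have ev: "ultra_eval (x k) f = c k" "ultra_eval (y k) f = 0"
    if "functional K f" "\<forall>k j. f (x k j) = c k \<and> f (y k j) = 0" for K f c k
    using that by (auto intro!: ultra_eval_eqI[OF that(1)])
  \<comment> \<open>The natural bound for \<open>T0\<close> is \<open>2 * R\<close>; adding 1 makes
    it positive also when \<open>R = 0\<close>.\<close>
  have onto: "\<exists>T. bounded_linear_onto wap_quotient (linf :: ('k, nat \<Rightarrow> 'k) nspace) T"
  proof (rule wap_quotient_onto_linf[of T0 "2 * R + 1"])
    show "norm (T0 f k) \<le> (2 * R + 1) * K" if f: "functional K f" for K f k
    proof -
      have "norm (T0 f k) \<le> R * K + R * K"
        using norm_triangle_ineq4[of "ultra_eval (x k) f" "ultra_eval (y k) f"]
          ultra_eval_linear(3)[of "x k" R, OF x f f] ultra_eval_linear(3)[of "y k" R, OF y f f]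
        unfolding T0_def by linarith
      also have "\<dots> \<le> (2 * R + 1) * K" using functionalD(1)[OF f] by (simp add: algebra_simps)
      finally show ?thesis .
    qed
    show "T0 (\<lambda>x. f x + g x) = (\<lambda>k. T0 f k + T0 g k)" if "functional K f" "functional K' g" for K f K' g
      using ultra_eval_linear(1)[of "x _" R, OF x that] ultra_eval_linear(1)[of "y _" R, OF y that]
      by (auto simp: T0_def)
    show "T0 (\<lambda>x. c * f x) = (\<lambda>k. c * T0 f k)" if "functional K f" for K f c
      using ultra_eval_linear(2)[of "x _" R, OF x that that] ultra_eval_linear(2)[of "y _" R, OF y that that]
      by (auto simp: T0_def right_diff_distrib)
    show "T0 w = (\<lambda>k. 0)" if "w \<in> WAP sc" for w
      using WAP_double_limit[of w "x _" R "y _", OF that x y xy] by (auto simp: T0_def)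
    show "\<exists>K f. functional K f \<and> T0 f = c" if "bounded (range c)" for c
    proof -
      obtain K f where f: "functional K f" "\<forall>k j. f (x k j) = c k \<and> f (y k j) = 0"
        using interp[OF \<open>bounded (range c)\<close>] by blast
      have "T0 f = c" using ev[OF f] by (auto simp: T0_def)
      then show ?thesis using f(1) by blast
    qed
  qed (use R in simp)
  moreover have "\<not> arens_regular sc"
  proof -
    \<comment> \<open>The constant sequence 1 and the pair of blocks with index 0 suffice to tell
      the Arens products apart.\<close>
    obtain K f where f: "functional K f" "\<forall>k j. f (x k j) = 1 \<and> f (y k j) = 0"
      using interp[of "\<lambda>_. 1"] by auto
    then have "ultra_eval (x 0) f \<noteq> ultra_eval (y 0) f" using ev[of K f "\<lambda>_. 1" 0] by simp
    then show ?thesis using arens_products_differ[of "x 0" R "y 0", OF x y xy f(1)] by blast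
  qed
  ultimately show ?thesis using extremely_non_arens_regularI by blast
qed

end
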